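(* Let $(M,\varphi,\xi,\eta,g)$ be a paracontact metric manifold. Then $M$ is $H$-paracontact (that is, its Reeb vector field $\xi$ is a harmonic vector field) if and only if $\xi$ is an eigenvector of the Ricci operator $Q$ at every point (that is, $Q\xi$ is collinear to $\xi$).
   Context: All manifolds are smooth and connected. A $(2n+1)$-dimensional contact manifold is a manifold $M^{2n+1}$ with a global 1-form $\eta$ such that $\eta\wedge(d\eta)^n\neq 0$ everywhere; its Reeb vector field $\xi$ is the unique vector field with $\eta(\xi)=1$, $d\eta(\xi,\cdot)=0$. A paracontact metric structure $(\varphi,\xi,\eta,g)$ on $M$ consists of such $\eta,\xi$, a semi-Riemannian metric $g$ and a $(1,1)$-tensor $\varphi$ with $\eta=g(\xi,\cdot)$, $d\eta(\cdot,\cdot)=g(\cdot,\varphi\,\cdot)$, $\varphi^2=I-\eta\otimes\xi$ (here $2\,d\eta(X,Y)=X\eta(Y)-Y\eta(X)-\eta([X,Y])$). $\nabla$ is the Levi-Civita connection of $g$; $Q$ is the Ricci operator, $g(QX,Y)=\varrho(X,Y)$ with $\varrho$ the usual Ricci tensor. Harmonic vector fields: the energy of a vector field $V$ on $(M,g)$ is the energy of the map $V:(M,g)\to(TM,g^s)$, $g^s$ the Sasaki metric (computed over relatively compact domains if $M$ is non-compact). A vector field $V$ of constant length $g(V,V)=r\neq 0$ is harmonic if it is a critical point of the energy restricted to vector fields of the same constant length $r$; equivalently (Euler–Lagrange equation), $\bar\Delta V$ is collinear to $V$, where $\bar\Delta V=-\mathrm{tr}\,\nabla^2V=\sum_i\varepsilon_i(\nabla_{\nabla_{E_i}E_i}V-\nabla_{E_i}\nabla_{E_i}V)$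 for a local pseudo-orthonormal frame $\{E_i\}$, $\varepsilon_i=g(E_i,E_i)=\pm1$. *)

theory Defs
  imports "HOL-Analysis.Analysis"
begin

section \<open>Smooth maps\<close>

text \<open>Intended for open sets \<open>S\<close>. Derivatives are taken along fixed directions, so that all
  iterated derivatives have the type of \<open>f\<close>.\<close>

primrec Ck_on :: "nat \<Rightarrow> ('a::real_normed_vector \<Rightarrow> 'b::real_normed_vector) \<Rightarrow> 'a set \<Rightarrow> bool" where
  "Ck_on 0 f S \<longleftrightarrow> continuous_on S f"
| "Ck_on (Suc k) f S \<longleftrightarrow>
     (\<forall>x\<in>S. f differentiable (at x)) \<and> (\<forall>v. Ck_on k (\<lambda>x. frechet_derivative f (at x) v) S)"

definition smooth_on :: "'a set \<Rightarrow> ('a::real_normed_vector \<Rightarrow> 'b::real_normed_vector) \<Rightarrow> bool" where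
  "smooth_on S f \<longleftrightarrow> (\<forall>k. Ck_on k f S)"


section \<open>Manifolds and tensor fields\<close>

text \<open>The points of the manifold are the elements of the type \<open>'m\<close>; a chart is a pair
  (domain, coordinate map). The index type \<open>'d\<close> of the coordinates is finite and linearly
  ordered (like \<open>1, \<dots>, m\<close>); the order has no bearing on any definition, but the change of variables
  theorems of the library are stated for such index types.\<close>

type_synonym ('m, 'd) chart = "'m set \<times> ('m \<Rightarrow> real^'d)"

definition chart_image :: "('m, 'd) chart \<Rightarrow> (real^'d) set" where
  "chart_image c = snd c ` fst c"

definition chart_inv :: "('m, 'd) chart \<Rightarrow> real^'d \<Rightarrow> 'm" where
  "chart_inv c = inv_into (fst c) (snd c)"

definition overlap :: "('m, 'd) chart \<Rightarrow> ('m, 'd) chart \<Rightarrow> (real^'d) set" where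
  "overlap c c' = snd c ` (fst c \<inter> fst c')"

definition transition :: "('m, 'd) chart \<Rightarrow> ('m, 'd) chart \<Rightarrow> real^'d \<Rightarrow> real^'d" where
  "transition c c' = snd c' \<circ> chart_inv c"

definition smooth_manifold :: "('m::{t2_space, second_countable_topology}, 'd::finite) chart set \<Rightarrow> bool" where
  "smooth_manifold \<A> \<longleftrightarrow>
     (\<forall>c\<in>\<A>. open (fst c) \<and> open (chart_image c) \<and>
        homeomorphism (fst c) (chart_image c) (snd c) (chart_inv c)) \<and>
     (\<Union>c\<in>\<A>. fst c) = UNIV \<and>
     (\<forall>c\<in>\<A>. \<forall>c'\<in>\<A>. smooth_on (overlap c c') (transition c c'))"

text \<open>A tensor field is the family of its component functions, one for each chart of the atlas and
  each expressed in the coordinates of that chart, obeying the transformation law of its type. Values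
  outside the atlas or outside the image of the chart carry no meaning.\<close>

type_synonym ('m, 'd, 'v) field = "('m, 'd) chart \<Rightarrow> real^'d \<Rightarrow> 'v"

definition transforms ::
    "('m, 'd::finite) chart set \<Rightarrow> ('m, 'd, 'v) field \<Rightarrow> (real^'d^'d \<Rightarrow> 'v \<Rightarrow> 'v \<Rightarrow> bool) \<Rightarrow> bool" where
  "transforms \<A> T law \<longleftrightarrow> (\<forall>c\<in>\<A>. \<forall>c'\<in>\<A>. \<forall>x\<in>overlap c c'.
     law (jacobian (transition c c') (at x)) (T c x) (T c' (transition c c' x)))"

definition smooth_field ::
    "('m, 'd::finite) chart set \<Rightarrow> ('m, 'd, 'v::real_normed_vector) field \<Rightarrow> bool" where
  "smooth_field \<A> T \<longleftrightarrow> (\<forall>c\<in>\<A>. smooth_on (chart_image c) (T c))"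

definition vector_field :: "('m, 'd::finite) chart set \<Rightarrow> ('m, 'd, real^'d) field \<Rightarrow> bool" where
  "vector_field \<A> X \<longleftrightarrow> smooth_field \<A> X \<and> transforms \<A> X (\<lambda>J v v'. v' = J *v v)"

definition one_form :: "('m, 'd::finite) chart set \<Rightarrow> ('m, 'd, real^'d) field \<Rightarrow> bool" where
  "one_form \<A> \<eta> \<longleftrightarrow> smooth_field \<A> \<eta> \<and> transforms \<A> \<eta> (\<lambda>J a a'. a = transpose J *v a')"

definition endomorphism_field :: "('m, 'd::finite) chart set \<Rightarrow> ('m, 'd, real^'d^'d) field \<Rightarrow> bool" where
  "endomorphism_field \<A> F \<longleftrightarrow> smooth_field \<A> F \<and> transforms \<A> F (\<lambda>J a a'. J ** a = a' ** J)"

definition semi_riemannian_metric :: "('m, 'd::finite) chart set \<Rightarrow> ('m, 'd, real^'d^'d) field \<Rightarrow> bool" where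
  "semi_riemannian_metric \<A> g \<longleftrightarrow>
     smooth_field \<A> g \<and> transforms \<A> g (\<lambda>J a a'. a = transpose J ** a' ** J) \<and>
     (\<forall>c\<in>\<A>. \<forall>x\<in>chart_image c. transpose (g c x) = g c x \<and> invertible (g c x))"


section \<open>Calculus in a chart\<close>

text \<open>\<open>G\<close> is the matrix of components of the metric as a function of the coordinates.\<close>

definition metric_at :: "real^'d^'d \<Rightarrow> real^'d \<Rightarrow> real^'d::finite \<Rightarrow> real" where
  "metric_at A u v = u \<bullet> (A *v v)"

definition lie_bracket ::
    "(real^'d \<Rightarrow> real^'d) \<Rightarrow> (real^'d \<Rightarrow> real^'d) \<Rightarrow> real^'d::finite \<Rightarrow> real^'d" where
  "lie_bracket X Y x = frechet_derivative Y (at x) (X x) - frechet_derivative X (at x) (Y x)"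

definition ext_deriv_on_fields ::
    "(real^'d \<Rightarrow> real^'d) \<Rightarrow> (real^'d \<Rightarrow> real^'d) \<Rightarrow> (real^'d \<Rightarrow> real^'d) \<Rightarrow> real^'d::finite \<Rightarrow> real" where
  "ext_deriv_on_fields \<eta> X Y x = (1/2) *
     (frechet_derivative (\<lambda>y. \<eta> y \<bullet> Y y) (at x) (X x)
      - frechet_derivative (\<lambda>y. \<eta> y \<bullet> X y) (at x) (Y x)
      - \<eta> x \<bullet> lie_bracket X Y x)"

text \<open>The exterior derivative and the curvature are tensorial; their values on tangent vectors are
  computed by extending the vectors to fields with constant components.\<close>

definition ext_deriv :: "(real^'d \<Rightarrow> real^'d) \<Rightarrow> real^'d \<Rightarrow> real^'d \<Rightarrow> real^'d::finite \<Rightarrow> real" where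
  "ext_deriv \<eta> x u v = ext_deriv_on_fields \<eta> (\<lambda>_. u) (\<lambda>_. v) x"

text \<open>Christoffel symbols of the Levi-Civita connection as a bilinear map: the vector
  \<open>\<nabla>\<^sub>u v\<close> for fields \<open>u\<close>, \<open>v\<close> with constant components (Koszul formula).\<close>

definition christoffel :: "(real^'d \<Rightarrow> real^'d^'d) \<Rightarrow> real^'d \<Rightarrow> real^'d \<Rightarrow> real^'d \<Rightarrow> real^'d::finite" where
  "christoffel G x u v = matrix_inv (G x) *v (\<chi> k. (1/2) *
     (metric_at (frechet_derivative G (at x) u) v (axis k 1)
      + metric_at (frechet_derivative G (at x) v) u (axis k 1)
      - metric_at (frechet_derivative G (at x) (axis k 1)) u v))"

definition levi_civita ::
    "(real^'d \<Rightarrow> real^'d^'d) \<Rightarrow> (real^'d \<Rightarrow> real^'d) \<Rightarrow> (real^'d \<Rightarrow> real^'d) \<Rightarrow> real^'d \<Rightarrow> real^'d::finite" where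
  "levi_civita G X Y x = frechet_derivative Y (at x) (X x) + christoffel G x (X x) (Y x)"

definition curvature_on_fields ::
    "(real^'d \<Rightarrow> real^'d^'d) \<Rightarrow> (real^'d \<Rightarrow> real^'d) \<Rightarrow> (real^'d \<Rightarrow> real^'d) \<Rightarrow> (real^'d \<Rightarrow> real^'d) \<Rightarrow>
      real^'d \<Rightarrow> real^'d::finite" where
  "curvature_on_fields G X Y Z x =
     levi_civita G X (levi_civita G Y Z) x - levi_civita G Y (levi_civita G X Z) x
     - levi_civita G (lie_bracket X Y) Z x"

definition curvature ::
    "(real^'d \<Rightarrow> real^'d^'d) \<Rightarrow> real^'d \<Rightarrow> real^'d \<Rightarrow> real^'d \<Rightarrow> real^'d \<Rightarrow> real^'d::finite" where
  "curvature G x u v w = curvature_on_fields G (\<lambda>_. u) (\<lambda>_. v) (\<lambda>_. w) x"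

definition ricci_tensor :: "(real^'d \<Rightarrow> real^'d^'d) \<Rightarrow> real^'d \<Rightarrow> real^'d \<Rightarrow> real^'d::finite \<Rightarrow> real" where
  "ricci_tensor G x v w = trace (matrix (\<lambda>u. curvature G x u v w))"

definition ricci_operator :: "(real^'d \<Rightarrow> real^'d^'d) \<Rightarrow> real^'d \<Rightarrow> real^'d \<Rightarrow> real^'d::finite" where
  "ricci_operator G x u = (THE w. \<forall>v. metric_at (G x) w v = ricci_tensor G x u v)"


section \<open>Paracontact metric manifolds\<close>

text \<open>A \<open>k\<close>-form on \<open>'v\<close> is a function of sequences of vectors that depends only on the first
  \<open>k\<close> entries.\<close>

definition wedge :: "nat \<Rightarrow> nat \<Rightarrow> ((nat \<Rightarrow> 'v) \<Rightarrow> real) \<Rightarrow> ((nat \<Rightarrow> 'v) \<Rightarrow> real) \<Rightarrow> (nat \<Rightarrow> 'v) \<Rightarrow> real" where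
  "wedge k l \<alpha> \<beta> v = (1 / (fact k * fact l)) *
     (\<Sum>\<sigma> | \<sigma> permutes {..<k + l}. of_int (sign \<sigma>) * \<alpha> (\<lambda>i. v (\<sigma> i)) * \<beta> (\<lambda>i. v (\<sigma> (k + i))))"

primrec wedge_power_two_form :: "((nat \<Rightarrow> 'v) \<Rightarrow> real) \<Rightarrow> nat \<Rightarrow> (nat \<Rightarrow> 'v) \<Rightarrow> real" where
  "wedge_power_two_form \<omega> 0 = (\<lambda>v. 1)"
| "wedge_power_two_form \<omega> (Suc n) = wedge 2 (2 * n) \<omega> (wedge_power_two_form \<omega> n)"

definition contact_form :: "nat \<Rightarrow> ('m, 'd::finite) chart set \<Rightarrow> ('m, 'd, real^'d) field \<Rightarrow> bool" where
  "contact_form n \<A> \<eta> \<longleftrightarrow> one_form \<A> \<eta> \<and>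
     (\<forall>c\<in>\<A>. \<forall>x\<in>chart_image c.
        wedge 1 (2 * n) (\<lambda>v. \<eta> c x \<bullet> v 0)
          (wedge_power_two_form (\<lambda>v. ext_deriv (\<eta> c) x (v 0) (v 1)) n) \<noteq> (\<lambda>_. 0))"

definition reeb_field ::
    "('m, 'd::finite) chart set \<Rightarrow> ('m, 'd, real^'d) field \<Rightarrow> ('m, 'd, real^'d) field \<Rightarrow> bool" where
  "reeb_field \<A> \<eta> \<xi> \<longleftrightarrow> vector_field \<A> \<xi> \<and>
     (\<forall>c\<in>\<A>. \<forall>x\<in>chart_image c.
        \<eta> c x \<bullet> \<xi> c x = 1 \<and> (\<forall>v. ext_deriv (\<eta> c) x (\<xi> c x) v = 0))"

definition paracontact_metric_manifold ::
    "nat \<Rightarrow> ('m::{t2_space, second_countable_topology}, 'd::finite) chart set \<Rightarrow>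
     ('m, 'd, real^'d^'d) field \<Rightarrow> ('m, 'd, real^'d) field \<Rightarrow> ('m, 'd, real^'d) field \<Rightarrow>
     ('m, 'd, real^'d^'d) field \<Rightarrow> bool" where
  "paracontact_metric_manifold n \<A> \<phi> \<xi> \<eta> g \<longleftrightarrow>
     CARD('d) = 2 * n + 1 \<and> smooth_manifold \<A> \<and> connected (UNIV :: 'm set) \<and>
     contact_form n \<A> \<eta> \<and> reeb_field \<A> \<eta> \<xi> \<and>
     semi_riemannian_metric \<A> g \<and> endomorphism_field \<A> \<phi> \<and>
     (\<forall>c\<in>\<A>. \<forall>x\<in>chart_image c.
        (\<forall>v. \<eta> c x \<bullet> v = metric_at (g c x) (\<xi> c x) v) \<and>
        (\<forall>u v. ext_deriv (\<eta> c) x u v = metric_at (g c x) u (\<phi> c x *v v)) \<and>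
        (\<forall>v. \<phi> c x *v (\<phi> c x *v v) = v - (\<eta> c x \<bullet> v) *\<^sub>R \<xi> c x))"


section \<open>Energy and harmonic vector fields\<close>

text \<open>The volume measure of the metric, with density \<open>sqrt \<bar>det g\<bar>\<close> in each chart.\<close>

definition volume_measure ::
    "('m::{t2_space, second_countable_topology}, 'd::finite) chart set \<Rightarrow> ('m, 'd, real^'d^'d) field \<Rightarrow> 'm measure" where
  "volume_measure \<A> g = (THE \<mu>. sets \<mu> = sets borel \<and>
     (\<forall>c\<in>\<A>. \<forall>B\<in>sets borel. B \<subseteq> fst c \<longrightarrow>
        emeasure \<mu> B = (\<integral>\<^sup>+x\<in>snd c ` B. ennreal (sqrt \<bar>det (g c x)\<bar>) \<partial>lborel)))"

text \<open>Energy density \<open>(1/2) tr\<^sub>G (f\<^sup>* H)\<close> of a map \<open>f\<close> at \<open>x\<close>, where \<open>H y\<close> is the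
  (possibly indefinite) metric of the target at \<open>y\<close>.\<close>

definition map_energy_density ::
    "(real^'d \<Rightarrow> real^'d^'d) \<Rightarrow> ('b \<Rightarrow> 'b \<Rightarrow> 'b \<Rightarrow> real) \<Rightarrow> (real^'d \<Rightarrow> 'b::real_normed_vector) \<Rightarrow>
     real^'d::finite \<Rightarrow> real" where
  "map_energy_density G H f x = (1/2) * (\<Sum>i\<in>UNIV. \<Sum>j\<in>UNIV. matrix_inv (G x) $ i $ j *
     H (f x) (frechet_derivative f (at x) (axis i 1)) (frechet_derivative f (at x) (axis j 1)))"

text \<open>The Sasaki metric in the coordinates of the tangent bundle induced by a chart: a point
  \<open>(x, w)\<close> is the tangent vector \<open>w\<close> at \<open>x\<close>, and a tangent vector \<open>(a, b)\<close> at \<open>(x, w)\<close> has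
  horizontal part \<open>a\<close> and vertical part \<open>b + \<Gamma>\<^sub>x(a, w)\<close>.\<close>

definition sasaki_metric ::
    "(real^'d \<Rightarrow> real^'d^'d) \<Rightarrow> (real^'d) \<times> (real^'d) \<Rightarrow> (real^'d) \<times> (real^'d) \<Rightarrow>
     (real^'d) \<times> (real^'d::finite) \<Rightarrow> real" where
  "sasaki_metric G p s t = metric_at (G (fst p)) (fst s) (fst t) +
     metric_at (G (fst p)) (snd s + christoffel G (fst p) (fst s) (snd p))
                           (snd t + christoffel G (fst p) (fst t) (snd p))"

text \<open>The value does not depend on the chart chosen to compute it.\<close>

definition energy_density ::
    "('m, 'd::finite) chart set \<Rightarrow> ('m, 'd, real^'d^'d) field \<Rightarrow> ('m, 'd, real^'d) field \<Rightarrow> 'm \<Rightarrow> real" where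
  "energy_density \<A> g V p = (let c = (SOME c. c \<in> \<A> \<and> p \<in> fst c) in
     map_energy_density (g c) (sasaki_metric (g c)) (\<lambda>x. (x, V c x)) (snd c p))"

definition energy ::
    "('m::{t2_space, second_countable_topology}, 'd::finite) chart set \<Rightarrow> ('m, 'd, real^'d^'d) field \<Rightarrow>
     'm set \<Rightarrow> ('m, 'd, real^'d) field \<Rightarrow> real" where
  "energy \<A> g D V = set_lebesgue_integral (volume_measure \<A> g) D (energy_density \<A> g V)"

definition constant_length_field ::
    "('m, 'd::finite) chart set \<Rightarrow> ('m, 'd, real^'d^'d) field \<Rightarrow> real \<Rightarrow> ('m, 'd, real^'d) field \<Rightarrow> bool" where
  "constant_length_field \<A> g r V \<longleftrightarrow> vector_field \<A> V \<and>
     (\<forall>c\<in>\<A>. \<forall>x\<in>chart_image c. metric_at (g c x) (V c x) (V c x) = r)"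

text \<open>Smooth one-parameter variations of \<open>V\<close> among the fields of length \<open>r\<close>, supported in \<open>K\<close>.\<close>

definition variation ::
    "('m, 'd::finite) chart set \<Rightarrow> ('m, 'd, real^'d^'d) field \<Rightarrow> real \<Rightarrow> ('m, 'd, real^'d) field \<Rightarrow>
     'm set \<Rightarrow> real \<Rightarrow> (real \<Rightarrow> ('m, 'd, real^'d) field) \<Rightarrow> bool" where
  "variation \<A> g r V K \<epsilon> W \<longleftrightarrow> 0 < \<epsilon> \<and>
     (\<forall>t\<in>{-\<epsilon><..<\<epsilon>}. constant_length_field \<A> g r (W t)) \<and>
     (\<forall>c\<in>\<A>. smooth_on ({-\<epsilon><..<\<epsilon>} \<times> chart_image c) (\<lambda>p. W (fst p) c (snd p))) \<and>
     (\<forall>c\<in>\<A>. \<forall>x\<in>chart_image c. W 0 c x = V c x) \<and>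
     (\<forall>t\<in>{-\<epsilon><..<\<epsilon>}. \<forall>c\<in>\<A>. \<forall>x\<in>chart_image c. chart_inv c x \<notin> K \<longrightarrow> W t c x = V c x)"

text \<open>\<open>D\<close> ranges over the relatively compact domains; if the manifold is compact, \<open>D = K = UNIV\<close>
  is allowed and gives the energy of the whole manifold.\<close>

definition harmonic_vector_field ::
    "('m::{t2_space, second_countable_topology}, 'd::finite) chart set \<Rightarrow> ('m, 'd, real^'d^'d) field \<Rightarrow>
     ('m, 'd, real^'d) field \<Rightarrow> bool" where
  "harmonic_vector_field \<A> g V \<longleftrightarrow> (\<exists>r. r \<noteq> 0 \<and> constant_length_field \<A> g r V \<and>
     (\<forall>D K \<epsilon> W. open D \<and> connected D \<and> compact (closure D) \<and> compact K \<and> K \<subseteq> D \<and>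
        variation \<A> g r V K \<epsilon> W \<longrightarrow>
        ((\<lambda>t. energy \<A> g D (W t)) has_real_derivative 0) (at 0)))"

end

theory Submission
  imports Defs
begin

text \<open>The energy density of a field \<open>V\<close> is \<open>(dim M + |\<nabla>V|\<^sup>2) / 2\<close>, so the first variation of the
  energy at \<open>\<xi>\<close> in the direction of a compactly supported field \<open>U\<close> orthogonal to \<open>\<xi>\<close> is the integral
  of \<open>\<langle>\<nabla>\<xi>, \<nabla>U\<rangle> = tr (A\<^sup>* \<nabla>U)\<close> with \<open>A = \<nabla>\<xi>\<close>. Since \<open>\<eta> = g(\<xi>, \<cdot>)\<close> and \<open>d\<eta> = g(\<cdot>, \<phi> \<cdot>)\<close>, the adjoint is
  \<open>A\<^sup>* = A + 2 \<phi>\<close>. The relations \<open>d(d\<eta>) = 0\<close> and \<open>\<phi>\<^sup>2 = I - \<eta> \<otimes> \<xi>\<close> force \<open>div \<xi> = 0\<close> and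
  \<open>(div \<phi>)(U) = 0\<close> for \<open>\<eta>(U) = 0\<close>; commuting covariant derivatives then gives
  \<open>\<langle>\<nabla>\<xi>, \<nabla>U\<rangle> = div (\<nabla>\<^sub>U \<xi> + 2 \<phi> U) - Ric(\<xi>, U)\<close>. By the divergence theorem the first variation is
  \<open>- \<integral> g(Q\<xi>, U)\<close>, which vanishes for every such \<open>U\<close> exactly if \<open>Q\<xi>\<close> is collinear to \<open>\<xi>\<close>.\<close>

section \<open>Calculus of smooth maps\<close>

text \<open>Since the metric is indefinite, orthonormal frames are avoided: contractions are written
  with \<open>matrix_inv (G x)\<close> and turned into traces of endomorphisms, and the recurring
  tool is that metrically adjoint endomorphisms have equal traces. It yields the symmetry of the
  Ricci tensor and both divergence statements: the trace of
  \<open>w \<mapsto> \<phi> (\<nabla>_w \<phi>) v\<close> is zero, so differentiating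
  \<open>\<phi>\<^sup>2\<close> and tracing over w leaves \<open>tr (w \<mapsto> (\<nabla>_w \<phi>)
  (\<phi> v)) = - \<eta>(v) div \<xi>\<close>. Inserting \<xi> for v gives
  \<open>div \<xi> = 0\<close>, because \<phi> annihilates \<xi>; inserting \<open>\<phi> v\<close>
  gives the claim on \<open>div \<phi>\<close>. The divergence theorem is proved for fields
  supported in one chart, where partial derivatives of compactly supported functions integrate to
  zero. Other fields are cut into pieces by bump functions; the pieces keep \<eta>(U) = 0 and
  Ric(\<xi>, U) = 0, both conditions being linear at each point. Conversely, every horizontal test
  field U must be the velocity of a variation of constant length; a rational parametrisation of the
  quadric of unit vectors provides it without square roots or geodesics.\<close>

abbreviation \<D> :: "('a::real_normed_vector \<Rightarrow> 'b::real_normed_vector) \<Rightarrow> 'a \<Rightarrow> 'a \<Rightarrow> 'b" where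
  "\<D> f x \<equiv> frechet_derivative f (at x)"

lemma has_derivative_imp_frechet:
  "(f has_derivative f') (at x) \<Longrightarrow> \<D> f x = f'"
  by (rule frechet_derivative_at[symmetric])

lemma frechet_derivative_worksI:
  "f differentiable (at x) \<Longrightarrow> (f has_derivative \<D> f x) (at x)"
  by (simp add: frechet_derivative_works[symmetric])

text \<open>\<open>frechet_derivative\<close> is a choice among all derivatives at the point, so
  functions that agree nearby have the same candidates and the same value, even where neither is
  differentiable. Identities valid only on a chart image can therefore be differentiated
  there.\<close>

lemma frechet_derivative_cong_open:
  assumes "open S" "x \<in> S" "\<And>y. y \<in> S \<Longrightarrow> f y = g y"
  shows "\<D> f x = \<D> g x"
proof -
  have "(f has_derivative D) (at x) \<longleftrightarrow> (g has_derivative D) (at x)" for D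
    using has_derivative_transform_within_open[OF _ assms(1,2), of f D UNIV g]
      has_derivative_transform_within_open[OF _ assms(1,2), of g D UNIV f] assms(3) by auto
  then show ?thesis by (simp add: frechet_derivative_def)
qed

lemma differentiable_cong_open:
  assumes "open S" "x \<in> S" "\<And>y. y \<in> S \<Longrightarrow> f y = g y"
  shows "f differentiable (at x) \<longleftrightarrow> g differentiable (at x)"
  using has_derivative_transform_within_open[OF _ assms(1,2), of f _ UNIV g]
      has_derivative_transform_within_open[OF _ assms(1,2), of g _ UNIV f] assms(3)
  unfolding differentiable_def by fastforce

section \<open>Closure properties of k times continuously differentiable maps\<close>

lemma Ck_on_cong:
  assumes "open S" "\<And>x. x \<in> S \<Longrightarrow> f x = g x"
  shows "Ck_on k f S \<longleftrightarrow> Ck_on k g S"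
  using assms(2)
proof (induction k arbitrary: f g)
  case 0
  then show ?case by (auto intro: continuous_on_cong)
next
  case (Suc k)
  have "(\<forall>x\<in>S. f differentiable (at x)) \<longleftrightarrow> (\<forall>x\<in>S. g differentiable (at x))"
    using differentiable_cong_open[OF assms(1), of _ f g] Suc.prems by blast
  moreover have "Ck_on k (\<lambda>x. \<D> f x v) S \<longleftrightarrow> Ck_on k (\<lambda>x. \<D> g x v) S" for v
    by (rule Suc.IH) (simp add: frechet_derivative_cong_open[OF assms(1) _ Suc.prems])
  ultimately show ?case by simp
qed

lemma Ck_on_congI:
  "open S \<Longrightarrow> Ck_on k g S \<Longrightarrow> (\<And>x. x \<in> S \<Longrightarrow> f x = g x) \<Longrightarrow> Ck_on k f S"
  using Ck_on_cong by blast

lemma Ck_on_subset: "Ck_on k f S \<Longrightarrow> T \<subseteq> S \<Longrightarrow> Ck_on k f T"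
  by (induction k arbitrary: f) (auto intro: continuous_on_subset)

lemma Ck_on_Suc_imp: "Ck_on (Suc k) f S \<Longrightarrow> Ck_on k f S"
proof (induction k arbitrary: f)
  case 0
  then show ?case
    by (auto intro!: continuous_at_imp_continuous_on differentiable_imp_continuous_within)
next
  case (Suc k)
  from Suc.prems have d: "\<forall>x\<in>S. f differentiable (at x)"
    and c: "\<And>v. Ck_on (Suc k) (\<lambda>x. \<D> f x v) S" by simp_all
  show ?case using d Suc.IH[OF c] by simp
qed

lemma Ck_on_const: "Ck_on k (\<lambda>_. c) S"
  by (induction k arbitrary: c) auto

lemma Ck_on_bounded_linear:
  assumes "bounded_linear f"
  shows "Ck_on k f S"
proof (cases k)
  case 0
  then show ?thesis using assms by (simp add: linear_continuous_on)
next
  case (Suc k')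
  have "\<D> f x v = f v" for x v
    using has_derivative_imp_frechet[OF bounded_linear_imp_has_derivative[OF assms]] by metis
  then show ?thesis using Suc assms
    by (simp add: Ck_on_const bounded_linear_imp_differentiable)
qed

lemma Ck_on_add:
  assumes "open S"
  shows "Ck_on k f S \<Longrightarrow> Ck_on k g S \<Longrightarrow> Ck_on k (\<lambda>x. f x + g x) S"
proof (induction k arbitrary: f g)
  case 0
  then show ?case by (auto intro: continuous_intros)
next
  case (Suc k)
  have "Ck_on k (\<lambda>x. \<D> (\<lambda>x. f x + g x) x v) S" for v
  proof -
    have "Ck_on k (\<lambda>x. \<D> f x v + \<D> g x v) S"
      using Suc by simp
    moreover have "\<D> (\<lambda>x. f x + g x) x v = \<D> f x v + \<D> g x v"
      if "x \<in> S" for x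
    proof -
      have "(f has_derivative \<D> f x) (at x)" "(g has_derivative \<D> g x) (at x)"
        using Suc.prems that by (auto simp: frechet_derivative_works[symmetric])
      from has_derivative_imp_frechet[OF has_derivative_add[OF this]] show ?thesis by simp
    qed
    ultimately show ?thesis by (rule Ck_on_congI[OF assms])
  qed
  then show ?case using Suc.prems by (auto intro: derivative_intros)
qed

lemma Ck_on_sum:
  assumes "open S"
  shows "(\<And>i. i \<in> I \<Longrightarrow> Ck_on k (f i) S) \<Longrightarrow> Ck_on k (\<lambda>x. \<Sum>i\<in>I. f i x) S"
  by (induction I rule: infinite_finite_induct) (auto simp: Ck_on_const intro!: Ck_on_add[OF assms])

lemma frechet_derivative_bilinear:
  assumes "bounded_bilinear b" "f differentiable (at x)" "g differentiable (at x)"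
  shows "\<D> (\<lambda>x. b (f x) (g x)) x v
     = b (f x) (\<D> g x v) + b (\<D> f x v) (g x)"
proof -
  have "(f has_derivative \<D> f x) (at x)" "(g has_derivative \<D> g x) (at x)"
    using assms(2,3) by (auto simp: frechet_derivative_works[symmetric])
  from has_derivative_imp_frechet[OF bounded_bilinear.FDERIV[OF assms(1) this]] show ?thesis by metis
qed

lemma differentiable_bilinear:
  assumes "bounded_bilinear b" "f differentiable (at x)" "g differentiable (at x)"
  shows "(\<lambda>x. b (f x) (g x)) differentiable (at x)"
  using bounded_bilinear.FDERIV[OF assms(1)] assms(2,3) unfolding differentiable_def by blast

text \<open>One induction serves scalar, inner and matrix products alike. It runs over arbitrary f
  and g because the product rule returns two terms of the same shape with one factor
  differentiated.\<close>

lemma Ck_on_bilinear: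
  assumes "open S" "bounded_bilinear b"
  shows "Ck_on k f S \<Longrightarrow> Ck_on k g S \<Longrightarrow> Ck_on k (\<lambda>x. b (f x) (g x)) S"
proof (induction k arbitrary: f g)
  case 0
  then show ?case by (auto intro!: bounded_bilinear.continuous_on[OF assms(2)])
next
  case (Suc k)
  have "Ck_on k (\<lambda>x. \<D> (\<lambda>x. b (f x) (g x)) x v) S" for v
  proof -
    have "Ck_on k (\<lambda>x. b (f x) (\<D> g x v) + b (\<D> f x v) (g x)) S"
      using Suc Ck_on_Suc_imp[OF Suc.prems(1)] Ck_on_Suc_imp[OF Suc.prems(2)]
      by (intro Ck_on_add[OF assms(1)]) auto
    moreover have "\<D> (\<lambda>x. b (f x) (g x)) x v
        = b (f x) (\<D> g x v) + b (\<D> f x v) (g x)"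
      if "x \<in> S" for x
      using Suc.prems that by (intro frechet_derivative_bilinear[OF assms(2)]) auto
    ultimately show ?thesis by (rule Ck_on_congI[OF assms(1)])
  qed
  then show ?case using Suc.prems by (auto intro: differentiable_bilinear[OF assms(2)])
qed

lemma frechet_derivative_linear_compose:
  assumes "bounded_linear l" "f differentiable (at x)"
  shows "\<D> (\<lambda>x. l (f x)) x v = l (\<D> f x v)"
proof -
  have "(f has_derivative \<D> f x) (at x)"
    using assms(2) by (simp add: frechet_derivative_works[symmetric])
  from has_derivative_imp_frechet[OF bounded_linear.has_derivative[OF assms(1) this]] show ?thesis by simp
qed

lemma differentiable_linear_compose:
  assumes "bounded_linear l" "f differentiable (at x)"
  shows "(\<lambda>x. l (f x)) differentiable (at x)"
  by (rule differentiableI[OF bounded_linear.has_derivative[OF assms(1) frechet_derivative_worksI[OF assms(2)]]])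

lemma Ck_on_linear_compose:
  assumes "open S" "bounded_linear l"
  shows "Ck_on k f S \<Longrightarrow> Ck_on k (\<lambda>x. l (f x)) S"
proof (induction k arbitrary: f)
  case 0
  then show ?case by (auto intro: bounded_linear.continuous_on[OF assms(2)])
next
  case (Suc k)
  have "Ck_on k (\<lambda>x. \<D> (\<lambda>x. l (f x)) x v) S" for v
  proof (rule Ck_on_congI[OF assms(1)])
    show "Ck_on k (\<lambda>x. l (\<D> f x v)) S"
      using Suc by simp
    show "\<D> (\<lambda>x. l (f x)) x v = l (\<D> f x v)" if "x \<in> S" for x
      using Suc.prems that by (intro frechet_derivative_linear_compose[OF assms(2)]) auto
  qed
  moreover have "(\<lambda>x. l (f x)) differentiable (at x)" if "x \<in> S" for x
    using Suc.prems that by (auto intro: differentiable_linear_compose[OF assms(2)])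
  ultimately show ?case by simp
qed

lemma frechet_derivative_compose_at:
  assumes "f differentiable (at (g x))" "g differentiable (at x)"
  shows "\<D> (\<lambda>x. f (g x)) x v = \<D> f (g x) (\<D> g x v)"
proof -
  have "(f has_derivative \<D> f (g x)) (at (g x))" "(g has_derivative \<D> g x) (at x)"
    using assms by (auto simp: frechet_derivative_works[symmetric])
  from has_derivative_imp_frechet[OF has_derivative_compose[OF this(2,1)]] show ?thesis by simp
qed

lemma differentiable_compose_at:
  assumes "f differentiable (at (g x))" "g differentiable (at x)"
  shows "(\<lambda>x. f (g x)) differentiable (at x)"
  using assms differentiable_chain_at[of g x f] by (simp add: comp_def)

lemma linear_basis_expand:
  fixes h :: "'a::euclidean_space \<Rightarrow> 'b::real_normed_vector"
  assumes "linear h"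
  shows "h u = (\<Sum>b\<in>Basis. (u \<bullet> b) *\<^sub>R h b)"
proof -
  have "h u = h (\<Sum>b\<in>Basis. (u \<bullet> b) *\<^sub>R b)" by (simp add: euclidean_representation)
  also have "\<dots> = (\<Sum>b\<in>Basis. (u \<bullet> b) *\<^sub>R h b)"
    using assms by (simp add: linear_sum linear_scale)
  finally show ?thesis .
qed

text \<open>The chain rule evaluates the derivative of f in the moving direction
  \<open>\<D> g x v\<close>, whereas \<open>Ck_on\<close> controls derivatives in fixed directions
  only. Expanding the direction over \<open>Basis\<close> separates the two dependences, and the
  induction hypothesis is applied to each fixed directional derivative of f.\<close>

lemma Ck_on_compose:
  fixes f :: "'b::euclidean_space \<Rightarrow> 'c::real_normed_vector"
  assumes "open S" "open T" "\<And>x. x \<in> S \<Longrightarrow> g x \<in> T"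
  shows "Ck_on k f T \<Longrightarrow> Ck_on k g S \<Longrightarrow> Ck_on k (\<lambda>x. f (g x)) S"
proof (induction k arbitrary: f)
  case 0
  then show ?case
    using continuous_on_compose2[of T f S g] assms(3) by auto
next
  case (Suc k)
  have gk: "Ck_on k g S" using Ck_on_Suc_imp Suc.prems(2) by blast
  have "Ck_on k (\<lambda>x. \<D> (\<lambda>x. f (g x)) x v) S" for v
  proof -
    have "Ck_on k (\<lambda>x. \<Sum>b\<in>Basis. (\<D> g x v \<bullet> b) *\<^sub>R \<D> f (g x) b) S"
    proof (intro Ck_on_sum[OF assms(1)] Ck_on_bilinear[OF assms(1) bounded_bilinear_scaleR])
      fix b
      show "Ck_on k (\<lambda>x. \<D> g x v \<bullet> b) S"
        using Suc.prems by (intro Ck_on_bilinear[OF assms(1) bounded_bilinear_inner]) (auto intro: Ck_on_const)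
      show "Ck_on k (\<lambda>x. \<D> f (g x) b) S"
        using Suc.IH[of "\<lambda>y. \<D> f y b"] Suc.prems(1) gk by simp
    qed
    moreover have "\<D> (\<lambda>x. f (g x)) x v
        = (\<Sum>b\<in>Basis. (\<D> g x v \<bullet> b) *\<^sub>R \<D> f (g x) b)"
      if "x \<in> S" for x
    proof -
      have d: "f differentiable (at (g x))" "g differentiable (at x)"
        using Suc.prems that assms(3) by auto
      show ?thesis unfolding frechet_derivative_compose_at[OF d]
        by (rule linear_basis_expand[OF linear_frechet_derivative[OF d(1)]])
    qed
    ultimately show ?thesis by (rule Ck_on_congI[OF assms(1)])
  qed
  moreover have "(\<lambda>x. f (g x)) differentiable (at x)" if "x \<in> S" for x
    by (rule differentiable_compose_at) (use Suc.prems assms(3) that in auto)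
  ultimately show ?case by simp
qed

lemma Ck_on_local:
  assumes "\<And>x. x \<in> S \<Longrightarrow> \<exists>T. open T \<and> x \<in> T \<and> Ck_on k f T"
  shows "Ck_on k f S"
  using assms
proof (induction k arbitrary: f)
  case 0
  then show ?case
    by (metis Ck_on.simps(1) continuous_at_imp_continuous_on continuous_on_eq_continuous_at)
next
  case (Suc k)
  show ?case unfolding Ck_on.simps
  proof (intro conjI ballI allI)
    fix x assume "x \<in> S" then show "f differentiable at x" using Suc.prems by fastforce
  next
    fix v show "Ck_on k (\<lambda>x. \<D> f x v) S"
      by (rule Suc.IH) (use Suc.prems in fastforce)
  qed
qed

text \<open>The derivative of 1/f contains 1/f again, but only with one order of regularity less,
  which the induction hypothesis supplies.\<close>

lemma Ck_on_inverse:
  fixes f :: "'a::real_normed_vector \<Rightarrow> real"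
  assumes "open S"
  shows "Ck_on k f S \<Longrightarrow> (\<And>x. x \<in> S \<Longrightarrow> f x \<noteq> 0) \<Longrightarrow> Ck_on k (\<lambda>x. inverse (f x)) S"
proof (induction k)
  case 0
  then show ?case by (auto intro!: continuous_intros)
next
  case (Suc k)
  have fk: "Ck_on k f S" using Ck_on_Suc_imp Suc.prems(1) by blast
  have ik: "Ck_on k (\<lambda>x. inverse (f x)) S" using Suc.IH[OF fk] Suc.prems(2) by blast
  have D: "((\<lambda>x. inverse (f x)) has_derivative (\<lambda>v. - (inverse (f x) * \<D> f x v * inverse (f x)))) (at x)"
    if "x \<in> S" for x
  proof -
    have "(f has_derivative \<D> f x) (at x)" using Suc.prems that
      by (auto simp: frechet_derivative_works[symmetric])
    from Deriv.has_derivative_inverse[OF Suc.prems(2)[OF that] this] show ?thesis by simp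
  qed
  have "Ck_on k (\<lambda>x. \<D> (\<lambda>x. inverse (f x)) x v) S" for v
  proof -
    have "Ck_on k (\<lambda>x. (-1) * (inverse (f x) * \<D> f x v * inverse (f x))) S"
      using Suc.prems ik by (intro Ck_on_bilinear[OF assms bounded_bilinear_mult] Ck_on_const) auto
    moreover have "\<D> (\<lambda>x. inverse (f x)) x v
      = (-1) * (inverse (f x) * \<D> f x v * inverse (f x))" if "x \<in> S" for x
      using has_derivative_imp_frechet[OF D[OF that]] by simp
    ultimately show ?thesis by (rule Ck_on_congI[OF assms])
  qed
  then show ?case using D by (auto simp: differentiable_def)
qed

lemma smooth_on_cong: "open S \<Longrightarrow> (\<And>x. x \<in> S \<Longrightarrow> f x = g x) \<Longrightarrow> smooth_on S f \<longleftrightarrow> smooth_on S g"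
  unfolding smooth_on_def using Ck_on_cong by blast

lemma smooth_on_subset: "smooth_on S f \<Longrightarrow> T \<subseteq> S \<Longrightarrow> smooth_on T f"
  unfolding smooth_on_def using Ck_on_subset by blast

lemma smooth_on_const: "smooth_on S (\<lambda>_. c)"
  by (simp add: smooth_on_def Ck_on_const)

lemma smooth_on_bounded_linear: "bounded_linear f \<Longrightarrow> smooth_on S f"
  by (simp add: smooth_on_def Ck_on_bounded_linear)

lemma smooth_on_linear_compose: "open S \<Longrightarrow> bounded_linear l \<Longrightarrow> smooth_on S f \<Longrightarrow> smooth_on S (\<lambda>x. l (f x))"
  by (simp add: smooth_on_def Ck_on_linear_compose)

lemma smooth_on_add: "open S \<Longrightarrow> smooth_on S f \<Longrightarrow> smooth_on S g \<Longrightarrow> smooth_on S (\<lambda>x. f x + g x)"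
  by (simp add: smooth_on_def Ck_on_add)

lemma smooth_on_sum: "open S \<Longrightarrow> (\<And>i. i \<in> I \<Longrightarrow> smooth_on S (f i)) \<Longrightarrow> smooth_on S (\<lambda>x. \<Sum>i\<in>I. f i x)"
  by (simp add: smooth_on_def Ck_on_sum)

lemma smooth_on_bilinear:
  "open S \<Longrightarrow> bounded_bilinear b \<Longrightarrow> smooth_on S f \<Longrightarrow> smooth_on S g \<Longrightarrow> smooth_on S (\<lambda>x. b (f x) (g x))"
  by (simp add: smooth_on_def Ck_on_bilinear)

lemma smooth_on_scaleR:
  "open S \<Longrightarrow> smooth_on S f \<Longrightarrow> smooth_on S g \<Longrightarrow> smooth_on S (\<lambda>x. f x *\<^sub>R g x)"
  by (rule smooth_on_bilinear[OF _ bounded_bilinear_scaleR])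

lemma smooth_on_mult:
  fixes f g :: "_ \<Rightarrow> real"
  shows "open S \<Longrightarrow> smooth_on S f \<Longrightarrow> smooth_on S g \<Longrightarrow> smooth_on S (\<lambda>x. f x * g x)"
  by (rule smooth_on_bilinear[OF _ bounded_bilinear_mult])

lemma smooth_on_inner:
  "open S \<Longrightarrow> smooth_on S f \<Longrightarrow> smooth_on S g \<Longrightarrow> smooth_on S (\<lambda>x. f x \<bullet> g x)"
  by (rule smooth_on_bilinear[OF _ bounded_bilinear_inner])

lemma smooth_on_diff:
  assumes "open S" "smooth_on S f" "smooth_on S g" shows "smooth_on S (\<lambda>x. f x - g x)"
  using smooth_on_add[OF assms(1,2) smooth_on_scaleR[OF assms(1) smooth_on_const[of _ "-1"] assms(3)]] by simp

lemma smooth_on_inverse: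
  "open S \<Longrightarrow> smooth_on S (f :: _ \<Rightarrow> real) \<Longrightarrow> (\<And>x. x \<in> S \<Longrightarrow> f x \<noteq> 0) \<Longrightarrow> smooth_on S (\<lambda>x. inverse (f x))"
  by (simp add: smooth_on_def Ck_on_inverse)

lemma smooth_on_compose:
  fixes f :: "'b::euclidean_space \<Rightarrow> 'c::real_normed_vector"
  shows "smooth_on T f \<Longrightarrow> smooth_on S g \<Longrightarrow> open S \<Longrightarrow> open T \<Longrightarrow> (\<And>x. x \<in> S \<Longrightarrow> g x \<in> T) \<Longrightarrow> smooth_on S (\<lambda>x. f (g x))"
  by (simp add: smooth_on_def Ck_on_compose)

lemma smooth_on_local:
  "(\<And>x. x \<in> S \<Longrightarrow> \<exists>T. open T \<and> x \<in> T \<and> smooth_on T f) \<Longrightarrow> smooth_on S f"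
  unfolding smooth_on_def using Ck_on_local by meson

lemma smooth_on_differentiable: "smooth_on S f \<Longrightarrow> x \<in> S \<Longrightarrow> f differentiable (at x)"
  unfolding smooth_on_def using Ck_on.simps(2) by blast

lemma smooth_on_continuous_on: "smooth_on S f \<Longrightarrow> continuous_on S f"
  unfolding smooth_on_def using Ck_on.simps(1) by blast

lemma smooth_on_frechet_derivative: "smooth_on S f \<Longrightarrow> smooth_on S (\<lambda>x. \<D> f x v)"
  unfolding smooth_on_def using Ck_on.simps(2) by blast

lemma smooth_on_has_derivative:
  "smooth_on S f \<Longrightarrow> x \<in> S \<Longrightarrow> (f has_derivative \<D> f x) (at x)"
  using smooth_on_differentiable frechet_derivative_works by blast

lemma smooth_on_vec_nth: "open S \<Longrightarrow> smooth_on S f \<Longrightarrow> smooth_on S (\<lambda>x. f x $ i)"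
  by (rule smooth_on_linear_compose[OF _ bounded_linear_vec_nth])

lemma smooth_on_vec_lambda:
  fixes f :: "'n::finite \<Rightarrow> 'a::real_normed_vector \<Rightarrow> 'b::euclidean_space"
  assumes "open S" "\<And>i. smooth_on S (f i)"
  shows "smooth_on S (\<lambda>x. \<chi> i. f i x)"
proof -
  have "bounded_linear (\<lambda>y::'b. axis i y)" for i :: 'n
    by (rule linear_conv_bounded_linear[THEN iffD1], rule linearI) (auto simp: axis_def vec_eq_iff)
  then have "smooth_on S (\<lambda>x. axis i (f i x))" for i
    by (rule smooth_on_linear_compose[OF assms(1) _ assms(2)])
  then have "smooth_on S (\<lambda>x. \<Sum>i\<in>UNIV. axis i (f i x))"
    by (intro smooth_on_sum[OF assms(1)])
  moreover have "(\<Sum>i\<in>UNIV. axis i (f i x)) = (\<chi> i. f i x)" for x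
    by (simp add: vec_eq_iff axis_def)
  ultimately show ?thesis by simp
qed

lemma bounded_bilinear_euclidean:
  fixes b :: "'a::euclidean_space \<Rightarrow> 'b::euclidean_space \<Rightarrow> 'c::real_normed_vector"
  assumes "bilinear b" shows "bounded_bilinear b"
  using assms bilinear_conv_bounded_bilinear by blast

section \<open>Smoothness of matrix products, determinants and inverse matrices\<close>

lemma bilinear_matrix_vector_mult: "bilinear ((*v) :: real^'n::finite^'m::finite \<Rightarrow> _)"
  unfolding bilinear_def
  by (auto intro!: linearI simp: matrix_vector_mult_def vec_eq_iff algebra_simps sum.distrib sum_distrib_left)

lemma bilinear_matrix_matrix_mult: "bilinear ((**) :: real^'n::finite^'m::finite \<Rightarrow> real^'p::finite^'n \<Rightarrow> _)"
  unfolding bilinear_def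
  by (auto intro!: linearI simp: matrix_matrix_mult_def vec_eq_iff algebra_simps sum.distrib sum_distrib_left)

lemmas bounded_bilinear_matrix_vector_mult = bounded_bilinear_euclidean[OF bilinear_matrix_vector_mult]
lemmas bounded_bilinear_matrix_matrix_mult = bounded_bilinear_euclidean[OF bilinear_matrix_matrix_mult]

lemma smooth_on_matrix_vector_mult:
  fixes A :: "_ \<Rightarrow> real^'n::finite^'m::finite"
  shows "open S \<Longrightarrow> smooth_on S A \<Longrightarrow> smooth_on S v \<Longrightarrow> smooth_on S (\<lambda>x. A x *v v x)"
  by (rule smooth_on_bilinear[OF _ bounded_bilinear_matrix_vector_mult])

lemma smooth_on_prod:
  fixes f :: "'i \<Rightarrow> 'a::real_normed_vector \<Rightarrow> real"
  assumes "open S"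
  shows "(\<And>i. i \<in> I \<Longrightarrow> smooth_on S (f i)) \<Longrightarrow> smooth_on S (\<lambda>x. \<Prod>i\<in>I. f i x)"
  by (induction I rule: infinite_finite_induct) (auto simp: smooth_on_const intro!: smooth_on_mult[OF assms])

lemma smooth_on_det:
  fixes A :: "_ \<Rightarrow> real^'n::finite^'n"
  assumes "open S" "smooth_on S A"
  shows "smooth_on S (\<lambda>x. det (A x))"
  unfolding det_def
  by (intro smooth_on_sum smooth_on_mult smooth_on_prod smooth_on_vec_nth smooth_on_const assms)

lemma matrix_inv_cancel:
  fixes A :: "real^'n::finite^'n"
  assumes "invertible A"
  shows "A ** matrix_inv A = mat 1" "matrix_inv A ** A = mat 1"
  using someI_ex[of "\<lambda>B. A ** B = mat 1 \<and> B ** A = mat 1"] assms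
  unfolding invertible_def matrix_inv_def by auto

text \<open>Exhibits the entries of the inverse as quotients of determinants, so that smoothness of
  the inverse reduces to that of polynomials and of 1/det.\<close>

lemma matrix_inv_cramer:
  fixes A :: "real^'n::finite^'n"
  assumes "invertible A"
  shows "matrix_inv A = (\<chi> k j. det (\<chi> i l. if l = k then axis j 1 $ i else A $ i $ l) / det A)"
proof -
  have d: "det A \<noteq> 0" using assms by (simp add: invertible_det_nz)
  have "A *v (matrix_inv A *v axis j 1) = axis j 1" for j
    by (simp add: matrix_vector_mul_assoc matrix_inv_cancel[OF assms])
  then have "matrix_inv A *v axis j 1 = (\<chi> k. det (\<chi> i l. if l = k then axis j 1 $ i else A $ i $ l) / det A)" for j
    using cramer[OF d] by blast
  moreover have "matrix_inv A $ k $ j = (matrix_inv A *v axis j 1) $ k" for k j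
    by (simp add: matrix_vector_mult_basis column_def)
  ultimately show ?thesis by (simp add: vec_eq_iff)
qed

lemma smooth_on_matrix_inv:
  fixes A :: "_ \<Rightarrow> real^'n::finite^'n"
  assumes "open S" "smooth_on S A" "\<And>x. x \<in> S \<Longrightarrow> invertible (A x)"
  shows "smooth_on S (\<lambda>x. matrix_inv (A x))"
proof -
  have "smooth_on S (\<lambda>x. (\<chi> k j. det (\<chi> i l. if l = k then axis j 1 $ i else A x $ i $ l) * inverse (det (A x))) :: real^'n^'n)"
  proof (intro smooth_on_vec_lambda smooth_on_mult smooth_on_inverse smooth_on_det assms)
    show "smooth_on S (\<lambda>x. if l = k then axis j 1 $ i else A x $ i $ l)" for i j k l :: 'n
      using assms by (cases "l = k") (auto intro: smooth_on_const smooth_on_vec_nth)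
    show "\<And>x. x \<in> S \<Longrightarrow> det (A x) \<noteq> 0" using assms(3) by (simp add: invertible_det_nz)
  qed
  then show ?thesis
    by (subst smooth_on_cong[OF assms(1)]) (auto simp: matrix_inv_cramer[OF assms(3)] divide_inverse)
qed

section \<open>Symmetry of second derivatives\<close>

lemma directional_derivative:
  fixes F :: "'a::real_normed_vector \<Rightarrow> real"
  assumes "F differentiable (at (x + s *\<^sub>R u))"
  shows "((\<lambda>s. F (x + s *\<^sub>R u)) has_real_derivative \<D> F (x + s *\<^sub>R u) u) (at s)"
proof -
  have 2: "((\<lambda>s. x + s *\<^sub>R u) has_derivative (\<lambda>r. r *\<^sub>R u)) (at s)"
    by (auto intro!: derivative_eq_intros)
  have "((\<lambda>s. F (x + s *\<^sub>R u)) has_derivative (\<lambda>r. \<D> F (x + s *\<^sub>R u) (r *\<^sub>R u))) (at s)"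
    using has_derivative_compose[OF 2 frechet_derivative_worksI[OF assms]] .
  moreover have "\<D> F (x + s *\<^sub>R u) (r *\<^sub>R u) = \<D> F (x + s *\<^sub>R u) u * r" for r
    using linear_frechet_derivative[OF assms] by (simp add: linear_scale)
  ultimately show ?thesis by (simp add: has_field_derivative_def)
qed

text \<open>The mean value theorem is applied twice to the second difference over the parallelogram
  spanned by h u and h v: to p, the increment of f along the side h v, as a function of s, and then
  to the u-derivative of f along v.\<close>

lemma second_difference_mvt:
  fixes f :: "'a::real_normed_vector \<Rightarrow> real"
  assumes "0 < h"
    and S: "\<And>s t. 0 \<le> s \<Longrightarrow> s \<le> h \<Longrightarrow> 0 \<le> t \<Longrightarrow> t \<le> h \<Longrightarrow> x + s *\<^sub>R u + t *\<^sub>R v \<in> S"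
    and d: "\<And>y. y \<in> S \<Longrightarrow> f differentiable (at y)"
    and d2: "\<And>y. y \<in> S \<Longrightarrow> (\<lambda>y. \<D> f y u) differentiable (at y)"
  shows "\<exists>s t. 0 < s \<and> s < h \<and> 0 < t \<and> t < h \<and>
    f (x + h *\<^sub>R u + h *\<^sub>R v) - f (x + h *\<^sub>R u) - f (x + h *\<^sub>R v) + f x
      = h * h * \<D> (\<lambda>y. \<D> f y u) (x + s *\<^sub>R u + t *\<^sub>R v) v"
proof -
  define p where "p s = f (x + s *\<^sub>R u + h *\<^sub>R v) - f (x + s *\<^sub>R u)" for s
  have mem0: "x + s *\<^sub>R u \<in> S" if "0 \<le> s" "s \<le> h" for s
    using S[OF that, of 0] \<open>0 < h\<close> by simp
  have "\<exists>s>0. s < h \<and> p h - p 0 = (h - 0) *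
     (\<D> f (x + s *\<^sub>R u + h *\<^sub>R v) u - \<D> f (x + s *\<^sub>R u) u)"
  proof (rule MVT2[OF \<open>0 < h\<close>])
    fix s assume s: "0 \<le> s" "s \<le> h"
    have "((\<lambda>s. f ((x + h *\<^sub>R v) + s *\<^sub>R u)) has_real_derivative \<D> f ((x + h *\<^sub>R v) + s *\<^sub>R u) u) (at s)"
      using S[OF s, of h] \<open>0 < h\<close> by (intro directional_derivative d) (simp add: add_ac)
    then have a: "((\<lambda>s. f (x + s *\<^sub>R u + h *\<^sub>R v)) has_real_derivative \<D> f (x + s *\<^sub>R u + h *\<^sub>R v) u) (at s)"
      by (simp add: add_ac)
    have b: "((\<lambda>s. f (x + s *\<^sub>R u)) has_real_derivative \<D> f (x + s *\<^sub>R u) u) (at s)"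
      using mem0[OF s] by (intro directional_derivative d)
    show "(p has_real_derivative \<D> f (x + s *\<^sub>R u + h *\<^sub>R v) u - \<D> f (x + s *\<^sub>R u) u) (at s)"
      unfolding p_def by (rule DERIV_diff[OF a b])
  qed
  then obtain s where s: "0 < s" "s < h" and e1: "p h - p 0 = h *
     (\<D> f (x + s *\<^sub>R u + h *\<^sub>R v) u - \<D> f (x + s *\<^sub>R u) u)" by auto
  let ?g = "\<lambda>y. \<D> f y u"
  have "\<exists>t>0. t < h \<and> ?g (x + s *\<^sub>R u + h *\<^sub>R v) - ?g (x + s *\<^sub>R u + 0 *\<^sub>R v)
     = (h - 0) * \<D> ?g (x + s *\<^sub>R u + t *\<^sub>R v) v"
    by (rule MVT2[OF \<open>0 < h\<close>]) (use s S in \<open>auto intro!: directional_derivative d2\<close>)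
  then obtain t where t: "0 < t" "t < h" and e2: "?g (x + s *\<^sub>R u + h *\<^sub>R v) - ?g (x + s *\<^sub>R u)
     = h * \<D> ?g (x + s *\<^sub>R u + t *\<^sub>R v) v" by auto
  have "f (x + h *\<^sub>R u + h *\<^sub>R v) - f (x + h *\<^sub>R u) - f (x + h *\<^sub>R v) + f x = p h - p 0"
    by (simp add: p_def)
  also have "\<dots> = h * (h * \<D> ?g (x + s *\<^sub>R u + t *\<^sub>R v) v)"
    unfolding e1 e2 ..
  finally show ?thesis using s t by (intro exI[of _ s] exI[of _ t]) simp
qed

text \<open>The second difference is symmetric in u and v. Hence the two mixed derivatives, each
  taken at a suitable point near x, coincide, and continuity excludes different values at x.\<close>

lemma symmetric_second_derivative_real:
  fixes f :: "'a::real_normed_vector \<Rightarrow> real"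
  assumes "open S" "Ck_on 2 f S" "x \<in> S"
  shows "\<D> (\<lambda>y. \<D> f y u) x v
       = \<D> (\<lambda>y. \<D> f y v) x u"
proof (rule ccontr)
  let ?g = "\<lambda>u v y. \<D> (\<lambda>y. \<D> f y u) y v"
  assume ne: "?g u v x \<noteq> ?g v u x"
  \<comment> \<open>Half the gap: two equal numbers, each strictly within e of one of the two
    values, would bring these closer than 2 e.\<close>
  define e where "e = dist (?g u v x) (?g v u x) / 2"
  have e: "e > 0" using ne by (simp add: e_def)
  have d: "\<And>y. y \<in> S \<Longrightarrow> f differentiable (at y)"
    "\<And>y w. y \<in> S \<Longrightarrow> (\<lambda>y. \<D> f y w) differentiable (at y)"
    "\<And>w w'. continuous_on S (?g w w')"
    using assms(2) by (auto simp: numeral_2_eq_2)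
  have "isCont (?g u v) x" "isCont (?g v u) x" using d(3) assms continuous_on_eq_continuous_at by blast+
  then obtain d1 d2 where d1: "d1 > 0" "\<And>y. dist y x < d1 \<Longrightarrow> dist (?g u v y) (?g u v x) < e"
    and d2: "d2 > 0" "\<And>y. dist y x < d2 \<Longrightarrow> dist (?g v u y) (?g v u x) < e"
    using e unfolding continuous_at_eps_delta by (metis)
  obtain d3 where d3: "d3 > 0" "ball x d3 \<subseteq> S" using assms open_contains_ball by blast
  define r where "r = min d1 (min d2 d3)"
  have r: "r > 0" using d1 d2 d3 by (simp add: r_def)
  \<comment> \<open>With this h the whole parallelogram stays within r/2 of x; the summand 1 keeps
    the denominator positive when u and v vanish.\<close>
  define h where "h = r / (2 * (norm u + norm v + 1))"
  have nn: "norm u + norm v + 1 > 0" by (smt (verit) norm_ge_zero)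
  have h: "h > 0" using r nn by (simp add: h_def)
  have near: "dist (x + s *\<^sub>R u + t *\<^sub>R v) x < r" if "0 \<le> s" "s \<le> h" "0 \<le> t" "t \<le> h" for s t
  proof -
    have "dist (x + s *\<^sub>R u + t *\<^sub>R v) x \<le> s * norm u + t * norm v"
      using that norm_triangle_ineq[of "s *\<^sub>R u" "t *\<^sub>R v"] by (simp add: dist_norm)
    also have "\<dots> \<le> h * norm u + h * norm v" using that by (intro add_mono mult_right_mono) auto
    also have "\<dots> < h * (norm u + norm v + 1)" using h by (simp add: algebra_simps)
    also have "\<dots> = r / 2" using nn unfolding h_def by (simp add: field_simps del: mult_minus_right)
    finally show ?thesis using r by simp
  qed
  have memS: "x + s *\<^sub>R u + t *\<^sub>R v \<in> S" if "0 \<le> s" "s \<le> h" "0 \<le> t" "t \<le> h" for s t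
    using near[OF that] d3(2) by (auto simp: r_def dist_commute)
  obtain s t where st: "0 < s" "s < h" "0 < t" "t < h"
    and 1: "f (x + h *\<^sub>R u + h *\<^sub>R v) - f (x + h *\<^sub>R u) - f (x + h *\<^sub>R v) + f x
      = h * h * ?g u v (x + s *\<^sub>R u + t *\<^sub>R v)"
    using second_difference_mvt[OF h memS d(1) d(2)] by blast
  have memS': "x + s *\<^sub>R v + t *\<^sub>R u \<in> S" if "0 \<le> s" "s \<le> h" "0 \<le> t" "t \<le> h" for s t
    using memS[OF that(3,4,1,2)] by (simp add: add_ac)
  obtain s' t' where st': "0 < s'" "s' < h" "0 < t'" "t' < h"
    and 2: "f (x + h *\<^sub>R v + h *\<^sub>R u) - f (x + h *\<^sub>R v) - f (x + h *\<^sub>R u) + f x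
      = h * h * ?g v u (x + s' *\<^sub>R v + t' *\<^sub>R u)"
    using second_difference_mvt[OF h memS' d(1) d(2)] by blast
  have "h * h * ?g u v (x + s *\<^sub>R u + t *\<^sub>R v) = h * h * ?g v u (x + s' *\<^sub>R v + t' *\<^sub>R u)"
    using 1 2 by (simp add: algebra_simps)
  then have "?g u v (x + s *\<^sub>R u + t *\<^sub>R v) = ?g v u (x + s' *\<^sub>R v + t' *\<^sub>R u)" using h by simp
  moreover have "dist (?g u v (x + s *\<^sub>R u + t *\<^sub>R v)) (?g u v x) < e"
    using near[of s t] st by (intro d1(2)) (auto simp: r_def)
  moreover have "dist (?g v u (x + s' *\<^sub>R v + t' *\<^sub>R u)) (?g v u x) < e"
    using near[of t' s'] st' by (intro d2(2)) (auto simp: r_def add_ac)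
  moreover have "dist (?g u v x) (?g v u x) = 2 * e" by (simp add: e_def)
  ultimately show False
    using dist_triangle2[of "?g u v x" "?g v u x" "?g u v (x + s *\<^sub>R u + t *\<^sub>R v)"] by (simp add: dist_commute)
qed

lemma frechet_derivative_inner_const:
  assumes "f differentiable (at x)"
  shows "\<D> (\<lambda>y. f y \<bullet> b) x v = \<D> f x v \<bullet> b"
  using frechet_derivative_bilinear[OF bounded_bilinear_inner assms, of "\<lambda>_. b"] by simp

lemma symmetric_second_derivative:
  fixes f :: "'a::real_normed_vector \<Rightarrow> 'b::euclidean_space"
  assumes "open S" "smooth_on S f" "x \<in> S"
  shows "\<D> (\<lambda>y. \<D> f y u) x v
       = \<D> (\<lambda>y. \<D> f y v) x u"
proof (rule euclidean_eqI)
  fix b :: 'b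
  have k: "\<D> (\<lambda>y. \<D> f y u) x v \<bullet> b
     = \<D> (\<lambda>y. \<D> (\<lambda>y. f y \<bullet> b) y u) x v" for u v
  proof -
    have "\<D> (\<lambda>y. \<D> f y u) x v \<bullet> b
      = \<D> (\<lambda>y. \<D> f y u \<bullet> b) x v"
      using smooth_on_differentiable[OF smooth_on_frechet_derivative[OF assms(2)] assms(3)]
      by (simp add: frechet_derivative_inner_const)
    also have "\<dots> = \<D> (\<lambda>y. \<D> (\<lambda>y. f y \<bullet> b) y u) x v"
      by (rule fun_cong[OF frechet_derivative_cong_open[OF assms(1,3)]])
         (simp add: frechet_derivative_inner_const[OF smooth_on_differentiable[OF assms(2)]])
    finally show ?thesis .
  qed
  have "Ck_on 2 (\<lambda>y. f y \<bullet> b) S"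
    using smooth_on_inner[OF assms(1,2) smooth_on_const] by (simp add: smooth_on_def)
  from symmetric_second_derivative_real[OF assms(1) this assms(3)]
  show "\<D> (\<lambda>y. \<D> f y u) x v \<bullet> b
       = \<D> (\<lambda>y. \<D> f y v) x u \<bullet> b"
    unfolding k .
qed

section \<open>Levi-Civita geometry in a chart\<close>

text \<open>A product rule for a point-dependent linear map applied to a field, when the map is only
  known to be differentiable on each fixed vector. Expansion over \<open>Basis\<close> makes it a
  finite sum of products. It serves Christoffel terms, \<open>\<D> \<xi> y (U y)\<close> and
  Jacobians applied to fields.\<close>

lemma linear_in_basis_derivative:
  fixes L :: "'a::real_normed_vector \<Rightarrow> 'b::euclidean_space \<Rightarrow> 'c::real_normed_vector"
  assumes S: "open S" "x \<in> S" and lin: "\<And>y. y \<in> S \<Longrightarrow> linear (L y)"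
    and L: "\<And>b. (\<lambda>y. L y b) differentiable (at x)" and X: "X differentiable (at x)"
  shows "((\<lambda>y. L y (X y)) has_derivative
      (\<lambda>u. \<D> (\<lambda>y. L y (X x)) x u + L x (\<D> X x u))) (at x)"
proof -
  have LD: "((\<lambda>y. L y b) has_derivative \<D> (\<lambda>y. L y b) x) (at x)" for b
    by (rule frechet_derivative_worksI[OF L])
  have XD: "((\<lambda>y. X y \<bullet> b) has_derivative (\<lambda>u. \<D> X x u \<bullet> b)) (at x)" for b
    using has_derivative_inner_left[OF frechet_derivative_worksI[OF X]] .
  have "((\<lambda>y. \<Sum>b\<in>Basis. (X y \<bullet> b) *\<^sub>R L y b) has_derivative
     (\<lambda>u. \<Sum>b\<in>Basis. (X x \<bullet> b) *\<^sub>R \<D> (\<lambda>y. L y b) x u + (\<D> X x u \<bullet> b) *\<^sub>R L x b)) (at x)"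
    by (rule has_derivative_sum, rule has_derivative_scaleR[OF XD LD])
  moreover have "(\<Sum>b\<in>Basis. (X x \<bullet> b) *\<^sub>R \<D> (\<lambda>y. L y b) x u) = \<D> (\<lambda>y. L y (X x)) x u" for u
  proof -
    have "((\<lambda>y. \<Sum>b\<in>Basis. (X x \<bullet> b) *\<^sub>R L y b) has_derivative
        (\<lambda>u. \<Sum>b\<in>Basis. (X x \<bullet> b) *\<^sub>R \<D> (\<lambda>y. L y b) x u)) (at x)"
      by (rule has_derivative_sum, rule has_derivative_scaleR_right[OF LD])
    then have "((\<lambda>y. L y (X x)) has_derivative
        (\<lambda>u. \<Sum>b\<in>Basis. (X x \<bullet> b) *\<^sub>R \<D> (\<lambda>y. L y b) x u)) (at x)"
      by (rule has_derivative_transform_within_open[OF _ S]) (simp add: linear_basis_expand[OF lin, symmetric])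
    from has_derivative_imp_frechet[OF this] show ?thesis by simp
  qed
  moreover have "(\<Sum>b\<in>Basis. (\<D> X x u \<bullet> b) *\<^sub>R L x b) = L x (\<D> X x u)" for u
    by (rule linear_basis_expand[OF lin[OF S(2)], symmetric])
  ultimately have "((\<lambda>y. \<Sum>b\<in>Basis. (X y \<bullet> b) *\<^sub>R L y b) has_derivative
      (\<lambda>u. \<D> (\<lambda>y. L y (X x)) x u + L x (\<D> X x u))) (at x)"
    by (simp add: sum.distrib)
  then show ?thesis
    by (rule has_derivative_transform_within_open[OF _ S]) (simp add: linear_basis_expand[OF lin, symmetric])
qed

lemma smooth_on_linear_in_basis:
  fixes L :: "'a::real_normed_vector \<Rightarrow> 'b::euclidean_space \<Rightarrow> 'c::real_normed_vector"
  assumes S: "open S" and lin: "\<And>y. y \<in> S \<Longrightarrow> linear (L y)"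
    and L: "\<And>b. smooth_on S (\<lambda>y. L y b)" and X: "smooth_on S X"
  shows "smooth_on S (\<lambda>y. L y (X y))"
proof -
  have "smooth_on S (\<lambda>y. \<Sum>b\<in>Basis. (X y \<bullet> b) *\<^sub>R L y b)"
    by (intro smooth_on_sum smooth_on_scaleR smooth_on_inner S L X smooth_on_const)
  then show ?thesis
    by (subst smooth_on_cong[OF S]) (auto simp: linear_basis_expand[OF lin, symmetric])
qed

section \<open>Traces and adjoints with respect to a nondegenerate form\<close>

definition ltrace :: "(real^'d \<Rightarrow> real^'d::finite) \<Rightarrow> real" where
  "ltrace f = trace (matrix f)"

lemma ltrace_sum: "ltrace f = (\<Sum>i\<in>UNIV. f (axis i 1) $ i)"
  by (simp add: ltrace_def trace_def matrix_def)

lemma ltrace_add: "ltrace (\<lambda>u. f u + g u) = ltrace f + ltrace g"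
  by (simp add: ltrace_sum sum.distrib)

lemma ltrace_diff: "ltrace (\<lambda>u. f u - g u) = ltrace f - ltrace g"
  by (simp add: ltrace_sum sum_subtractf)

lemma ltrace_minus: "ltrace (\<lambda>u. - f u) = - ltrace f"
  by (simp add: ltrace_sum sum_negf)

lemma ltrace_scaleR: "ltrace (\<lambda>u. c *\<^sub>R f u) = c * ltrace f"
  by (simp add: ltrace_sum sum_distrib_left)

lemma ltrace_zero: "ltrace (\<lambda>u. 0) = 0"
  by (simp add: ltrace_sum)

lemma ltrace_commute:
  assumes "linear f" "linear g"
  shows "ltrace (\<lambda>u. f (g u)) = ltrace (\<lambda>u. g (f u))"
  using matrix_compose[OF assms] matrix_compose[OF assms(2,1)] trace_mul_sym[of "matrix f" "matrix g"]
  by (simp add: ltrace_def comp_def)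

lemma linear_axis_expand:
  fixes f :: "real^'d::finite \<Rightarrow> 'b::real_vector"
  assumes "linear f"
  shows "(\<Sum>i\<in>UNIV. z $ i *\<^sub>R f (axis i 1)) = f z"
proof -
  have "f z = f (\<Sum>i\<in>UNIV. z $ i *\<^sub>R axis i 1)"
    by (simp add: basis_expansion flip: scalar_mult_eq_scaleR)
  also have "\<dots> = (\<Sum>i\<in>UNIV. z $ i *\<^sub>R f (axis i 1))"
    using assms by (simp add: linear_sum linear_scale)
  finally show ?thesis ..
qed

lemma ltrace_rank_one:
  fixes f :: "real^'d::finite \<Rightarrow> real"
  assumes "linear f"
  shows "ltrace (\<lambda>u. f u *\<^sub>R z) = f z"
  using linear_axis_expand[OF assms, of z] by (simp add: ltrace_sum mult.commute)

lemma metric_at_simps: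
  "metric_at A (u + u') v = metric_at A u v + metric_at A u' v"
  "metric_at A u (v + v') = metric_at A u v + metric_at A u v'"
  "metric_at A (u - u') v = metric_at A u v - metric_at A u' v"
  "metric_at A u (v - v') = metric_at A u v - metric_at A u v'"
  "metric_at A (c *\<^sub>R u) v = c * metric_at A u v"
  "metric_at A u (c *\<^sub>R v) = c * metric_at A u v"
  "metric_at A (- u) v = - metric_at A u v"
  "metric_at A u (- v) = - metric_at A u v"
  "metric_at A 0 v = 0" "metric_at A u 0 = 0"
  by (simp_all add: metric_at_def inner_add_left inner_add_right inner_diff_left inner_diff_right
      matrix_vector_right_distrib matrix_vector_mult_diff_distrib matrix_vector_mult_scaleR
      scaleR_matrix_vector_assoc[symmetric] linear_neg[OF matrix_vector_mul_linear])

lemma metric_at_linear_matrix: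
  "metric_at (A + B) u v = metric_at A u v + metric_at B u v"
  "metric_at (c *\<^sub>R A) u v = c * metric_at A u v"
  by (simp_all add: metric_at_def matrix_vector_mult_add_rdistrib inner_add_right
      scaleR_matrix_vector_assoc[symmetric])

lemma bounded_linear_metric_at: "bounded_linear (\<lambda>A::real^'d::finite^'d. metric_at A u v)"
  by (rule linear_conv_bounded_linear[THEN iffD1], rule linearI) (simp_all add: metric_at_linear_matrix)

lemma metric_at_sum: "metric_at A (\<Sum>i\<in>I. f i) v = (\<Sum>i\<in>I. metric_at A (f i) v)"
  by (simp add: metric_at_def inner_sum_left)

lemma metric_at_transpose: "metric_at A u v = metric_at (transpose A) v u"
  by (simp add: metric_at_def inner_commute[of v] dot_lmul_matrix[symmetric] transpose_matrix_vector)

lemma metric_at_nondegenerate: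
  assumes "invertible A" "\<And>w. metric_at A w u = metric_at A w v"
  shows "u = v"
proof -
  have "A *v u = A *v v"
    by (rule vector_eq_rdot[THEN iffD1]) (use assms(2) in \<open>auto simp: metric_at_def inner_commute\<close>)
  then have "matrix_inv A *v (A *v u) = matrix_inv A *v (A *v v)" by simp
  then show ?thesis using matrix_inv_cancel[OF assms(1)] by (simp add: matrix_vector_mul_assoc)
qed

text \<open>In matrices the adjoint condition says that the transpose of f times A equals A times h,
  so h is conjugate to the transpose of f. This covers metrics of every signature.\<close>

lemma ltrace_adjoint:
  assumes A: "invertible A" and "linear f" "linear h"
    and adj: "\<And>u v. metric_at A (f u) v = metric_at A u (h v)"
  shows "ltrace f = ltrace h"
proof -
  have "transpose (matrix f) ** A = A ** matrix h"
  proof -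
    have "(transpose (matrix f) ** A) *v v = (A ** matrix h) *v v" for v
    proof (rule vector_eq_rdot[THEN iffD1], rule allI)
      fix u
      have "metric_at A (f u) v = (matrix f *v u) \<bullet> (A *v v)"
        by (simp add: metric_at_def fun_cong[OF matrix_vector_mul(2)[OF assms(2)]])
      also have "\<dots> = u \<bullet> (transpose (matrix f) *v (A *v v))"
        using metric_at_transpose[of "transpose (matrix f)" u "A *v v"]
        by (simp add: metric_at_def inner_commute)
      finally have "u \<bullet> (transpose (matrix f) *v (A *v v)) = u \<bullet> (A *v (matrix h *v v))"
        using adj[of u v] by (simp add: metric_at_def fun_cong[OF matrix_vector_mul(2)[OF assms(3)]])
      then show "((transpose (matrix f) ** A) *v v) \<bullet> u = ((A ** matrix h) *v v) \<bullet> u"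
        by (simp add: matrix_vector_mul_assoc inner_commute)
    qed
    then show ?thesis by (simp add: matrix_eq)
  qed
  then have "matrix_inv A ** (transpose (matrix f) ** A) = matrix h"
    by (simp add: matrix_mul_assoc matrix_inv_cancel[OF A])
  then have "trace (matrix h) = trace ((matrix_inv A ** transpose (matrix f)) ** A)"
    by (simp add: matrix_mul_assoc)
  also have "\<dots> = trace (transpose (matrix f))"
    by (subst trace_mul_sym) (simp add: matrix_mul_assoc matrix_inv_cancel[OF A])
  also have "\<dots> = trace (matrix f)"
    by (simp add: trace_def transpose_def)
  finally show ?thesis by (simp add: ltrace_def)
qed

definition cov :: "(real^'d \<Rightarrow> real^'d^'d) \<Rightarrow> (real^'d \<Rightarrow> real^'d) \<Rightarrow> real^'d \<Rightarrow> real^'d \<Rightarrow> real^'d::finite" where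
  "cov G V x u = \<D> V x u + christoffel G x u (V x)"

text \<open>The pairing of \<nabla>V with \<nabla>U, with the metric contracting the values and its
  inverse the directions. For U = V it is twice the vertical part of the energy density.\<close>

definition cov_pairing :: "(real^'d \<Rightarrow> real^'d^'d) \<Rightarrow> (real^'d \<Rightarrow> real^'d) \<Rightarrow> (real^'d \<Rightarrow> real^'d) \<Rightarrow> real^'d::finite \<Rightarrow> real" where
  "cov_pairing G V U x = (\<Sum>i\<in>UNIV. \<Sum>j\<in>UNIV. matrix_inv (G x) $ i $ j *
     metric_at (G x) (cov G V x (axis i 1)) (cov G U x (axis j 1)))"

definition divergence :: "(real^'d \<Rightarrow> real^'d^'d) \<Rightarrow> (real^'d \<Rightarrow> real^'d) \<Rightarrow> real^'d::finite \<Rightarrow> real" where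
  "divergence G X x = ltrace (cov G X x)"

text \<open>The open set S is left general because the same facts are applied to whole chart images
  and to overlaps of two charts.\<close>

locale chart_metric =
  fixes S :: "(real^'d::finite) set" and G :: "real^'d \<Rightarrow> real^'d^'d"
  assumes open_S: "open S" and smooth_G: "smooth_on S G"
    and sym_G: "\<And>x. x \<in> S \<Longrightarrow> transpose (G x) = G x"
    and inv_G: "\<And>x. x \<in> S \<Longrightarrow> invertible (G x)"
begin

lemma diff_G: "x \<in> S \<Longrightarrow> G differentiable (at x)"
  using smooth_on_differentiable[OF smooth_G] .

lemma metric_sym: "x \<in> S \<Longrightarrow> metric_at (G x) u v = metric_at (G x) v u"
  using metric_at_transpose[of "G x" u v] by (simp add: sym_G)

lemma metric_eqI: "x \<in> S \<Longrightarrow> (\<And>w. metric_at (G x) w u = metric_at (G x) w v) \<Longrightarrow> u = v"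
  using metric_at_nondegenerate[OF inv_G] .

abbreviation "dG x u \<equiv> \<D> G x u"

lemma linear_dG: "x \<in> S \<Longrightarrow> linear (\<D> G x)"
  by (rule linear_frechet_derivative[OF diff_G])

lemma sym_dG: 
  assumes "x \<in> S" shows "metric_at (dG x w) u v = metric_at (dG x w) v u"
proof -
  have "metric_at (dG x w) u v = \<D> (\<lambda>y. metric_at (G y) u v) x w" for u v
    using frechet_derivative_linear_compose[OF bounded_linear_metric_at diff_G[OF assms]] by simp
  moreover have "\<D> (\<lambda>y. metric_at (G y) u v) x w = \<D> (\<lambda>y. metric_at (G y) v u) x w"
    by (rule fun_cong[OF frechet_derivative_cong_open[OF open_S assms]]) (rule metric_sym)
  ultimately show ?thesis by simp
qed

text \<open>Pairing with w removes the inverse matrix from the definition of the symbols. Both sides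
  are linear in w, so agreement on the coordinate axes is enough.\<close>

lemma koszul:
  assumes "x \<in> S"
  shows "metric_at (G x) w (christoffel G x u v) =
    (1/2) * (metric_at (dG x u) v w + metric_at (dG x v) u w - metric_at (dG x w) u v)"
proof -
  let ?\<kappa> = "\<chi> k. (1/2) * (metric_at (dG x u) v (axis k 1) + metric_at (dG x v) u (axis k 1)
      - metric_at (dG x (axis k 1)) u v)"
  let ?K = "\<lambda>w. (1/2) * (metric_at (dG x u) v w + metric_at (dG x v) u w - metric_at (dG x w) u v)"
  have "G x *v christoffel G x u v = ?\<kappa>"
    by (simp add: christoffel_def matrix_vector_mul_assoc matrix_inv_cancel[OF inv_G[OF assms]])
  then have "metric_at (G x) w (christoffel G x u v) = w \<bullet> ?\<kappa>"
    by (simp add: metric_at_def)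
  also have "\<dots> = (\<Sum>k\<in>UNIV. w $ k * ?K (axis k 1))" by (simp add: inner_vec_def)
  also have "\<dots> = ?K w"
  proof -
    have "linear ?K"
      by (rule linearI) (simp_all add: metric_at_simps metric_at_linear_matrix linear_add[OF linear_dG[OF assms]]
          linear_scale[OF linear_dG[OF assms]] algebra_simps)
    from linear_axis_expand[OF this, of w] show ?thesis by simp
  qed
  finally show ?thesis .
qed

lemma christoffel_sym:
  assumes "x \<in> S" shows "christoffel G x u v = christoffel G x v u"
  by (rule metric_eqI[OF assms]) (simp add: koszul[OF assms] sym_dG[OF assms, of _ u v])

lemma linear_christoffel: assumes "x \<in> S" shows "linear (christoffel G x u)"
proof (rule linearI)
  fix v w c
  show "christoffel G x u (v + w) = christoffel G x u v + christoffel G x u w"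
    by (rule metric_eqI[OF assms])
      (simp add: koszul assms metric_at_simps metric_at_linear_matrix linear_add[OF linear_dG[OF assms]] algebra_simps add_divide_distrib diff_divide_distrib)
  show "christoffel G x u (c *\<^sub>R v) = c *\<^sub>R christoffel G x u v"
    by (rule metric_eqI[OF assms])
      (simp add: koszul assms metric_at_simps metric_at_linear_matrix linear_scale[OF linear_dG[OF assms]] algebra_simps)
qed

lemma linear_christoffel_left: "x \<in> S \<Longrightarrow> linear (\<lambda>u. christoffel G x u v)"
  using linear_christoffel[of x v] by (simp add: christoffel_sym[of x _ v])

lemmas christoffel_add = linear_add[OF linear_christoffel] linear_add[OF linear_christoffel_left]
lemmas christoffel_diff = linear_diff[OF linear_christoffel] linear_diff[OF linear_christoffel_left]
lemmas christoffel_scale = linear_scale[OF linear_christoffel] linear_scale[OF linear_christoffel_left]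

text \<open>This is \<nabla>g = 0: in the sum of the two Koszul expressions the derivatives of the
  metric along u and v cancel, and those along w add up.\<close>

lemma metric_compatible:
  assumes "x \<in> S"
  shows "metric_at (dG x w) u v = metric_at (G x) (christoffel G x w u) v + metric_at (G x) u (christoffel G x w v)"
  unfolding metric_sym[OF assms, of "christoffel G x w u" v]
  by (simp add: koszul[OF assms] sym_dG[OF assms, of w v u] sym_dG[OF assms, of v u w] sym_dG[OF assms, of u v w] field_simps)

lemma smooth_christoffel: "smooth_on S (\<lambda>y. christoffel G y u v)"
proof -
  have m: "smooth_on S (\<lambda>y. metric_at (dG y w) a b)" for w a b
    by (rule smooth_on_linear_compose[OF open_S bounded_linear_metric_at smooth_on_frechet_derivative[OF smooth_G]])
  show ?thesis unfolding christoffel_def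
    by (intro smooth_on_matrix_vector_mult smooth_on_vec_lambda smooth_on_mult smooth_on_add smooth_on_diff
       smooth_on_matrix_inv open_S smooth_G smooth_on_const m inv_G)
qed

lemma diff_christoffel: "x \<in> S \<Longrightarrow> (\<lambda>y. christoffel G y u v) differentiable (at x)"
  using smooth_on_differentiable[OF smooth_christoffel] .

abbreviation "d\<Gamma> x u v w \<equiv> \<D> (\<lambda>y. christoffel G y v w) x u"

lemma d\<Gamma>_sym: "x \<in> S \<Longrightarrow> d\<Gamma> x u v w = d\<Gamma> x u w v"
  by (rule fun_cong[OF frechet_derivative_cong_open[OF open_S]]) (auto intro: christoffel_sym)

lemma linear_d\<Gamma>_3:
  assumes x: "x \<in> S" shows "linear (\<lambda>w. d\<Gamma> x u v w)"
proof (rule linearI)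
  fix a b c
  have "d\<Gamma> x u v (a + b) = \<D> (\<lambda>y. christoffel G y v a + christoffel G y v b) x u"
    by (rule fun_cong[OF frechet_derivative_cong_open[OF open_S x]]) (simp add: christoffel_add)
  also have "\<dots> = d\<Gamma> x u v a + d\<Gamma> x u v b"
    using has_derivative_imp_frechet[OF has_derivative_add[OF frechet_derivative_worksI frechet_derivative_worksI, OF diff_christoffel[OF x] diff_christoffel[OF x]], of v a v b]
    by simp
  finally show "d\<Gamma> x u v (a + b) = d\<Gamma> x u v a + d\<Gamma> x u v b" .
  have "d\<Gamma> x u v (c *\<^sub>R a) = \<D> (\<lambda>y. c *\<^sub>R christoffel G y v a) x u"
    by (rule fun_cong[OF frechet_derivative_cong_open[OF open_S x]]) (simp add: christoffel_scale)
  also have "\<dots> = c *\<^sub>R d\<Gamma> x u v a"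
    using frechet_derivative_linear_compose[OF bounded_linear_scaleR_right diff_christoffel[OF x]] by simp
  finally show "d\<Gamma> x u v (c *\<^sub>R a) = c *\<^sub>R d\<Gamma> x u v a" .
qed

lemma christoffel_fields_derivative:
  assumes x: "x \<in> S" and X: "X differentiable (at x)" and Y: "Y differentiable (at x)"
  shows "((\<lambda>y. christoffel G y (X y) (Y y)) has_derivative
    (\<lambda>u. d\<Gamma> x u (X x) (Y x) + christoffel G x (\<D> X x u) (Y x)
       + christoffel G x (X x) (\<D> Y x u))) (at x)"
proof -
  have 1: "((\<lambda>y. christoffel G y (X y) b) has_derivative
     (\<lambda>u. d\<Gamma> x u (X x) b + christoffel G x (\<D> X x u) b)) (at x)" for b
    by (rule linear_in_basis_derivative[OF open_S x linear_christoffel_left diff_christoffel[OF x] X])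
  have "((\<lambda>y. christoffel G y (X y) (Y y)) has_derivative
      (\<lambda>u. \<D> (\<lambda>y. christoffel G y (X y) (Y x)) x u + christoffel G x (X x) (\<D> Y x u))) (at x)"
    by (rule linear_in_basis_derivative[OF open_S x linear_christoffel _ Y]) (auto intro: differentiableI 1)
  then show ?thesis by (simp add: has_derivative_imp_frechet[OF 1])
qed

text \<open>Fields with constant components commute, so the bracket term drops out and only
  Christoffel symbols and their first derivatives remain.\<close>

lemma curvature_eq:
  assumes x: "x \<in> S"
  shows "curvature G x u v w = d\<Gamma> x u v w - d\<Gamma> x v u w
     + christoffel G x u (christoffel G x v w) - christoffel G x v (christoffel G x u w)"
proof -
  have lc: "levi_civita G (\<lambda>_. a) (\<lambda>_. b) = (\<lambda>y. christoffel G y a b)" for a b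
    by (simp add: fun_eq_iff levi_civita_def)
  have 0: "christoffel G x 0 w = 0" using linear_0[OF linear_christoffel_left[OF x]] .
  show ?thesis
    by (simp add: curvature_def curvature_on_fields_def lc lie_bracket_def)
      (simp add: levi_civita_def lie_bracket_def 0 algebra_simps)
qed

lemma bianchi:
  assumes x: "x \<in> S"
  shows "curvature G x u v w + curvature G x v w u + curvature G x w u v = 0"
  unfolding curvature_eq[OF x] d\<Gamma>_sym[OF x, of w v] d\<Gamma>_sym[OF x, of w u] d\<Gamma>_sym[OF x, of v u]
      christoffel_sym[OF x, of w v] christoffel_sym[OF x, of w u] christoffel_sym[OF x, of v u]
  by (simp add: algebra_simps)

lemma linear_curvature_3: "x \<in> S \<Longrightarrow> linear (\<lambda>w. curvature G x u v w)"
  by (intro linearI) (simp_all add: curvature_eq linear_add[OF linear_d\<Gamma>_3]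
     linear_scale[OF linear_d\<Gamma>_3] christoffel_add christoffel_scale algebra_simps)

lemma metric_fields_derivative:
  assumes x: "x \<in> S" and X: "X differentiable (at x)" and Y: "Y differentiable (at x)"
  shows "\<D> (\<lambda>y. metric_at (G y) (X y) (Y y)) x u =
     metric_at (dG x u) (X x) (Y x) + metric_at (G x) (\<D> X x u) (Y x)
       + metric_at (G x) (X x) (\<D> Y x u)"
    and "(\<lambda>y. metric_at (G y) (X y) (Y y)) differentiable (at x)"
proof -
  note GY = differentiable_bilinear[OF bounded_bilinear_matrix_vector_mult diff_G[OF x] Y]
  show "(\<lambda>y. metric_at (G y) (X y) (Y y)) differentiable (at x)"
    unfolding metric_at_def by (rule differentiable_bilinear[OF bounded_bilinear_inner X GY])
  show "\<D> (\<lambda>y. metric_at (G y) (X y) (Y y)) x u =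
     metric_at (dG x u) (X x) (Y x) + metric_at (G x) (\<D> X x u) (Y x)
       + metric_at (G x) (X x) (\<D> Y x u)"
    unfolding metric_at_def frechet_derivative_bilinear[OF bounded_bilinear_inner X GY]
      frechet_derivative_bilinear[OF bounded_bilinear_matrix_vector_mult diff_G[OF x] Y]
    by (simp add: inner_add_right)
qed

text \<open>Metric compatibility, differentiated once more, expands the second derivative of the
  metric component of a and b (fact \<open>*\<close>). Its symmetry in v and w equates two
  expansions; the terms with one symbol on a and one on b occur on both sides, and the remainder is
  the curvature acting on a and on b.\<close>

lemma curvature_skew:
  assumes x: "x \<in> S"
  shows "metric_at (G x) (curvature G x v w a) b = - metric_at (G x) a (curvature G x v w b)"
proof -
  let ?g = "metric_at (G x)" and ?C = "christoffel G x"
  have *: "metric_at (\<D> (\<lambda>y. dG y w) x v) a b =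
      ?g (?C v (?C w a)) b + ?g (?C w a) (?C v b) + ?g (d\<Gamma> x v w a) b
      + ?g (?C v a) (?C w b) + ?g a (?C v (?C w b)) + ?g a (d\<Gamma> x v w b)" for v w
  proof -
    have "metric_at (\<D> (\<lambda>y. dG y w) x v) a b
      = \<D> (\<lambda>y. metric_at (dG y w) a b) x v"
      using frechet_derivative_linear_compose[OF bounded_linear_metric_at smooth_on_differentiable[OF smooth_on_frechet_derivative[OF smooth_G] x]]
      by simp
    also have "\<dots> = \<D> (\<lambda>y. metric_at (G y) (christoffel G y w a) b + metric_at (G y) a (christoffel G y w b)) x v"
      by (rule fun_cong[OF frechet_derivative_cong_open[OF open_S x]]) (rule metric_compatible)
    also have "\<dots> = \<D> (\<lambda>y. metric_at (G y) (christoffel G y w a) b) x v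
        + \<D> (\<lambda>y. metric_at (G y) a (christoffel G y w b)) x v"
      using has_derivative_imp_frechet[OF has_derivative_add[OF frechet_derivative_worksI frechet_derivative_worksI,
          OF metric_fields_derivative(2)[OF x] metric_fields_derivative(2)[OF x]],
          of "\<lambda>y. christoffel G y w a" "\<lambda>_. b" "\<lambda>_. a" "\<lambda>y. christoffel G y w b"] diff_christoffel[OF x] by simp
    finally show ?thesis
      by (simp add: metric_fields_derivative(1)[OF x] diff_christoffel[OF x] metric_compatible[OF x] metric_at_simps)
  qed
  have "\<D> (\<lambda>y. dG y w) x v = \<D> (\<lambda>y. dG y v) x w"
    by (rule symmetric_second_derivative[OF open_S smooth_G x])
  then have "metric_at (\<D> (\<lambda>y. dG y w) x v) a b = metric_at (\<D> (\<lambda>y. dG y v) x w) a b"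
    by simp
  then have key: "?g (?C v (?C w a)) b + ?g (?C w a) (?C v b) + ?g (d\<Gamma> x v w a) b
      + ?g (?C v a) (?C w b) + ?g a (?C v (?C w b)) + ?g a (d\<Gamma> x v w b) =
      ?g (?C w (?C v a)) b + ?g (?C v a) (?C w b) + ?g (d\<Gamma> x w v a) b
      + ?g (?C w a) (?C v b) + ?g a (?C w (?C v b)) + ?g a (d\<Gamma> x w v b)"
    using *[of w v] *[of v w] by (simp only:)
  have "?g (curvature G x v w a) b + ?g a (curvature G x v w b) = 0"
    unfolding curvature_eq[OF x] metric_at_simps using key by argo
  then show ?thesis by simp
qed

text \<open>By the skewness of the curvature, \<open>curvature G x v w\<close> is the negative of
  its own adjoint and has trace zero. The Bianchi identity identifies this trace, up to sign, with
  the difference of the two Ricci values.\<close>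

lemma ricci_sym:
  assumes x: "x \<in> S"
  shows "ricci_tensor G x v w = ricci_tensor G x w v"
proof -
  have "ltrace (curvature G x v w) = ltrace (\<lambda>a. - curvature G x v w a)"
    by (rule ltrace_adjoint[OF inv_G[OF x] linear_curvature_3[OF x] linear_compose_neg[OF linear_curvature_3[OF x]]])
      (simp add: curvature_skew[OF x] metric_at_simps)
  then have t0: "ltrace (curvature G x v w) = 0" by (simp add: ltrace_minus)
  have "curvature G x u v w - curvature G x u w v = - curvature G x v w u" for u
  proof -
    have *: "curvature G x w u v = - curvature G x u w v" by (simp add: curvature_eq[OF x])
    show ?thesis using bianchi[OF x, of u v w] unfolding * by (simp add: eq_neg_iff_add_eq_0 algebra_simps)
  qed
  then have "ltrace (\<lambda>u. curvature G x u v w - curvature G x u w v) = 0"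
    by (simp add: ltrace_minus t0 eta_contract_eq)
  then show ?thesis by (simp add: ltrace_diff ricci_tensor_def ltrace_def)
qed

lemma ricci_ltrace: "ricci_tensor G x v w = ltrace (\<lambda>u. curvature G x u v w)"
  by (simp add: ricci_tensor_def ltrace_def)

lemma linear_ricci:
  assumes x: "x \<in> S" shows "linear (ricci_tensor G x v)"
  by (intro linearI) (simp_all add: ricci_ltrace linear_add[OF linear_curvature_3[OF x]]
    linear_scale[OF linear_curvature_3[OF x]] ltrace_add ltrace_scaleR)

lemma ricci_operator:
  assumes x: "x \<in> S" shows "metric_at (G x) (ricci_operator G x u) v = ricci_tensor G x u v"
proof -
  \<comment> \<open>The covector \<open>ricci_tensor G x u\<close> with its index raised;
    nondegeneracy makes it the only candidate for \<open>THE\<close>.\<close>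
  define w where "w = matrix_inv (G x) *v (\<chi> k. ricci_tensor G x u (axis k 1))"
  have w: "metric_at (G x) w v = ricci_tensor G x u v" for v
  proof -
    have "metric_at (G x) w v = metric_at (G x) v w" by (rule metric_sym[OF x])
    also have "\<dots> = (\<Sum>k\<in>UNIV. v $ k * ricci_tensor G x u (axis k 1))"
      by (simp add: metric_at_def w_def matrix_vector_mul_assoc matrix_inv_cancel[OF inv_G[OF x]] inner_vec_def)
    also have "\<dots> = ricci_tensor G x u v"
      using linear_axis_expand[OF linear_ricci[OF x], of v u] by simp
    finally show ?thesis .
  qed
  have "ricci_operator G x u = w" unfolding ricci_operator_def
  proof (rule the_equality)
    fix w' assume "\<forall>v. metric_at (G x) w' v = ricci_tensor G x u v"
    then show "w' = w" by (intro metric_eqI[OF x]) (simp add: metric_sym[OF x, of _ w'] metric_sym[OF x, of _ w] w)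
  qed (simp add: w)
  then show ?thesis using w by simp
qed

lemma linear_cov: "x \<in> S \<Longrightarrow> V differentiable (at x) \<Longrightarrow> linear (cov G V x)"
  unfolding cov_def by (intro linear_compose_add linear_frechet_derivative linear_christoffel_left)

lemma matrix_inv_sym: assumes x: "x \<in> S" shows "matrix_inv (G x) $ i $ j = matrix_inv (G x) $ j $ i"
proof -
  have "transpose (matrix_inv (G x)) ** G x = mat 1"
    using arg_cong[OF matrix_inv_cancel(1)[OF inv_G[OF x]], of transpose]
    by (simp add: matrix_transpose_mul sym_G[OF x] transpose_mat)
  then have "transpose (matrix_inv (G x)) ** G x ** matrix_inv (G x) = mat 1 ** matrix_inv (G x)"
    by (simp only:)
  then have "transpose (matrix_inv (G x)) = matrix_inv (G x)"
    by (simp add: matrix_mul_assoc[symmetric] matrix_inv_cancel[OF inv_G[OF x]])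
  from arg_cong[OF this, of "\<lambda>A. A $ i $ j"] show ?thesis by (simp add: transpose_def)
qed

text \<open>Replaces a contraction with the inverse metric by the trace of a composition. The
  adjoint is an assumption, not a construction, because for \<nabla>\<xi> it is the explicit map
  \<nabla>\<xi> + 2 \<phi>.\<close>

lemma contraction_ltrace:
  assumes x: "x \<in> S" and A': "linear A'" and adj: "\<And>u v. metric_at (G x) (A u) v = metric_at (G x) u (A' v)"
  shows "(\<Sum>i\<in>UNIV. \<Sum>j\<in>UNIV. matrix_inv (G x) $ i $ j * metric_at (G x) (A (axis i 1)) (B (axis j 1)))
    = ltrace (\<lambda>u. A' (B u))"
proof -
  have "(\<Sum>i\<in>UNIV. matrix_inv (G x) $ i $ j * metric_at (G x) (A (axis i 1)) w) = A' w $ j" for j w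
  proof -
    have "(\<Sum>i\<in>UNIV. matrix_inv (G x) $ i $ j * metric_at (G x) (A (axis i 1)) w)
      = (\<Sum>i\<in>UNIV. matrix_inv (G x) $ j $ i * (G x *v A' w) $ i)"
      by (subst adj) (simp add: matrix_inv_sym[OF x, of _ j] metric_at_def inner_axis')
    also have "\<dots> = (matrix_inv (G x) *v (G x *v A' w)) $ j"
      by (simp add: matrix_vector_mult_def[of "matrix_inv (G x)"])
    finally show ?thesis by (simp add: matrix_vector_mul_assoc matrix_inv_cancel[OF inv_G[OF x]])
  qed
  then show ?thesis by (subst sum.swap) (simp add: ltrace_sum)
qed

end

section \<open>Paracontact structures in a chart\<close>

lemma det_derivative_at_identity:
  fixes C :: "real^'n::finite^'n"
  shows "((\<lambda>t. det (mat 1 + t *\<^sub>R C)) has_real_derivative trace C) (at 0)"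
proof -
  let ?P = "{p. p permutes (UNIV::'n set)}"
  let ?f = "\<lambda>p i t. (if i = p i then 1 else 0) + t * C $ i $ p i"
  let ?d = "\<lambda>p y. \<Sum>i\<in>UNIV. (y * C $ i $ p i) * (\<Prod>j\<in>UNIV - {i}. ?f p j 0)"
  have "((\<lambda>t. \<Prod>i\<in>UNIV. ?f p i t) has_derivative ?d p) (at 0)" for p
    by (rule has_derivative_prod) (auto intro!: derivative_eq_intros)
  then have "((\<lambda>t. \<Sum>p\<in>?P. of_int (sign p) * (\<Prod>i\<in>UNIV. ?f p i t)) has_derivative
       (\<lambda>y. \<Sum>p\<in>?P. of_int (sign p) * ?d p y)) (at 0)"
    by (intro has_derivative_sum has_derivative_mult_right)
  moreover have "det (mat 1 + t *\<^sub>R C) = (\<Sum>p\<in>?P. of_int (sign p) * (\<Prod>i\<in>UNIV. ?f p i t))" for t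
    by (simp add: det_def mat_def)
  moreover have "(\<Sum>p\<in>?P. of_int (sign p) * ?d p y) = trace C * y" for y
  proof -
    \<comment> \<open>A permutation other than the identity moves at least two indices.
      Differentiating one factor of its product leaves another moved index j, whose factor is an
      off-diagonal entry of the identity matrix.\<close>
    have z: "?d p y = 0" if p: "p \<in> ?P" "p \<noteq> id" for p
    proof (rule sum.neutral, rule ballI)
      fix i
      obtain k where k: "p k \<noteq> k" using p(2) by (auto simp: fun_eq_iff)
      have inj: "inj p" using p(1) permutes_inj by auto
      obtain j where "j \<noteq> i" "p j \<noteq> j"
        using k inj_eq[OF inj, of "p k" k] by (cases "k = i") auto
      then have "(\<Prod>j\<in>UNIV - {i}. ?f p j 0) = 0"
        by (intro prod_zero bexI[of _ j]) auto
      then show "(y * C $ i $ p i) * (\<Prod>j\<in>UNIV - {i}. ?f p j 0) = 0" by simp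
    qed
    have "(\<Sum>p\<in>?P. of_int (sign p) * ?d p y) = (\<Sum>p\<in>{id}. of_int (sign p) * ?d p y)"
      by (rule sum.mono_neutral_right) (use z permutes_id in \<open>auto simp: finite_permutations\<close>)
    then show ?thesis by (simp add: trace_def sum_distrib_right sum_distrib_left mult.commute sign_id)
  qed
  ultimately show ?thesis by (simp add: has_field_derivative_def)
qed

text \<open>Jacobi's formula. The factorisation
  \<open>A + t B = A (1 + t A\<^sup>-\<^sup>1 B)\<close> reduces it to the identity matrix;
  uniqueness of the derivative compares the outcome with the chain rule.\<close>

lemma det_derivative:
  fixes A :: "'a::real_normed_vector \<Rightarrow> real^'n::finite^'n"
  assumes A: "A differentiable (at x)" and inv: "invertible (A x)"
  shows "\<D> (\<lambda>y. det (A y)) x u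
     = det (A x) * trace (matrix_inv (A x) ** \<D> A x u)"
proof -
  let ?B = "\<D> A x u"
  have dd: "(det :: real^'n^'n \<Rightarrow> real) differentiable (at M)" for M
    using smooth_on_differentiable[OF smooth_on_det[OF open_UNIV smooth_on_bounded_linear[OF bounded_linear_ident]]]
    by simp
  have 1: "((\<lambda>t. det (A x + t *\<^sub>R ?B)) has_derivative (\<lambda>t. \<D> det (A x) (t *\<^sub>R ?B))) (at 0)"
  proof -
    have "((\<lambda>t::real. A x + t *\<^sub>R ?B) has_derivative (\<lambda>t. t *\<^sub>R ?B)) (at 0)"
      by (auto intro!: derivative_eq_intros)
    from has_derivative_compose[OF this, of det] frechet_derivative_worksI[OF dd, of "A x"] show ?thesis by simp
  qed
  have 2: "((\<lambda>t. det (A x + t *\<^sub>R ?B)) has_derivative (\<lambda>t. (det (A x) * trace (matrix_inv (A x) ** ?B)) * t)) (at 0)"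
  proof -
    have "A x + t *\<^sub>R ?B = A x ** (mat 1 + t *\<^sub>R (matrix_inv (A x) ** ?B))" for t
      by (simp add: matrix_add_ldistrib matrix_mul_assoc matrix_inv_cancel[OF inv]
          bounded_bilinear.scaleR_right[OF bounded_bilinear_matrix_matrix_mult])
    then have "det (A x + t *\<^sub>R ?B) = det (A x) * det (mat 1 + t *\<^sub>R (matrix_inv (A x) ** ?B))" for t
      by (simp add: det_mul)
    moreover have "((\<lambda>t. det (A x) * det (mat 1 + t *\<^sub>R (matrix_inv (A x) ** ?B))) has_real_derivative
        det (A x) * trace (matrix_inv (A x) ** ?B)) (at 0)"
      by (rule DERIV_cmult[OF det_derivative_at_identity])
    ultimately show ?thesis by (simp add: has_field_derivative_def)
  qed
  have "\<D> (\<lambda>y. det (A y)) x u = \<D> det (A x) (1 *\<^sub>R ?B)"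
    using frechet_derivative_compose_at[OF dd A] by simp
  also have "\<dots> = (det (A x) * trace (matrix_inv (A x) ** ?B)) * 1"
    using has_derivative_unique[OF 1 2] by (rule fun_cong)
  finally show ?thesis by simp
qed

definition volume_density :: "(real^'d \<Rightarrow> real^'d^'d) \<Rightarrow> real^'d::finite \<Rightarrow> real" where
  "volume_density G x = sqrt \<bar>det (G x)\<bar>"

context chart_metric
begin

lemma det_G: "x \<in> S \<Longrightarrow> det (G x) \<noteq> 0"
  using inv_G invertible_det_nz by blast

lemma volume_density_pos: "x \<in> S \<Longrightarrow> volume_density G x > 0"
  by (simp add: volume_density_def det_G)

lemma ltrace_id_contraction:
  assumes x: "x \<in> S"
  shows "(\<Sum>i\<in>UNIV. \<Sum>j\<in>UNIV. matrix_inv (G x) $ i $ j * metric_at (G x) (axis i 1) (B (axis j 1))) = ltrace B"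
  using contraction_ltrace[OF x linear_ident, of "\<lambda>u. u" B] by simp

lemma trace_dG:
  assumes x: "x \<in> S"
  shows "trace (matrix_inv (G x) ** dG x u) = 2 * ltrace (christoffel G x u)"
proof -
  let ?I = "\<lambda>i j. matrix_inv (G x) $ i $ j"
  have e: "dG x u $ j $ i = metric_at (dG x u) (axis i 1) (axis j 1)" for i j
    by (subst sym_dG[OF x]) (simp add: metric_at_def inner_axis' matrix_vector_mult_basis column_def)
  have "trace (matrix_inv (G x) ** dG x u) = (\<Sum>i\<in>UNIV. \<Sum>j\<in>UNIV. ?I i j * metric_at (dG x u) (axis i 1) (axis j 1))"
    by (simp add: trace_def matrix_matrix_mult_def e)
  also have "\<dots> = (\<Sum>i\<in>UNIV. \<Sum>j\<in>UNIV. ?I i j * metric_at (G x) (christoffel G x u (axis i 1)) (axis j 1))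
      + (\<Sum>i\<in>UNIV. \<Sum>j\<in>UNIV. ?I i j * metric_at (G x) (axis i 1) (christoffel G x u (axis j 1)))"
    by (simp add: metric_compatible[OF x] distrib_left sum.distrib)
  also have "(\<Sum>i\<in>UNIV. \<Sum>j\<in>UNIV. ?I i j * metric_at (G x) (christoffel G x u (axis i 1)) (axis j 1))
     = (\<Sum>i\<in>UNIV. \<Sum>j\<in>UNIV. ?I i j * metric_at (G x) (axis i 1) (christoffel G x u (axis j 1)))"
    by (subst sum.swap, rule sum.cong[OF refl], rule sum.cong[OF refl])
      (simp add: matrix_inv_sym[OF x] metric_sym[OF x, of "christoffel G x u _"])
  finally show ?thesis by (simp add: ltrace_id_contraction[OF x] eta_contract_eq)
qed

text \<open>The logarithmic derivative of sqrt |det G| along u is half the trace of the inverse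
  metric times the derivative of G, which is the trace of the Christoffel map of u. The absolute
  value admits both signs of the determinant.\<close>

lemma volume_density_derivative:
  assumes x: "x \<in> S"
  shows "(volume_density G has_derivative (\<lambda>u. volume_density G x * ltrace (christoffel G x u))) (at x)"
proof -
  let ?d = "\<lambda>y. det (G y)"
  have dd: "(?d has_derivative (\<lambda>u. ?d x * (2 * ltrace (christoffel G x u)))) (at x)"
  proof -
    have "?d differentiable (at x)"
      by (rule smooth_on_differentiable[OF smooth_on_det[OF open_S smooth_G] x])
    moreover have "\<D> ?d x = (\<lambda>u. ?d x * (2 * ltrace (christoffel G x u)))"
      using det_derivative[OF diff_G[OF x] inv_G[OF x]] trace_dG[OF x] by (simp add: fun_eq_iff)
    ultimately show ?thesis using frechet_derivative_worksI by metis
  qed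
  have "((\<lambda>y. \<bar>?d y\<bar>) has_derivative (\<lambda>u. sgn (?d x) * (?d x * (2 * ltrace (christoffel G x u))))) (at x)"
    using has_derivative_compose[OF dd has_derivative_norm[OF det_G[OF x], unfolded real_norm_def]]
    by (simp add: mult.commute)
  then have a: "((\<lambda>y. \<bar>?d y\<bar>) has_derivative (\<lambda>u. \<bar>?d x\<bar> * (2 * ltrace (christoffel G x u)))) (at x)"
    by (simp add: mult.assoc[symmetric] abs_sgn mult.commute[of "sgn _"])
  have "((\<lambda>y. sqrt \<bar>?d y\<bar>) has_derivative (\<lambda>u. (\<bar>?d x\<bar> * (2 * ltrace (christoffel G x u))) * (inverse (sqrt \<bar>?d x\<bar>) / 2))) (at x)"
    by (rule has_derivative_compose[OF a, where g = sqrt, THEN has_derivative_eq_rhs])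
      (use DERIV_real_sqrt[of "\<bar>?d x\<bar>"] det_G[OF x] in \<open>auto simp: has_field_derivative_def\<close>)
  moreover have "(\<bar>?d x\<bar> * (2 * t)) * (inverse (sqrt \<bar>?d x\<bar>) / 2) = sqrt \<bar>?d x\<bar> * t" for t
  proof -
    have "\<bar>?d x\<bar> = sqrt \<bar>?d x\<bar> * sqrt \<bar>?d x\<bar>" by simp
    then show ?thesis using det_G[OF x] by (simp add: field_simps)
  qed
  ultimately show ?thesis unfolding volume_density_def[abs_def] by (simp only:)
qed

text \<open>The classical coordinate formula for the divergence: weighted by the volume density, the
  covariant divergence becomes a plain sum of partial derivatives, which can be integrated over the
  coordinate space.\<close>

lemma ltrace_weighted_derivative:
  assumes x: "x \<in> S" and X: "X differentiable (at x)"
  shows "ltrace (\<D> (\<lambda>y. volume_density G y *\<^sub>R X y) x) = volume_density G x * divergence G X x"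
proof -
  let ?\<rho> = "volume_density G"
  have 0: "((\<lambda>y. ?\<rho> y *\<^sub>R X y) has_derivative
     (\<lambda>u. ?\<rho> x *\<^sub>R \<D> X x u + (?\<rho> x * ltrace (christoffel G x u)) *\<^sub>R X x)) (at x)"
    by (rule has_derivative_scaleR[OF volume_density_derivative[OF x] frechet_derivative_worksI[OF X]])
  have "linear (\<lambda>u. ?\<rho> x * ltrace (christoffel G x u))"
    by (rule linearI) (simp_all add: christoffel_add[OF x] christoffel_scale[OF x] ltrace_add[where f = "christoffel G x _"]
        ltrace_scaleR[where f = "christoffel G x _"] ltrace_sum sum.distrib sum_distrib_left algebra_simps)
  then have "ltrace (\<lambda>u. (?\<rho> x * ltrace (christoffel G x u)) *\<^sub>R X x) = ?\<rho> x * ltrace (christoffel G x (X x))"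
    by (rule ltrace_rank_one)
  moreover have "christoffel G x (X x) = (\<lambda>u. christoffel G x u (X x))"
    by (rule ext) (rule christoffel_sym[OF x])
  ultimately show ?thesis
    by (simp add: has_derivative_imp_frechet[OF 0] ltrace_add ltrace_scaleR divergence_def cov_def[abs_def] distrib_left)
qed

lemma ltrace_derivative:
  assumes "\<And>i. (\<lambda>y. f y (axis i 1)) differentiable (at x)"
  shows "((\<lambda>y. ltrace (f y)) has_derivative (\<lambda>u. ltrace (\<lambda>v. \<D> (\<lambda>y. f y v) x u))) (at x)"
  unfolding ltrace_sum
  by (rule has_derivative_sum, rule bounded_linear.has_derivative[OF bounded_linear_vec_nth frechet_derivative_worksI[OF assms]])

end

section \<open>Covariant derivatives of \<eta>, \<xi> and \<phi>, and their traces\<close>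

locale paracontact_chart = chart_metric S G
  for S :: "(real^'d::finite) set" and G :: "real^'d \<Rightarrow> real^'d^'d" +
  fixes \<phi> :: "real^'d \<Rightarrow> real^'d^'d" and \<xi> \<eta> :: "real^'d \<Rightarrow> real^'d"
  assumes smooth_\<phi>: "smooth_on S \<phi>" and smooth_\<xi>: "smooth_on S \<xi>" and smooth_\<eta>: "smooth_on S \<eta>"
    and eta_xi: "\<And>x. x \<in> S \<Longrightarrow> \<eta> x \<bullet> \<xi> x = 1"
    and reeb: "\<And>x v. x \<in> S \<Longrightarrow> ext_deriv \<eta> x (\<xi> x) v = 0"
    and eta_metric: "\<And>x v. x \<in> S \<Longrightarrow> \<eta> x \<bullet> v = metric_at (G x) (\<xi> x) v"
    and deta_metric: "\<And>x u v. x \<in> S \<Longrightarrow> ext_deriv \<eta> x u v = metric_at (G x) u (\<phi> x *v v)"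
    and phi_square: "\<And>x v. x \<in> S \<Longrightarrow> \<phi> x *v (\<phi> x *v v) = v - (\<eta> x \<bullet> v) *\<^sub>R \<xi> x"
begin

lemma diff_\<phi>: "x \<in> S \<Longrightarrow> \<phi> differentiable (at x)"
  and diff_\<xi>: "x \<in> S \<Longrightarrow> \<xi> differentiable (at x)"
  and diff_\<eta>: "x \<in> S \<Longrightarrow> \<eta> differentiable (at x)"
  using smooth_on_differentiable smooth_\<phi> smooth_\<xi> smooth_\<eta> by blast+

abbreviation "d\<eta> x u \<equiv> \<D> \<eta> x u"
abbreviation "d\<phi> x u \<equiv> \<D> \<phi> x u"
abbreviation "\<omega> x u v \<equiv> ext_deriv \<eta> x u v"

text \<open>\<open>cov_eta x w v\<close> is (\<nabla>_w \<eta>) v, and \<open>cov_phi x w v\<close>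
  below is (\<nabla>_w \<phi>) v. Both are tensorial in v, so v may be extended with constant
  components.\<close>

definition cov_eta :: "real^'d \<Rightarrow> real^'d \<Rightarrow> real^'d \<Rightarrow> real" where
  "cov_eta x w v = d\<eta> x w \<bullet> v - \<eta> x \<bullet> christoffel G x w v"

definition cov_phi :: "real^'d \<Rightarrow> real^'d \<Rightarrow> real^'d \<Rightarrow> real^'d" where
  "cov_phi x w v = d\<phi> x w *v v + christoffel G x w (\<phi> x *v v) - \<phi> x *v christoffel G x w v"

lemma omega_eq:
  assumes "x \<in> S" shows "\<omega> x u v = (1/2) * (d\<eta> x u \<bullet> v - d\<eta> x v \<bullet> u)"
  using diff_\<eta>[OF assms]
  by (simp add: ext_deriv_def ext_deriv_on_fields_def lie_bracket_def frechet_derivative_inner_const)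

lemma omega_antisym: "x \<in> S \<Longrightarrow> \<omega> x u v = - \<omega> x v u"
  by (simp add: omega_eq field_simps)

text \<open>As \<nabla>g = 0, lowering the index of \<xi> commutes with covariant
  differentiation.\<close>

lemma cov_eta_metric:
  assumes x: "x \<in> S"
  shows "cov_eta x w v = metric_at (G x) (cov G \<xi> x w) v"
proof -
  have "d\<eta> x w \<bullet> v = \<D> (\<lambda>y. \<eta> y \<bullet> v) x w"
    by (rule frechet_derivative_inner_const[OF diff_\<eta>[OF x], symmetric])
  also have "\<dots> = \<D> (\<lambda>y. metric_at (G y) (\<xi> y) v) x w"
    by (rule fun_cong[OF frechet_derivative_cong_open[OF open_S x]]) (rule eta_metric)
  also have "\<dots> = metric_at (dG x w) (\<xi> x) v + metric_at (G x) (\<D> \<xi> x w) v"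
    using metric_fields_derivative(1)[OF x diff_\<xi>[OF x], of "\<lambda>_. v"] by (simp add: metric_at_simps)
  finally show ?thesis
    by (simp add: cov_eta_def cov_def eta_metric[OF x] metric_compatible[OF x] metric_at_simps)
qed

text \<open>Differentiating \<eta>(\<xi>) = 1 shows that the two expressions add up to zero, and
  metric duality shows that they are equal.\<close>

lemma eta_cov_xi:
  assumes x: "x \<in> S"
  shows "cov_eta x w (\<xi> x) = 0" "\<eta> x \<bullet> cov G \<xi> x w = 0"
proof -
  have "\<D> (\<lambda>y. \<eta> y \<bullet> \<xi> y) x w = \<D> (\<lambda>_. 1::real) x w"
    by (rule fun_cong[OF frechet_derivative_cong_open[OF open_S x]]) (rule eta_xi)
  then have "\<eta> x \<bullet> \<D> \<xi> x w + d\<eta> x w \<bullet> \<xi> x = 0"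
    by (simp add: frechet_derivative_bilinear[OF bounded_bilinear_inner diff_\<eta>[OF x] diff_\<xi>[OF x]])
  then have 1: "cov_eta x w (\<xi> x) + \<eta> x \<bullet> cov G \<xi> x w = 0"
    by (simp add: cov_eta_def cov_def inner_add_right)
  moreover have "cov_eta x w (\<xi> x) = \<eta> x \<bullet> cov G \<xi> x w"
    by (simp add: cov_eta_metric[OF x] eta_metric[OF x] metric_sym[OF x])
  ultimately show "cov_eta x w (\<xi> x) = 0" "\<eta> x \<bullet> cov G \<xi> x w = 0" by simp_all
qed

lemma cov_eta_skew:
  assumes x: "x \<in> S" shows "cov_eta x u v - cov_eta x v u = 2 * \<omega> x u v"
  by (simp add: cov_eta_def omega_eq[OF x] christoffel_sym[OF x, of u v])

text \<open>By duality this says that the derivative of \<xi> along itself vanishes: the Reeb orbits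
  are geodesics. It follows from d\<eta>(\<xi>, v) = 0 and the skew part of \<nabla>\<eta>.\<close>

lemma cov_eta_xi: assumes x: "x \<in> S" shows "cov_eta x (\<xi> x) v = 0"
  using cov_eta_skew[OF x, of "\<xi> x" v] eta_cov_xi(1)[OF x, of v] reeb[OF x] by simp

lemma phi_xi: assumes x: "x \<in> S" shows "\<phi> x *v \<xi> x = 0"
proof (rule metric_eqI[OF x])
  fix w show "metric_at (G x) w (\<phi> x *v \<xi> x) = metric_at (G x) w 0"
    using deta_metric[OF x, of w "\<xi> x"] omega_antisym[OF x, of w "\<xi> x"] reeb[OF x] by (simp add: metric_at_simps)
qed

lemma phi_skew: assumes x: "x \<in> S" shows "metric_at (G x) (\<phi> x *v u) v = - metric_at (G x) u (\<phi> x *v v)"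
  using deta_metric[OF x] omega_antisym[OF x, of u v] by (simp add: metric_sym[OF x, of "\<phi> x *v u"])

lemma linear_phi: "linear ((*v) (\<phi> x))"
  by (rule matrix_vector_mul_linear)

lemma linear_cov_phi: assumes x: "x \<in> S"
  shows "linear (cov_phi x w)" "linear (\<lambda>w. cov_phi x w v)"
proof -
  have a: "linear (d\<phi> x)" by (rule linear_frechet_derivative[OF diff_\<phi>[OF x]])
  show "linear (cov_phi x w)" "linear (\<lambda>w. cov_phi x w v)"
    by (rule linearI; simp add: cov_phi_def linear_add[OF a] linear_scale[OF a] christoffel_add[OF x] christoffel_scale[OF x]
      matrix_vector_right_distrib matrix_vector_mult_add_rdistrib matrix_vector_mult_scaleR scaleR_matrix_vector_assoc[symmetric]
      algebra_simps)+
qed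

lemma linear_cov_eta: assumes x: "x \<in> S" shows "linear (\<lambda>w. cov_eta x w v)"
proof -
  have a: "linear (d\<eta> x)" by (rule linear_frechet_derivative[OF diff_\<eta>[OF x]])
  show ?thesis
    by (rule linearI; simp add: cov_eta_def linear_add[OF a] linear_scale[OF a] christoffel_add[OF x] christoffel_scale[OF x]
       inner_add_left inner_add_right algebra_simps)
qed

lemma phi_field_derivative:
  assumes x: "x \<in> S" and U: "U differentiable (at x)"
  shows "\<D> (\<lambda>y. \<phi> y *v U y) x w = d\<phi> x w *v U x + \<phi> x *v \<D> U x w"
    and "(\<lambda>y. \<phi> y *v U y) differentiable (at x)"
  using frechet_derivative_bilinear[OF bounded_bilinear_matrix_vector_mult diff_\<phi>[OF x] U, of w]
    differentiable_bilinear[OF bounded_bilinear_matrix_vector_mult diff_\<phi>[OF x] U]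
  by (simp_all add: add.commute)

text \<open>With \<nabla>g = 0, the covariant derivative of the form d\<eta> is the metric applied
  to \<nabla>\<phi>; the two Christoffel terms convert it into the partial derivative of the
  component function.\<close>

lemma omega_derivative:
  assumes x: "x \<in> S"
  shows "\<D> (\<lambda>y. \<omega> y u v) x w
      = metric_at (G x) u (cov_phi x w v) + \<omega> x (christoffel G x w u) v + \<omega> x u (christoffel G x w v)"
proof -
  have "\<D> (\<lambda>y. \<omega> y u v) x w = \<D> (\<lambda>y. metric_at (G y) u (\<phi> y *v v)) x w"
    by (rule fun_cong[OF frechet_derivative_cong_open[OF open_S x]]) (rule deta_metric)
  also have "\<dots> = metric_at (dG x w) u (\<phi> x *v v) + metric_at (G x) u (d\<phi> x w *v v)"
    using metric_fields_derivative(1)[OF x _ phi_field_derivative(2)[OF x], of "\<lambda>_. u" "\<lambda>_. v"]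
      phi_field_derivative(1)[OF x, of "\<lambda>_. v"] by (simp add: metric_at_simps)
  finally show ?thesis
    by (simp add: cov_phi_def deta_metric[OF x] metric_compatible[OF x] metric_at_simps)
qed

lemma cov_phi_skew:
  assumes x: "x \<in> S"
  shows "metric_at (G x) u (cov_phi x w v) = - metric_at (G x) v (cov_phi x w u)"
proof -
  have d: "(\<lambda>y. \<omega> y u v) differentiable (at x)" for u v
    by (subst differentiable_cong_open[OF open_S x deta_metric])
      (auto intro!: metric_fields_derivative(2)[OF x] phi_field_derivative(2)[OF x])
  have "\<D> (\<lambda>y. \<omega> y u v) x w = \<D> (\<lambda>y. - \<omega> y v u) x w"
    by (rule fun_cong[OF frechet_derivative_cong_open[OF open_S x]]) (rule omega_antisym)
  also have "\<dots> = - \<D> (\<lambda>y. \<omega> y v u) x w"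
    using has_derivative_imp_frechet[OF has_derivative_minus[OF frechet_derivative_worksI[OF d]]] by simp
  finally show ?thesis
    unfolding omega_derivative[OF x] omega_antisym[OF x, of "christoffel G x w u" v] omega_antisym[OF x, of u "christoffel G x w v"]
    by simp
qed

text \<open>The closedness of d\<eta>. In the cyclic sum the partial derivatives cancel by symmetry
  of second derivatives, and the Christoffel terms cancel in pairs by the symmetry of the symbols
  and the antisymmetry of the form.\<close>

lemma cov_phi_cyclic:
  assumes x: "x \<in> S"
  shows "metric_at (G x) u (cov_phi x w v) + metric_at (G x) v (cov_phi x u w) + metric_at (G x) w (cov_phi x v u) = 0"
proof -
  let ?d2 = "\<lambda>u w. \<D> (\<lambda>y. d\<eta> y u) x w"
  have s: "?d2 u w = ?d2 w u" for u w
    by (rule symmetric_second_derivative[OF open_S smooth_\<eta> x])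
  have d: "(\<lambda>y. d\<eta> y u) differentiable (at x)" for u
    by (rule smooth_on_differentiable[OF smooth_on_frechet_derivative[OF smooth_\<eta>] x])
  have *: "\<D> (\<lambda>y. \<omega> y u v) x w = (1/2) * (?d2 u w \<bullet> v - ?d2 v w \<bullet> u)" for u v w
  proof -
    have a: "\<D> (\<lambda>y. \<omega> y u v) x w = \<D> (\<lambda>y. (1/2) * (d\<eta> y u \<bullet> v - d\<eta> y v \<bullet> u)) x w"
      by (rule fun_cong[OF frechet_derivative_cong_open[OF open_S x]]) (rule omega_eq)
    have D: "((\<lambda>y. (1/2) * (d\<eta> y u \<bullet> v - d\<eta> y v \<bullet> u)) has_derivative (\<lambda>w. (1/2) * (?d2 u w \<bullet> v - ?d2 v w \<bullet> u))) (at x)"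
      by (intro has_derivative_mult_right has_derivative_diff has_derivative_inner_left frechet_derivative_worksI d)
    show ?thesis unfolding a has_derivative_imp_frechet[OF D] ..
  qed
  have "\<D> (\<lambda>y. \<omega> y u v) x w + \<D> (\<lambda>y. \<omega> y v w) x u
     + \<D> (\<lambda>y. \<omega> y w u) x v = 0"
    unfolding * s[of v w] s[of v u] s[of u w] by (simp add: field_simps)
  then show ?thesis
    unfolding omega_derivative[OF x] omega_antisym[OF x, of _ "christoffel G x _ _"]
      christoffel_sym[OF x, of u w] christoffel_sym[OF x, of v w] christoffel_sym[OF x, of v u]
    by simp
qed

text \<open>The covariant derivative along w of the identity for \<open>\<phi>\<^sup>2\<close>,
  applied to v.\<close>

lemma cov_phi_square:
  assumes x: "x \<in> S"
  shows "cov_phi x w (\<phi> x *v v) + \<phi> x *v cov_phi x w v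
     = - cov_eta x w v *\<^sub>R \<xi> x - (\<eta> x \<bullet> v) *\<^sub>R cov G \<xi> x w"
proof -
  have "\<D> (\<lambda>y. \<phi> y *v (\<phi> y *v v)) x w = d\<phi> x w *v (\<phi> x *v v) + \<phi> x *v (d\<phi> x w *v v)"
    using phi_field_derivative(1)[OF x phi_field_derivative(2)[OF x], of "\<lambda>_. v"] phi_field_derivative(1)[OF x, of "\<lambda>_. v"]
    by simp
  moreover have "\<D> (\<lambda>y. \<phi> y *v (\<phi> y *v v)) x w = \<D> (\<lambda>y. v - (\<eta> y \<bullet> v) *\<^sub>R \<xi> y) x w"
    by (rule fun_cong[OF frechet_derivative_cong_open[OF open_S x]]) (rule phi_square)
  moreover have D0: "((\<lambda>y. v - (\<eta> y \<bullet> v) *\<^sub>R \<xi> y) has_derivative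
     (\<lambda>w. 0 - ((\<eta> x \<bullet> v) *\<^sub>R \<D> \<xi> x w + (d\<eta> x w \<bullet> v) *\<^sub>R \<xi> x))) (at x)"
    by (intro has_derivative_diff has_derivative_const has_derivative_scaleR has_derivative_inner_left
      frechet_derivative_worksI diff_\<eta>[OF x] diff_\<xi>[OF x])
  ultimately have D: "d\<phi> x w *v (\<phi> x *v v) + \<phi> x *v (d\<phi> x w *v v)
     = - ((\<eta> x \<bullet> v) *\<^sub>R \<D> \<xi> x w + (d\<eta> x w \<bullet> v) *\<^sub>R \<xi> x)"
    by (simp add: has_derivative_imp_frechet[OF D0])
  have "cov_phi x w (\<phi> x *v v) + \<phi> x *v cov_phi x w v
     = (d\<phi> x w *v (\<phi> x *v v) + \<phi> x *v (d\<phi> x w *v v))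
       + christoffel G x w (\<phi> x *v (\<phi> x *v v)) - \<phi> x *v (\<phi> x *v christoffel G x w v)"
    by (simp add: cov_phi_def matrix_vector_right_distrib matrix_vector_mult_diff_distrib)
  then show ?thesis
    unfolding D phi_square[OF x]
    by (simp add: cov_eta_def cov_def christoffel_diff[OF x] christoffel_scale[OF x] algebra_simps)
qed

text \<open>The cyclic identity makes \<open>u \<mapsto> (\<nabla>\<^sub>u \<phi>) v - (\<nabla>\<^sub>v \<phi>) u\<close> the adjoint of \<open>u \<mapsto> (\<nabla>\<^sub>u \<phi>) v\<close>, so
  taking adjoints expresses the trace through its own negative.\<close>

lemma ltrace_phi_cov_phi:
  assumes x: "x \<in> S"
  shows "ltrace (\<lambda>w. \<phi> x *v cov_phi x w v) = 0"
proof -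
  let ?g = "metric_at (G x)" and ?F = "cov_phi x"
  have lF: "linear (\<lambda>u. ?F u v - ?F v u)"
    by (intro linear_compose_sub linear_cov_phi[OF x])
  have "ltrace (\<lambda>w. \<phi> x *v ?F w v) = ltrace (\<lambda>u. - (?F (\<phi> x *v u) v - ?F v (\<phi> x *v u)))"
  proof (rule ltrace_adjoint[OF inv_G[OF x]])
    show "linear (\<lambda>w. \<phi> x *v ?F w v)"
      using linear_compose[OF linear_cov_phi(2)[OF x] linear_phi] by (simp add: comp_def)
    show "linear (\<lambda>u. - (?F (\<phi> x *v u) v - ?F v (\<phi> x *v u)))"
      using linear_compose[OF linear_phi linear_compose_neg[OF lF]] by (simp add: comp_def)
    fix w u
    have adj: "?g (?F w v) u = ?g w (?F u v - ?F v u)" for u w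
      using cov_phi_cyclic[OF x, of u w v] cov_phi_skew[OF x, of v u w]
      by (simp add: metric_at_simps metric_sym[OF x, of _ u])
    show "?g (\<phi> x *v ?F w v) u = ?g w (- (?F (\<phi> x *v u) v - ?F v (\<phi> x *v u)))"
      unfolding phi_skew[OF x] adj metric_at_simps by simp
  qed
  also have "\<dots> = ltrace (\<lambda>u. ?F v (\<phi> x *v u)) - ltrace (\<lambda>u. ?F (\<phi> x *v u) v)"
    by (simp add: ltrace_diff[symmetric])
  also have "ltrace (\<lambda>u. ?F (\<phi> x *v u) v) = ltrace (\<lambda>w. \<phi> x *v ?F w v)"
    by (rule ltrace_commute[OF linear_cov_phi(2)[OF x] linear_phi])
  finally have 1: "2 * ltrace (\<lambda>w. \<phi> x *v ?F w v) = ltrace (\<lambda>u. ?F v (\<phi> x *v u))" by simp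
  \<comment> \<open>Differentiating \<open>\<phi>\<^sup>2\<close> in the fixed direction v makes the
    sum of the two compositions a sum of two rank-one maps, each of trace zero. The two compositions
    have equal trace, so each trace vanishes.\<close>
  have "ltrace (\<lambda>u. ?F v (\<phi> x *v u)) + ltrace (\<lambda>u. \<phi> x *v ?F v u)
     = ltrace (\<lambda>u. - cov_eta x v u *\<^sub>R \<xi> x - (\<eta> x \<bullet> u) *\<^sub>R cov G \<xi> x v)"
    by (simp only: cov_phi_square[OF x] ltrace_add[symmetric])
  also have "\<dots> = - cov_eta x v (\<xi> x) - \<eta> x \<bullet> cov G \<xi> x v"
  proof -
    have l: "linear (\<lambda>u. - cov_eta x v u)"
      by (rule linearI) (simp_all add: cov_eta_def inner_add_right christoffel_add[OF x] christoffel_scale[OF x] algebra_simps)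
    have l2: "linear (\<lambda>u. \<eta> x \<bullet> u)" by (rule linearI) (simp_all add: inner_add_right)
    show ?thesis unfolding ltrace_diff ltrace_rank_one[OF l] ltrace_rank_one[OF l2] ..
  qed
  also have "\<dots> = 0" by (simp add: eta_cov_xi[OF x])
  also have "ltrace (\<lambda>u. \<phi> x *v ?F v u) = ltrace (\<lambda>u. ?F v (\<phi> x *v u))"
    by (rule ltrace_commute[OF linear_phi linear_cov_phi(1)[OF x]])
  finally show ?thesis using 1 by simp
qed

text \<open>The same derivative of \<open>\<phi>\<^sup>2\<close>, now traced over the direction w of
  differentiation. The rank-one term contributes (\<nabla>_\<xi> \<eta>) v, which is zero, and the
  other term contributes the divergence of \<xi>.\<close>

lemma ltrace_cov_phi_phi:
  assumes x: "x \<in> S"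
  shows "ltrace (\<lambda>w. cov_phi x w (\<phi> x *v v)) = - (\<eta> x \<bullet> v) * divergence G \<xi> x"
proof -
  have l: "linear (\<lambda>w. - cov_eta x w v)"
    using linear_compose_neg[OF linear_cov_eta[OF x]] .
  have "ltrace (\<lambda>w. cov_phi x w (\<phi> x *v v)) + ltrace (\<lambda>w. \<phi> x *v cov_phi x w v)
    = - cov_eta x (\<xi> x) v - (\<eta> x \<bullet> v) * ltrace (cov G \<xi> x)"
    by (simp only: ltrace_add[symmetric] cov_phi_square[OF x] ltrace_diff ltrace_rank_one[OF l] ltrace_scaleR)
  then show ?thesis by (simp add: ltrace_phi_cov_phi[OF x] cov_eta_xi[OF x] divergence_def)
qed

text \<open>The choice v = \<xi> annihilates the traced map, because \<phi>\<xi> = 0, and leaves the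
  divergence with the factor -1.\<close>

lemma divergence_xi: assumes x: "x \<in> S" shows "divergence G \<xi> x = 0"
  using ltrace_cov_phi_phi[OF x, of "\<xi> x"] phi_xi[OF x] linear_0[OF linear_cov_phi(1)[OF x]] eta_xi[OF x]
  by (simp add: ltrace_zero)

text \<open>A horizontal v equals \<open>\<phi> (\<phi> v)\<close>, so the preceding trace formula
  applies to \<open>\<phi> v\<close> and its right side contains the divergence of \<xi>, which is
  zero.\<close>

lemma divergence_phi: assumes x: "x \<in> S" and v: "\<eta> x \<bullet> v = 0" shows "ltrace (\<lambda>w. cov_phi x w v) = 0"
  using ltrace_cov_phi_phi[OF x, of "\<phi> x *v v"] phi_square[OF x, of v] v by (simp add: divergence_xi[OF x])

text \<open>A Bochner-type identity. The divergence of \<nabla>_U \<xi> is the trace of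
  \<nabla>\<xi> composed with \<nabla>U, plus the contracted second derivative of \<xi>; exchanging
  derivatives turns the latter into Ric(U, \<xi>) plus the derivative of div \<xi> along U. The
  divergence of \<phi>U is tr (\<phi> \<nabla>U) plus (div \<phi>)(U). Both div \<xi> and, on
  horizontal U, div \<phi> vanish.\<close>

lemma cov_pairing_eq:
  assumes x: "x \<in> S" and U: "U differentiable (at x)" and eU: "\<eta> x \<bullet> U x = 0"
  shows "cov_pairing G \<xi> U x
     = divergence G (\<lambda>y. cov G \<xi> y (U y) + 2 *\<^sub>R (\<phi> y *v U y)) x - ricci_tensor G x (U x) (\<xi> x)"
    and "(\<lambda>y. cov G \<xi> y (U y) + 2 *\<^sub>R (\<phi> y *v U y)) differentiable (at x)"
proof -
  let ?g = "metric_at (G x)" and ?C = "christoffel G x" and ?A = "cov G \<xi> x" and ?B = "cov G U x"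
  let ?D\<xi> = "\<lambda>u. \<D> \<xi> x u" and ?DU = "\<lambda>u. \<D> U x u"
  let ?D2 = "\<lambda>u v. \<D> (\<lambda>y. \<D> \<xi> y v) x u"
  have lA: "linear ?A" by (rule linear_cov[OF x diff_\<xi>[OF x]])
  have lB: "linear ?B" by (rule linear_cov[OF x U])
  have lD\<xi>: "linear ?D\<xi>" by (rule linear_frechet_derivative[OF diff_\<xi>[OF x]])
  have adj: "?g (?A u) v = ?g u (?A v + 2 *\<^sub>R (\<phi> x *v v))" for u v
    using cov_eta_skew[OF x, of u v] by (simp add: cov_eta_metric[OF x] deta_metric[OF x] metric_at_simps metric_sym[OF x, of u])
  have lA': "linear (\<lambda>v. ?A v + 2 *\<^sub>R (\<phi> x *v v))"
    by (intro linear_compose_add lA linear_compose_scale_right linear_phi)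
  \<comment> \<open>The skew part of \<nabla>\<xi> is d\<eta>, which accounts for the summand 2
    \<phi> in the adjoint used here.\<close>
  have P: "cov_pairing G \<xi> U x = ltrace (\<lambda>u. ?A (?B u)) + 2 * ltrace (\<lambda>u. \<phi> x *v ?B u)"
    unfolding cov_pairing_def contraction_ltrace[OF x lA' adj] ltrace_add ltrace_scaleR ..

  have D\<phi>U: "((\<lambda>y. \<phi> y *v U y) has_derivative (\<lambda>u. d\<phi> x u *v U x + \<phi> x *v ?DU u)) (at x)"
    using bounded_bilinear.FDERIV[OF bounded_bilinear_matrix_vector_mult
        frechet_derivative_worksI[OF diff_\<phi>[OF x]] frechet_derivative_worksI[OF U]]
    by (simp add: add.commute)
  have d\<xi>U: "((\<lambda>y. \<D> \<xi> y (U y)) has_derivative (\<lambda>u. ?D2 u (U x) + ?D\<xi> (?DU u))) (at x)"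
    by (rule linear_in_basis_derivative[OF open_S x linear_frechet_derivative[OF diff_\<xi>]
          smooth_on_differentiable[OF smooth_on_frechet_derivative[OF smooth_\<xi>] x] U])
  have DcovU: "((\<lambda>y. cov G \<xi> y (U y)) has_derivative (\<lambda>u. (?D2 u (U x) + ?D\<xi> (?DU u))
      + (d\<Gamma> x u (U x) (\<xi> x) + ?C (?DU u) (\<xi> x) + ?C (U x) (?D\<xi> u)))) (at x)"
    unfolding cov_def by (rule has_derivative_add[OF d\<xi>U christoffel_fields_derivative[OF x U diff_\<xi>[OF x]]])
  note DX = has_derivative_add[OF DcovU has_derivative_scaleR_right[OF D\<phi>U, of 2]]
  show "(\<lambda>y. cov G \<xi> y (U y) + 2 *\<^sub>R (\<phi> y *v U y)) differentiable (at x)"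
    by (rule differentiableI[OF DX])

  have "ltrace (\<lambda>u. \<phi> x *v ?B u) = ltrace (\<lambda>u. (d\<phi> x u *v U x + \<phi> x *v ?DU u) + ?C u (\<phi> x *v U x))
      - ltrace (\<lambda>u. cov_phi x u (U x))"
    unfolding ltrace_diff[symmetric] cov_phi_def cov_def by (simp add: matrix_vector_right_distrib)
  then have T\<phi>: "ltrace (\<lambda>u. \<phi> x *v ?B u) = ltrace (\<lambda>u. (d\<phi> x u *v U x + \<phi> x *v ?DU u) + ?C u (\<phi> x *v U x))"
    using divergence_phi[OF x eU] by simp

  \<comment> \<open>The identity div \<xi> = 0 holds on all of S and can be differentiated along
    \<open>U x\<close>; the trace is written with exactly the terms that appear in the decomposition
    below.\<close>
  have ddiv: "ltrace (\<lambda>u. ?D2 (U x) u + (d\<Gamma> x (U x) u (\<xi> x) + ?C u (?D\<xi> (U x)))) = 0"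
  proof -
    have c: "((\<lambda>y. cov G \<xi> y a) has_derivative
        (\<lambda>w. ?D2 w a + (d\<Gamma> x w a (\<xi> x) + ?C 0 (\<xi> x) + ?C a (?D\<xi> w)))) (at x)" for a
      unfolding cov_def
      using has_derivative_add[OF frechet_derivative_worksI[OF smooth_on_differentiable[OF smooth_on_frechet_derivative[OF smooth_\<xi>] x]]
         christoffel_fields_derivative[OF x _ diff_\<xi>[OF x], of "\<lambda>_. a"], of a] by simp
    have "((\<lambda>y. divergence G \<xi> y) has_derivative
      (\<lambda>w. ltrace (\<lambda>v. \<D> (\<lambda>y. cov G \<xi> y v) x w))) (at x)"
      unfolding divergence_def by (rule ltrace_derivative) (rule differentiableI[OF c])
    from has_derivative_imp_frechet[OF this]
    have "\<D> (\<lambda>y. divergence G \<xi> y) x (U x)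
       = ltrace (\<lambda>v. \<D> (\<lambda>y. cov G \<xi> y v) x (U x))" by (simp only:)
    moreover have "\<D> (\<lambda>y. divergence G \<xi> y) x (U x) = \<D> (\<lambda>_. 0::real) x (U x)"
      by (rule fun_cong[OF frechet_derivative_cong_open[OF open_S x]]) (rule divergence_xi)
    ultimately show ?thesis
      by (simp add: has_derivative_imp_frechet[OF c] linear_0[OF linear_christoffel_left[OF x]])
  qed
  have c1: "ltrace (\<lambda>u. ?C (U x) (?D\<xi> u)) = ltrace (\<lambda>u. ?D\<xi> (?C (U x) u))"
    by (rule ltrace_commute[OF linear_christoffel[OF x] lD\<xi>])
  have c2: "ltrace (\<lambda>u. ?C (U x) (?C (\<xi> x) u)) = ltrace (\<lambda>u. ?C (\<xi> x) (?C (U x) u))"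
    by (rule ltrace_commute[OF linear_christoffel[OF x] linear_christoffel[OF x]])
  \<comment> \<open>The covariant derivative of \<nabla>_U \<xi> is split, before tracing, into
    \<nabla>\<xi> after \<nabla>U, the curvature map whose trace is the Ricci tensor, the integrand
    of \<open>ddiv\<close>, and two commutators. Commutators have trace zero by \<open>c1\<close>
    and \<open>c2\<close>.\<close>
  have "((?D2 u (U x) + ?D\<xi> (?DU u)) + (d\<Gamma> x u (U x) (\<xi> x) + ?C (?DU u) (\<xi> x) + ?C (U x) (?D\<xi> u)) + ?C u (?A (U x)))
      = ?A (?B u) + curvature G x u (U x) (\<xi> x)
       + (?D2 (U x) u + (d\<Gamma> x (U x) u (\<xi> x) + ?C u (?D\<xi> (U x))))
       + (?C (U x) (?D\<xi> u) - ?D\<xi> (?C (U x) u)) + (?C (U x) (?C (\<xi> x) u) - ?C (\<xi> x) (?C (U x) u))" for u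
  proof -
    have s: "?D2 u (U x) = ?D2 (U x) u" by (rule symmetric_second_derivative[OF open_S smooth_\<xi> x])
    show ?thesis
      unfolding s cov_def curvature_eq[OF x] linear_add[OF lD\<xi>] christoffel_add[OF x]
        christoffel_sym[OF x, of u "U x"] christoffel_sym[OF x, of u "\<xi> x"] christoffel_sym[OF x, of "\<xi> x" "?C (U x) u"]
      by (simp add: algebra_simps)
  qed
  then have "ltrace (\<lambda>u. (?D2 u (U x) + ?D\<xi> (?DU u)) + (d\<Gamma> x u (U x) (\<xi> x) + ?C (?DU u) (\<xi> x) + ?C (U x) (?D\<xi> u)) + ?C u (?A (U x)))
     = ltrace (\<lambda>u. ?A (?B u) + curvature G x u (U x) (\<xi> x)
       + (?D2 (U x) u + (d\<Gamma> x (U x) u (\<xi> x) + ?C u (?D\<xi> (U x))))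
       + (?C (U x) (?D\<xi> u) - ?D\<xi> (?C (U x) u)) + (?C (U x) (?C (\<xi> x) u) - ?C (\<xi> x) (?C (U x) u)))"
    by (intro arg_cong[of _ _ ltrace] ext)
  also have "\<dots> = ltrace (\<lambda>u. ?A (?B u)) + ltrace (\<lambda>u. curvature G x u (U x) (\<xi> x))
       + ltrace (\<lambda>u. (?D2 (U x) u + (d\<Gamma> x (U x) u (\<xi> x) + ?C u (?D\<xi> (U x)))))
       + (ltrace (\<lambda>u. ?C (U x) (?D\<xi> u)) - ltrace (\<lambda>u. ?D\<xi> (?C (U x) u)))
       + (ltrace (\<lambda>u. ?C (U x) (?C (\<xi> x) u)) - ltrace (\<lambda>u. ?C (\<xi> x) (?C (U x) u)))"
    by (simp only: ltrace_add ltrace_diff)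
  also have "\<dots> = ltrace (\<lambda>u. ?A (?B u)) + ricci_tensor G x (U x) (\<xi> x)"
    unfolding ddiv c1 c2 ricci_ltrace by simp
  finally have "ltrace (\<lambda>u. (?D2 u (U x) + ?D\<xi> (?DU u)) + (d\<Gamma> x u (U x) (\<xi> x) + ?C (?DU u) (\<xi> x) + ?C (U x) (?D\<xi> u)) + ?C u (?A (U x)))
     = ltrace (\<lambda>u. ?A (?B u)) + ricci_tensor G x (U x) (\<xi> x)" .
  then show "cov_pairing G \<xi> U x
     = divergence G (\<lambda>y. cov G \<xi> y (U y) + 2 *\<^sub>R (\<phi> y *v U y)) x - ricci_tensor G x (U x) (\<xi> x)"
    unfolding P T\<phi> divergence_def cov_def[of G "\<lambda>y. cov G \<xi> y (U y) + _ y"] has_derivative_imp_frechet[OF DX]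
    by (simp add: christoffel_add[OF x] christoffel_scale[OF x] ltrace_add ltrace_scaleR algebra_simps)
qed

end

section \<open>Change of charts\<close>

lemma (in chart_metric) adjoint_exists:
  assumes x: "x \<in> S" and A: "linear A"
  shows "\<exists>A'. linear A' \<and> (\<forall>u v. metric_at (G x) (A u) v = metric_at (G x) u (A' v))"
proof (intro exI conjI allI)
  let ?A' = "(*v) (matrix_inv (G x) ** transpose (matrix A) ** G x)"
  show "linear ?A'" by (rule matrix_vector_mul_linear)
  fix u v
  have "metric_at (G x) u (?A' v) = u \<bullet> (transpose (matrix A) *v (G x *v v))"
    by (simp add: metric_at_def matrix_vector_mul_assoc matrix_mul_assoc matrix_inv_cancel[OF inv_G[OF x]])
  also have "\<dots> = (matrix A *v u) \<bullet> (G x *v v)"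
    using metric_at_transpose[of "transpose (matrix A)" u "G x *v v"] by (simp add: metric_at_def inner_commute)
  also have "\<dots> = metric_at (G x) (A u) v"
    by (simp add: metric_at_def fun_cong[OF matrix_vector_mul(2)[OF A]])
  finally show "metric_at (G x) (A u) v = metric_at (G x) u (?A' v)" ..
qed

text \<open>The differential of the section V sends u to a vector with horizontal part u and
  vertical part \<nabla>_u V. Tracing the metric over the first gives the dimension, over the second
  the pairing.\<close>

lemma (in chart_metric) sasaki_energy_density:
  assumes x: "x \<in> S" and V: "V differentiable (at x)"
  shows "map_energy_density G (sasaki_metric G) (\<lambda>y. (y, V y)) x
    = (1/2) * (real CARD('d) + cov_pairing G V V x)"
proof -
  have "((\<lambda>y. (y, V y)) has_derivative (\<lambda>u. (u, \<D> V x u))) (at x)"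
    by (rule has_derivative_Pair[OF has_derivative_ident frechet_derivative_worksI[OF V]])
  note D = has_derivative_imp_frechet[OF this]
  have "(\<Sum>i\<in>UNIV. \<Sum>j\<in>UNIV. matrix_inv (G x) $ i $ j * metric_at (G x) (axis i 1) (axis j 1)) = real CARD('d)"
    using ltrace_id_contraction[OF x, of "\<lambda>u. u"] by (simp add: ltrace_sum)
  then show ?thesis
    by (simp add: map_energy_density_def sasaki_metric_def D cov_pairing_def cov_def distrib_left sum.distrib)
qed

text \<open>T is a local isometry into S' that need not be onto, so S can be an overlap while S' is
  the whole image of the second chart.\<close>

locale chart_change = M: chart_metric S G + M': chart_metric S' G'
  for S :: "(real^'d::finite) set" and G and S' :: "(real^'d) set" and G' +
  fixes T :: "real^'d \<Rightarrow> real^'d"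
  assumes smooth_T: "smooth_on S T" and T_S: "\<And>x. x \<in> S \<Longrightarrow> T x \<in> S'"
    and G_T: "\<And>x. x \<in> S \<Longrightarrow> G x = transpose (jacobian T (at x)) ** G' (T x) ** jacobian T (at x)"
begin

abbreviation "J x u \<equiv> \<D> T x u"

lemma diff_T: "x \<in> S \<Longrightarrow> T differentiable (at x)"
  by (rule smooth_on_differentiable[OF smooth_T])

lemma linear_J: "x \<in> S \<Longrightarrow> linear (\<D> T x)"
  by (rule linear_frechet_derivative[OF diff_T])

lemma jacobian_mult: "x \<in> S \<Longrightarrow> jacobian T (at x) *v u = J x u"
  unfolding jacobian_def by (rule fun_cong[OF matrix_vector_mul(2)[OF linear_J]])

lemma metric_J:
  assumes x: "x \<in> S" shows "metric_at (G x) u v = metric_at (G' (T x)) (J x u) (J x v)"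
proof -
  let ?J = "jacobian T (at x)"
  have "metric_at (G x) u v = u \<bullet> (transpose ?J *v (G' (T x) *v (?J *v v)))"
    by (simp add: metric_at_def G_T[OF x] matrix_vector_mul_assoc matrix_mul_assoc)
  also have "\<dots> = (?J *v u) \<bullet> (G' (T x) *v (?J *v v))"
    using metric_at_transpose[of "transpose ?J" u "G' (T x) *v (?J *v v)"] by (simp add: metric_at_def inner_commute)
  finally show ?thesis by (simp add: metric_at_def jacobian_mult[OF x])
qed

lemma det_jacobian: assumes x: "x \<in> S" shows "det (jacobian T (at x)) \<noteq> 0"
  using M.det_G[OF x] by (auto simp: G_T[OF x] det_mul)

lemma J_inverse:
  assumes x: "x \<in> S"
  obtains K where "linear K" "\<And>u. K (J x u) = u" "\<And>u. J x (K u) = u"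
proof
  let ?J = "jacobian T (at x)"
  have i: "invertible ?J" using det_jacobian[OF x] by (simp add: invertible_det_nz)
  show "linear ((*v) (matrix_inv ?J))" by (rule matrix_vector_mul_linear)
  show "matrix_inv ?J *v J x u = u" "J x (matrix_inv ?J *v u) = u" for u
    by (simp_all add: jacobian_mult[OF x, symmetric] matrix_vector_mul_assoc matrix_inv_cancel[OF i])
qed

lemma volume_density_J:
  assumes x: "x \<in> S"
  shows "volume_density G x = \<bar>det (jacobian T (at x))\<bar> * volume_density G' (T x)"
proof -
  have "\<bar>det (G x)\<bar> = \<bar>det (jacobian T (at x))\<bar> * \<bar>det (jacobian T (at x))\<bar> * \<bar>det (G' (T x))\<bar>"
    by (simp add: G_T[OF x] det_mul abs_mult)
  then show ?thesis by (simp add: volume_density_def real_sqrt_mult)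
qed

lemma dG_J:
  assumes x: "x \<in> S"
  shows "metric_at (\<D> G x u) a b
    = metric_at (\<D> G' (T x) (J x u)) (J x a) (J x b)
      + metric_at (G' (T x)) (\<D> (\<lambda>y. J y a) x u) (J x b)
      + metric_at (G' (T x)) (J x a) (\<D> (\<lambda>y. J y b) x u)"
proof -
  \<comment> \<open>The composed matrix field is not the pulled-back metric, which would need the
    Jacobians as well; the interpretation only lends its product rule.\<close>
  interpret P: chart_metric S "\<lambda>y. G' (T y)"
    by unfold_locales (auto intro!: smooth_on_compose[OF M'.smooth_G smooth_T] M.open_S M'.open_S T_S M'.sym_G M'.inv_G)
  have d: "(\<lambda>y. J y a) differentiable (at x)" for a
    by (rule smooth_on_differentiable[OF smooth_on_frechet_derivative[OF smooth_T] x])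
  have "metric_at (\<D> G x u) a b = \<D> (\<lambda>y. metric_at (G y) a b) x u"
    using M.metric_fields_derivative(1)[OF x, of "\<lambda>_. a" "\<lambda>_. b"] by (simp add: metric_at_simps)
  also have "\<dots> = \<D> (\<lambda>y. metric_at (G' (T y)) (J y a) (J y b)) x u"
    by (rule fun_cong[OF frechet_derivative_cong_open[OF M.open_S x]]) (rule metric_J)
  also have "\<dots> = metric_at (\<D> (\<lambda>y. G' (T y)) x u) (J x a) (J x b)
      + metric_at (G' (T x)) (\<D> (\<lambda>y. J y a) x u) (J x b)
      + metric_at (G' (T x)) (J x a) (\<D> (\<lambda>y. J y b) x u)"
    by (rule P.metric_fields_derivative(1)[OF x d d])
  finally show ?thesis
    by (simp add: frechet_derivative_compose_at[OF M'.diff_G[OF T_S[OF x]] diff_T[OF x]])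
qed

text \<open>The inhomogeneous transformation law. In the Koszul combination six terms contain second
  derivatives of T; by their symmetry four cancel and the other two agree.\<close>

lemma christoffel_J:
  assumes x: "x \<in> S"
  shows "J x (christoffel G x u v) = christoffel G' (T x) (J x u) (J x v) + \<D> (\<lambda>y. J y v) x u"
proof (rule M'.metric_eqI[OF T_S[OF x]])
  fix w'
  obtain K where K: "\<And>u. J x (K u) = u" using J_inverse[OF x] by metis
  define w where "w = K w'"
  have w': "w' = J x w" by (simp add: w_def K)
  let ?g = "metric_at (G' (T x))"
  let ?T2 = "\<lambda>u v. \<D> (\<lambda>y. J y v) x u"
  have s: "?T2 u v = ?T2 v u" for u v
    by (rule symmetric_second_derivative[OF M.open_S smooth_T x])
  note sy = M'.metric_sym[OF T_S[OF x]]
  have "?g w' (J x (christoffel G x u v)) = metric_at (G x) w (christoffel G x u v)"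
    by (simp add: metric_J[OF x] w')
  also have "\<dots> = ?g w' (christoffel G' (T x) (J x u) (J x v)) + ?g w' (?T2 u v)"
    unfolding M.koszul[OF x] M'.koszul[OF T_S[OF x]] dG_J[OF x] w'
    by (simp add: s[of v u] s[of w u] s[of w v] sy[of "J x _" "?T2 _ _"] field_simps)
  finally show "?g w' (J x (christoffel G x u v)) = ?g w' (christoffel G' (T x) (J x u) (J x v) + ?T2 u v)"
    by (simp add: metric_at_simps)
qed

text \<open>Tensoriality of the covariant derivative: the second derivative of T from the product
  rule cancels the inhomogeneous term of the Christoffel symbols. Only a neighbourhood N is used, as
  the fields are related just near x.\<close>

lemma cov_J:
  assumes x: "x \<in> S" and V: "V differentiable (at x)" and V': "V' differentiable (at (T x))"
    and eq: "\<And>y. y \<in> N \<Longrightarrow> V' (T y) = J y (V y)" and N: "open N" "x \<in> N" "N \<subseteq> S"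
  shows "cov G' V' (T x) (J x u) = J x (cov G V x u)"
proof -
  have "((\<lambda>y. J y (V y)) has_derivative (\<lambda>u. \<D> (\<lambda>y. J y (V x)) x u + J x (\<D> V x u))) (at x)"
    by (rule linear_in_basis_derivative[OF N(1,2) linear_J smooth_on_differentiable[OF smooth_on_frechet_derivative[OF smooth_T] x] V])
      (use N in auto)
  note D = has_derivative_imp_frechet[OF this]
  have "\<D> V' (T x) (J x u) = \<D> (\<lambda>y. V' (T y)) x u"
    by (rule frechet_derivative_compose_at[OF V' diff_T[OF x], symmetric])
  also have "\<dots> = \<D> (\<lambda>y. J y (V y)) x u"
    by (rule fun_cong[OF frechet_derivative_cong_open[OF N(1,2)]]) (rule eq)
  finally have "\<D> V' (T x) (J x u) = \<D> (\<lambda>y. J y (V x)) x u + J x (\<D> V x u)"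
    by (simp add: D)
  moreover have "V' (T x) = J x (V x)" by (rule eq[OF N(2)])
  ultimately show ?thesis
    by (simp add: cov_def linear_add[OF linear_J[OF x]] christoffel_J[OF x])
qed

text \<open>In the form of a trace the pairing is visibly invariant: the covariant derivatives and
  the adjoint are conjugated by the Jacobian, whose inverse is K.\<close>

lemma cov_pairing_J:
  assumes x: "x \<in> S" and N: "open N" "x \<in> N" "N \<subseteq> S"
    and V: "V differentiable (at x)" "V' differentiable (at (T x))" "\<And>y. y \<in> N \<Longrightarrow> V' (T y) = J y (V y)"
    and U: "U differentiable (at x)" "U' differentiable (at (T x))" "\<And>y. y \<in> N \<Longrightarrow> U' (T y) = J y (U y)"
  shows "cov_pairing G' V' U' (T x) = cov_pairing G V U x"
proof -
  obtain K where K: "linear K" "\<And>u. K (J x u) = u" "\<And>u. J x (K u) = u" using J_inverse[OF x] by metis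
  obtain A' where A': "linear A'" and adj: "\<And>u v. metric_at (G x) (cov G V x u) v = metric_at (G x) u (A' v)"
    using M.adjoint_exists[OF x M.linear_cov[OF x V(1)]] by metis
  have cV: "cov G' V' (T x) (J x u) = J x (cov G V x u)" for u
    by (rule cov_J[OF x V N])
  have cU: "cov G' U' (T x) (J x u) = J x (cov G U x u)" for u
    by (rule cov_J[OF x U N])
  have lA: "linear (\<lambda>v. A' (K v))" using linear_compose[OF K(1) A'] by (simp add: comp_def)
  have lA'': "linear (\<lambda>v. J x (A' (K v)))" using linear_compose[OF lA linear_J[OF x]] by (simp add: comp_def)
  have lB: "linear (\<lambda>v. A' (K (cov G' U' (T x) v)))"
    using linear_compose[OF M'.linear_cov[OF T_S[OF x] U(2)] lA] by (simp add: comp_def)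
  have adj': "metric_at (G' (T x)) (cov G' V' (T x) u) v = metric_at (G' (T x)) u (J x (A' (K v)))" for u v
  proof -
    have "metric_at (G' (T x)) (cov G' V' (T x) (J x (K u))) (J x (K v)) = metric_at (G x) (K u) (A' (K v))"
      unfolding cV metric_J[OF x, symmetric] adj ..
    also have "\<dots> = metric_at (G' (T x)) (J x (K u)) (J x (A' (K v)))"
      by (rule metric_J[OF x])
    finally show ?thesis by (simp only: K)
  qed
  have "cov_pairing G' V' U' (T x) = ltrace (\<lambda>u. J x (A' (K (cov G' U' (T x) u))))"
    unfolding cov_pairing_def by (rule M'.contraction_ltrace[OF T_S[OF x] lA'' adj'])
  also have "\<dots> = ltrace (\<lambda>u. A' (K (cov G' U' (T x) (J x u))))"
    by (rule ltrace_commute[OF linear_J[OF x] lB])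
  also have "\<dots> = ltrace (\<lambda>u. A' (cov G U x u))" by (simp only: cU K)
  also have "\<dots> = cov_pairing G V U x"
    unfolding cov_pairing_def by (rule M.contraction_ltrace[OF x A' adj, symmetric])
  finally show ?thesis .
qed

end

text \<open>A bridge from the nonnegative Lebesgue integral, in which the volume measure is defined,
  to the gauge integral, in which the change of variables is stated. Fixing the value r lets
  integrability and value travel together.\<close>

lemma nn_integral_finite_iff_absolutely_integrable:
  fixes f :: "'a::euclidean_space \<Rightarrow> real"
  assumes S: "S \<in> sets borel" and f: "f \<in> borel_measurable (restrict_space borel S)" and nn: "\<And>x. x \<in> S \<Longrightarrow> 0 \<le> f x"
    and r: "0 \<le> r"
  shows "(\<integral>\<^sup>+x\<in>S. ennreal (f x) \<partial>lborel) = ennreal r \<longleftrightarrow> f absolutely_integrable_on S \<and> integral S f = r"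
proof -
  let ?F = "\<lambda>x. indicator S x * f x"
  have F: "?F \<in> borel_measurable borel"
    using f S by (subst (asm) borel_measurable_restrict_space_iff) auto
  have eq: "(\<integral>\<^sup>+x\<in>S. ennreal (f x) \<partial>lborel) = (\<integral>\<^sup>+x. ennreal (?F x) \<partial>lborel)"
    by (rule nn_integral_cong) (auto simp: indicator_def)
  have "(\<integral>\<^sup>+x. ennreal (?F x) \<partial>lborel) = ennreal r \<longleftrightarrow> (f has_integral r) S"
  proof
    assume "(\<integral>\<^sup>+x. ennreal (?F x) \<partial>lborel) = ennreal r"
    then have "(?F has_integral r) UNIV"
      by (intro nn_integral_has_integral F) (auto simp: indicator_def nn r)
    moreover have "?F = (\<lambda>x. if x \<in> S then f x else 0)" by (auto simp: indicator_def)
    ultimately show "(f has_integral r) S" using has_integral_restrict_UNIV[of S f r] by simp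
  next
    assume "(f has_integral r) S"
    moreover have "?F = (\<lambda>x. if x \<in> S then f x else 0)" by (auto simp: indicator_def)
    ultimately have "(?F has_integral r) UNIV" using has_integral_restrict_UNIV[of S f r] by simp
    then show "(\<integral>\<^sup>+x. ennreal (?F x) \<partial>lborel) = ennreal r"
      by (intro nn_integral_has_integral_lborel F) (auto simp: indicator_def nn)
  qed
  moreover have "f absolutely_integrable_on S \<longleftrightarrow> f integrable_on S"
    using nonnegative_absolutely_integrable_1[of f S] nn set_lebesgue_integral_eq_integral(1) by blast
  ultimately show ?thesis unfolding eq by (metis has_integral_integrable_integral)
qed

text \<open>Infinity is the one extended value that equals no finite r, so comparison with finite
  values decides equality.\<close>

lemma ennreal_eqI_finite:
  fixes a b :: ennreal
  assumes "\<And>r. 0 \<le> r \<Longrightarrow> a = ennreal r \<longleftrightarrow> b = ennreal r"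
  shows "a = b"
proof (cases a rule: ennreal_cases)
  case (real r)
  then show ?thesis using assms[of r] by simp
next
  case top
  then show ?thesis using assms by (cases b rule: ennreal_cases) auto
qed

lemma nn_integral_change_of_variables:
  fixes g :: "real^'m::{finite,wellorder} \<Rightarrow> real^'m::_" and f :: "real^'m::_ \<Rightarrow> real"
  assumes S: "S \<in> sets borel" and gS: "g ` S \<in> sets borel"
    and der_g: "\<And>x. x \<in> S \<Longrightarrow> (g has_derivative g' x) (at x within S)" and inj: "inj_on g S"
    and nn: "\<And>x. x \<in> S \<Longrightarrow> 0 \<le> f (g x)"
    and f1: "f \<in> borel_measurable (restrict_space borel (g ` S))"
    and f2: "(\<lambda>x. \<bar>det (matrix (g' x))\<bar> * f (g x)) \<in> borel_measurable (restrict_space borel S)"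
  shows "(\<integral>\<^sup>+x\<in>S. ennreal (\<bar>det (matrix (g' x))\<bar> * f (g x)) \<partial>lborel) = (\<integral>\<^sup>+y\<in>g ` S. ennreal (f y) \<partial>lborel)"
    (is "?L = ?R")
proof -
  let ?h = "\<lambda>x. \<bar>det (matrix (g' x))\<bar> * f (g x)"
  have key: "?h absolutely_integrable_on S \<and> integral S ?h = b \<longleftrightarrow> f absolutely_integrable_on g ` S \<and> integral (g ` S) f = b" for b
  proof -
    \<comment> \<open>The theorem on change of variables concerns vector-valued functions, so the
      real integrand is carried through \<open>real^1\<close>.\<close>
    have "(\<lambda>x. \<bar>det (matrix (g' x))\<bar> *\<^sub>R (vec (f (g x)) :: real^1)) absolutely_integrable_on S \<and>
           integral S (\<lambda>x. \<bar>det (matrix (g' x))\<bar> *\<^sub>R (vec (f (g x)) :: real^1)) = vec b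
       \<longleftrightarrow> (\<lambda>x. vec (f x) :: real^1) absolutely_integrable_on (g ` S) \<and> integral (g ` S) (\<lambda>x. vec (f x) :: real^1) = vec b"
      using S by (intro has_absolute_integral_change_of_variables der_g inj) auto
    moreover have "integral A (\<lambda>x. F x) = vec b \<longleftrightarrow> integral A (\<lambda>x. F x $ 1) = b"
      for F :: "real^'m::_ \<Rightarrow> real^1" and A
      unfolding integral_on_1_eq by (metis vec_component)
    ultimately show ?thesis
      unfolding absolutely_integrable_on_1_iff by simp
  qed
  have l: "?L = ennreal r \<longleftrightarrow> ?h absolutely_integrable_on S \<and> integral S ?h = r" if "0 \<le> r" for r
    using that by (intro nn_integral_finite_iff_absolutely_integrable S f2) (auto simp: nn)
  have r: "?R = ennreal r \<longleftrightarrow> f absolutely_integrable_on g ` S \<and> integral (g ` S) f = r" if "0 \<le> r" for r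
    using that by (intro nn_integral_finite_iff_absolutely_integrable gS f1) (auto simp: nn)
  have "?L = ennreal r \<longleftrightarrow> ?R = ennreal r" if "0 \<le> r" for r
    using l[OF that] r[OF that] key by simp
  then show ?thesis by (rule ennreal_eqI_finite)
qed

section \<open>The volume measure of a manifold\<close>

locale smooth_manifold_locale =
  fixes \<A> :: "('m::{t2_space, second_countable_topology}, 'd::{finite,wellorder}) chart set"
  assumes manifold: "smooth_manifold \<A>"
begin

lemma chart:
  assumes "c \<in> \<A>"
  shows "open (fst c)" "open (chart_image c)" "homeomorphism (fst c) (chart_image c) (snd c) (chart_inv c)"
  using manifold assms by (auto simp: smooth_manifold_def)

lemma chart_cover: obtains c where "c \<in> \<A>" "p \<in> fst c"
proof -
  have "p \<in> (\<Union>c\<in>\<A>. fst c)" using manifold by (simp add: smooth_manifold_def)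
  then show ?thesis using that by blast
qed

lemma chart_apply:
  assumes "c \<in> \<A>"
  shows "p \<in> fst c \<Longrightarrow> chart_inv c (snd c p) = p" "p \<in> fst c \<Longrightarrow> snd c p \<in> chart_image c"
    "x \<in> chart_image c \<Longrightarrow> snd c (chart_inv c x) = x" "x \<in> chart_image c \<Longrightarrow> chart_inv c x \<in> fst c"
  using chart(3)[OF assms] by (auto simp: homeomorphism_def chart_image_def)

lemma continuous_chart: "c \<in> \<A> \<Longrightarrow> continuous_on (fst c) (snd c)"
  and continuous_chart_inv: "c \<in> \<A> \<Longrightarrow> continuous_on (chart_image c) (chart_inv c)"
  using chart(3) by (auto simp: homeomorphism_def)

lemma mem_chart_image_iff:
  assumes "c \<in> \<A>" "B \<subseteq> fst c"
  shows "x \<in> snd c ` B \<longleftrightarrow> x \<in> chart_image c \<and> chart_inv c x \<in> B"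
  using chart_apply[OF assms(1)] assms(2) by force

lemma open_chart_image:
  assumes c: "c \<in> \<A>" and B: "open B" "B \<subseteq> fst c"
  shows "open (snd c ` B)"
proof -
  have "snd c ` B = chart_image c \<inter> chart_inv c -` B"
    using mem_chart_image_iff[OF c B(2)] by auto
  then show ?thesis
    using continuous_open_preimage[OF continuous_chart_inv[OF c] chart(2)[OF c] B(1)] by simp
qed

lemma open_chart_inv_image:
  assumes c: "c \<in> \<A>" and N: "open N" "N \<subseteq> chart_image c"
  shows "open (chart_inv c ` N)"
proof -
  have "chart_inv c ` N = fst c \<inter> snd c -` N"
    using chart_apply[OF c] N(2) by force
  then show ?thesis
    using continuous_open_preimage[OF continuous_chart[OF c] chart(1)[OF c] N(1)] by simp
qed

lemma mem_overlap_iff: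
  assumes "c \<in> \<A>"
  shows "x \<in> overlap c c' \<longleftrightarrow> x \<in> chart_image c \<and> chart_inv c x \<in> fst c'"
  using mem_chart_image_iff[OF assms, of "fst c \<inter> fst c'" x] chart_apply[OF assms] by (auto simp: overlap_def)

lemma open_overlap: "c \<in> \<A> \<Longrightarrow> c' \<in> \<A> \<Longrightarrow> open (overlap c c')"
  unfolding overlap_def by (intro open_chart_image open_Int chart(1)) simp_all

lemma overlap_subset: "c \<in> \<A> \<Longrightarrow> overlap c c' \<subseteq> chart_image c"
  by (auto simp: mem_overlap_iff)

lemma transition_eq: "transition c c' x = snd c' (chart_inv c x)"
  by (simp add: transition_def)

lemma chart_inv_transition:
  "c \<in> \<A> \<Longrightarrow> c' \<in> \<A> \<Longrightarrow> x \<in> overlap c c' \<Longrightarrow> chart_inv c' (transition c c' x) = chart_inv c x"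
  using chart_apply(1)[of c'] mem_overlap_iff[of c] by (simp add: transition_eq)

lemma transition_mem:
  "c \<in> \<A> \<Longrightarrow> c' \<in> \<A> \<Longrightarrow> x \<in> overlap c c' \<Longrightarrow> transition c c' x \<in> overlap c' c"
  using chart_apply mem_overlap_iff by (auto simp: transition_eq)

lemma transition_inverse:
  "c \<in> \<A> \<Longrightarrow> c' \<in> \<A> \<Longrightarrow> x \<in> overlap c c' \<Longrightarrow> transition c' c (transition c c' x) = x"
  using chart_inv_transition[of c c' x] mem_overlap_iff[of c x c'] chart_apply(3)[of c x]
  by (simp add: transition_eq[of c' c])

lemma transition_chart: "c \<in> \<A> \<Longrightarrow> p \<in> fst c \<Longrightarrow> transition c c' (snd c p) = snd c' p"
  by (simp add: transition_eq chart_apply)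

lemma chart_mem_overlap: "p \<in> fst c \<Longrightarrow> p \<in> fst c' \<Longrightarrow> snd c p \<in> overlap c c'"
  by (auto simp: overlap_def)

lemma smooth_transition: "c \<in> \<A> \<Longrightarrow> c' \<in> \<A> \<Longrightarrow> smooth_on (overlap c c') (transition c c')"
  using manifold by (auto simp: smooth_manifold_def)

lemma jacobian_transition:
  assumes "c \<in> \<A>" "c' \<in> \<A>" "x \<in> overlap c c'"
  shows "jacobian (transition c c') (at x) *v u = \<D> (transition c c') x u"
  unfolding jacobian_def
  by (rule fun_cong[OF matrix_vector_mul(2)[OF linear_frechet_derivative[OF smooth_on_differentiable[OF smooth_transition[OF assms(1,2)] assms(3)]]]])

lemma vector_field_smooth: "vector_field \<A> X \<Longrightarrow> c \<in> \<A> \<Longrightarrow> smooth_on (chart_image c) (X c)"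
  by (auto simp: vector_field_def smooth_field_def)

lemma vector_field_transform:
  "vector_field \<A> X \<Longrightarrow> c \<in> \<A> \<Longrightarrow> c' \<in> \<A> \<Longrightarrow> x \<in> overlap c c' \<Longrightarrow>
    X c' (transition c c' x) = \<D> (transition c c') x (X c x)"
  by (auto simp: vector_field_def transforms_def jacobian_transition)

lemma vector_fieldI:
  assumes "\<And>c. c \<in> \<A> \<Longrightarrow> smooth_on (chart_image c) (X c)"
    and "\<And>c c' x. c \<in> \<A> \<Longrightarrow> c' \<in> \<A> \<Longrightarrow> x \<in> overlap c c' \<Longrightarrow>
      X c' (transition c c' x) = \<D> (transition c c') x (X c x)"
  shows "vector_field \<A> X"
  using assms by (auto simp: vector_field_def transforms_def jacobian_transition smooth_field_def)

end

locale metric_manifold = smooth_manifold_locale \<A>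
  for \<A> :: "('m::{t2_space, second_countable_topology}, 'd::{finite,wellorder}) chart set" +
  fixes g :: "('m, 'd, ((real, 'd) vec, 'd) vec) field"
  assumes metric: "semi_riemannian_metric \<A> g"
begin

lemma chart_metric: "c \<in> \<A> \<Longrightarrow> chart_metric (chart_image c) (g c)"
  using metric chart(2) by unfold_locales (auto simp: semi_riemannian_metric_def smooth_field_def)

lemma metric_transform:
  "c \<in> \<A> \<Longrightarrow> c' \<in> \<A> \<Longrightarrow> x \<in> overlap c c' \<Longrightarrow>
    g c x = transpose (jacobian (transition c c') (at x)) ** g c' (transition c c' x) ** jacobian (transition c c') (at x)"
  using metric by (auto simp: semi_riemannian_metric_def transforms_def)

lemma chart_change:
  assumes c: "c \<in> \<A>" "c' \<in> \<A>"
  shows "chart_change (overlap c c') (g c) (chart_image c') (g c') (transition c c')"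
proof -
  interpret C: chart_metric "chart_image c" "g c" by (rule chart_metric[OF c(1)])
  interpret C': chart_metric "chart_image c'" "g c'" by (rule chart_metric[OF c(2)])
  note s = subsetD[OF overlap_subset[OF c(1)]]
  have t: "transition c c' x \<in> chart_image c'" if "x \<in> overlap c c'" for x
    using transition_mem[OF c that] subsetD[OF overlap_subset[OF c(2)]] by blast
  show ?thesis
    by unfold_locales
      (auto intro: open_overlap c smooth_on_subset[OF C.smooth_G overlap_subset] C.sym_G C.inv_G s t
        smooth_transition metric_transform)
qed

lemma metric_at_transition:
  assumes "vector_field \<A> V" "vector_field \<A> U" "c \<in> \<A>" "c' \<in> \<A>" "x \<in> overlap c c'"
  shows "metric_at (g c' (transition c c' x)) (V c' (transition c c' x)) (U c' (transition c c' x)) = metric_at (g c x) (V c x) (U c x)"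
proof -
  interpret chart_change "overlap c c'" "g c" "chart_image c'" "g c'" "transition c c'"
    by (rule chart_change[OF assms(3,4)])
  show ?thesis
    using metric_J[OF assms(5)] vector_field_transform[OF assms(1,3,4,5)] vector_field_transform[OF assms(2,3,4,5)] by simp
qed

lemma cov_pairing_chart:
  assumes V: "vector_field \<A> V" and U: "vector_field \<A> U" and c: "c \<in> \<A>" "c' \<in> \<A>" and p: "p \<in> fst c" "p \<in> fst c'"
  shows "cov_pairing (g c') (V c') (U c') (snd c' p) = cov_pairing (g c) (V c) (U c) (snd c p)"
proof -
  interpret chart_change "overlap c c'" "g c" "chart_image c'" "g c'" "transition c c'"
    by (rule chart_change[OF c])
  have x: "snd c p \<in> overlap c c'" by (rule chart_mem_overlap[OF p])
  have T: "transition c c' (snd c p) = snd c' p" by (rule transition_chart[OF c(1) p(1)])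
  have d: "X c differentiable (at (snd c p))" "X c' differentiable (at (snd c' p))" if "vector_field \<A> X" for X
    using smooth_on_differentiable[OF vector_field_smooth[OF that]] c p chart_apply(2) by auto
  show ?thesis
    using cov_pairing_J[OF x open_overlap[OF c] x order_refl d(1)[OF V] _ vector_field_transform[OF V c]
        d(1)[OF U] _ vector_field_transform[OF U c]] d(2)[OF V] d(2)[OF U] by (simp add: T)
qed

text \<open>The definition selects a chart around p by choice; invariance of the pairing under
  transitions permits computation in any chart.\<close>

lemma energy_density_chart:
  assumes V: "vector_field \<A> V" and c: "c \<in> \<A>" "p \<in> fst c"
  shows "energy_density \<A> g V p = (1/2) * (real CARD('d) + cov_pairing (g c) (V c) (V c) (snd c p))"
proof -
  define c' where "c' = (SOME c. c \<in> \<A> \<and> p \<in> fst c)"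
  have c': "c' \<in> \<A>" "p \<in> fst c'" using someI[of "\<lambda>c. c \<in> \<A> \<and> p \<in> fst c" c] c by (auto simp: c'_def)
  interpret chart_metric "chart_image c'" "g c'" by (rule chart_metric[OF c'(1)])
  have x: "snd c' p \<in> chart_image c'" using chart_apply(2) c' by auto
  have "energy_density \<A> g V p = map_energy_density (g c') (sasaki_metric (g c')) (\<lambda>y. (y, V c' y)) (snd c' p)"
    by (simp add: energy_density_def c'_def[symmetric] Let_def)
  also have "\<dots> = (1/2) * (real CARD('d) + cov_pairing (g c') (V c') (V c') (snd c' p))"
    by (rule sasaki_energy_density[OF x smooth_on_differentiable[OF vector_field_smooth[OF V c'(1)] x]])
  finally show ?thesis using cov_pairing_chart[OF V V c(1) c'(1) c(2) c'(2)] by simp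
qed

definition weight :: "('m, 'd) chart \<Rightarrow> (real, 'd) vec \<Rightarrow> real" where
  "weight c x = indicator (chart_image c) x * volume_density (g c) x"

text \<open>Outside the image of the chart the weight vanishes, so the value of the parametrisation there
  is irrelevant.\<close>

definition param :: "('m, 'd) chart \<Rightarrow> (real, 'd) vec \<Rightarrow> 'm" where
  "param c x = (if x \<in> chart_image c then chart_inv c x else undefined)"

text \<open>An image measure on the whole manifold, concentrated on the domain of the chart. In this
  form the integration formulas for densities and distributions apply directly.\<close>

definition chart_measure :: "('m, 'd) chart \<Rightarrow> 'm measure" where
  "chart_measure c = distr (density lborel (\<lambda>x. ennreal (weight c x))) borel (param c)"

lemma continuous_volume_density: "c \<in> \<A> \<Longrightarrow> continuous_on (chart_image c) (volume_density (g c))"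
proof -
  assume c: "c \<in> \<A>"
  interpret chart_metric "chart_image c" "g c" by (rule chart_metric[OF c])
  show ?thesis
    using volume_density_derivative by (intro continuous_at_imp_continuous_on ballI) (auto intro: has_derivative_continuous)
qed

lemma weight_measurable: "c \<in> \<A> \<Longrightarrow> weight c \<in> borel_measurable borel"
  using borel_measurable_continuous_on_indicator[OF borel_open[OF chart(2)] continuous_volume_density]
  by (simp add: weight_def[abs_def])

lemma weight_nonneg: "0 \<le> weight c x"
  by (simp add: weight_def volume_density_def)

lemma param_measurable: "c \<in> \<A> \<Longrightarrow> param c \<in> borel_measurable borel"
proof -
  assume c: "c \<in> \<A>"
  have "chart_inv c \<in> borel_measurable (restrict_space borel (chart_image c))"
    by (rule borel_measurable_continuous_on_restrict[OF continuous_chart_inv[OF c]])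
  then show ?thesis unfolding param_def[abs_def]
    using borel_open[OF chart(2)[OF c]] by (subst measurable_If_restrict_space_iff) (auto simp: Collect_mem_eq)
qed

lemma sets_chart_measure [simp]: "sets (chart_measure c) = sets borel"
  by (simp add: chart_measure_def)

lemma emeasure_chart_measure:
  assumes c: "c \<in> \<A>" and B: "B \<in> sets borel"
  shows "emeasure (chart_measure c) B = (\<integral>\<^sup>+x\<in>snd c ` (B \<inter> fst c). ennreal (volume_density (g c) x) \<partial>lborel)"
proof -
  have m: "param c -` B \<in> sets borel"
    using measurable_sets[OF param_measurable[OF c] B] by simp
  have "emeasure (chart_measure c) B = emeasure (density lborel (\<lambda>x. ennreal (weight c x))) (param c -` B)"
    unfolding chart_measure_def using param_measurable[OF c] B by (subst emeasure_distr) auto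
  also have "\<dots> = (\<integral>\<^sup>+x. ennreal (weight c x) * indicator (param c -` B) x \<partial>lborel)"
    using weight_measurable[OF c] m by (subst emeasure_density) auto
  also have "\<dots> = (\<integral>\<^sup>+x\<in>snd c ` (B \<inter> fst c). ennreal (volume_density (g c) x) \<partial>lborel)"
  proof (rule nn_integral_cong)
    fix x
    show "ennreal (weight c x) * indicator (param c -` B) x = ennreal (volume_density (g c) x) * indicator (snd c ` (B \<inter> fst c)) x"
      using mem_chart_image_iff[OF c, of "B \<inter> fst c" x] chart_apply(4)[OF c, of x]
      by (auto simp: weight_def param_def indicator_def)
  qed
  finally show ?thesis .
qed

lemma chart_set_measurable:
  assumes c: "c \<in> \<A>" and B: "B \<in> sets borel" "B \<subseteq> fst c"
  shows "snd c ` B \<in> sets borel"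
proof -
  have "snd c ` B = chart_image c \<inter> param c -` B"
  proof (rule set_eqI)
    show "x \<in> snd c ` B \<longleftrightarrow> x \<in> chart_image c \<inter> param c -` B" for x
      unfolding mem_chart_image_iff[OF c B(2)] by (auto simp: param_def)
  qed
  then show ?thesis
    using measurable_sets[OF param_measurable[OF c] B(1)] borel_open[OF chart(2)[OF c]] by simp
qed

text \<open>Under a transition the density acquires the absolute Jacobian determinant, which is
  precisely the factor of the change of variables.\<close>

lemma chart_measure_compat:
  assumes c: "c \<in> \<A>" "c' \<in> \<A>" and B: "B \<in> sets borel" "B \<subseteq> fst c" "B \<subseteq> fst c'"
  shows "emeasure (chart_measure c) B = emeasure (chart_measure c') B"
proof -
  interpret chart_change "overlap c c'" "g c" "chart_image c'" "g c'" "transition c c'"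
    by (rule chart_change[OF c])
  let ?T = "transition c c'"
  have S: "snd c ` B \<in> sets borel" "snd c' ` B \<in> sets borel"
    using chart_set_measurable c B by auto
  have sub: "snd c ` B \<subseteq> overlap c c'" "snd c ` B \<subseteq> chart_image c" "snd c' ` B \<subseteq> chart_image c'"
    using B(2,3) chart_apply(2)[OF c(1)] chart_apply(2)[OF c(2)] by (auto simp: overlap_def)
  have img: "?T ` (snd c ` B) = snd c' ` B"
    unfolding image_image by (rule image_cong) (use B(2) transition_chart[OF c(1)] in blast)+
  have inj: "inj_on ?T (snd c ` B)"
    using transition_inverse[OF c] sub(1) by (intro inj_on_inverseI[of _ "transition c' c"]) auto
  have \<rho>: "volume_density (g c) x = \<bar>det (matrix (\<D> ?T x))\<bar> * volume_density (g c') (?T x)" if "x \<in> snd c ` B" for x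
    using volume_density_J[of x] that sub(1) by (auto simp: jacobian_def)
  have "(\<integral>\<^sup>+x\<in>snd c ` B. ennreal (volume_density (g c) x) \<partial>lborel)
      = (\<integral>\<^sup>+x\<in>snd c ` B. ennreal (\<bar>det (matrix (\<D> ?T x))\<bar> * volume_density (g c') (?T x)) \<partial>lborel)"
    by (rule nn_integral_cong) (auto simp: \<rho> indicator_def)
  also have "\<dots> = (\<integral>\<^sup>+y\<in>?T ` (snd c ` B). ennreal (volume_density (g c') y) \<partial>lborel)"
  proof (rule nn_integral_change_of_variables[OF S(1) _ _ inj])
    show "?T ` (snd c ` B) \<in> sets borel" using S(2) img by simp
    show "(?T has_derivative \<D> ?T x) (at x within snd c ` B)" if "x \<in> snd c ` B" for x
      using frechet_derivative_worksI[OF diff_T] that sub(1) by (blast intro: has_derivative_at_withinI)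
    show "0 \<le> volume_density (g c') (?T x)" for x by (simp add: volume_density_def)
    show "volume_density (g c') \<in> borel_measurable (restrict_space borel (?T ` (snd c ` B)))"
      unfolding img by (rule borel_measurable_continuous_on_restrict[OF continuous_on_subset[OF continuous_volume_density[OF c(2)] sub(3)]])
    have "volume_density (g c) \<in> borel_measurable (restrict_space borel (snd c ` B))"
      by (rule borel_measurable_continuous_on_restrict[OF continuous_on_subset[OF continuous_volume_density[OF c(1)] sub(2)]])
    then show "(\<lambda>x. \<bar>det (matrix (\<D> ?T x))\<bar> * volume_density (g c') (?T x)) \<in> borel_measurable (restrict_space borel (snd c ` B))"
      by (rule measurable_cong[THEN iffD1, rotated]) (use \<rho> in \<open>auto simp: space_restrict_space\<close>)
  qed
  finally show ?thesis
    unfolding img emeasure_chart_measure[OF c(1) B(1)] emeasure_chart_measure[OF c(2) B(1)] Int_absorb2[OF B(2)] Int_absorb2[OF B(3)] .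
qed

text \<open>Second countability yields a countable cover by chart domains, which is then made
  disjoint. The enumeration may repeat a chart; the later pieces are then empty.\<close>

lemma countable_chart_partition:
  obtains c :: "nat \<Rightarrow> ('m, 'd) chart" and A :: "nat \<Rightarrow> 'm set"
  where "\<And>i. c i \<in> \<A>" "\<And>i. A i \<subseteq> fst (c i)" "\<And>i. A i \<in> sets borel" "disjoint_family A" "(\<Union>i. A i) = UNIV"
proof -
  have "\<And>S. S \<in> fst ` \<A> \<Longrightarrow> open S" using chart(1) by auto
  then obtain F where F: "F \<subseteq> fst ` \<A>" "countable F" "\<Union>F = \<Union>(fst ` \<A>)"
    using Lindelof[of "fst ` \<A>"] by metis
  have "countable F \<and> F \<subseteq> fst ` \<A>" using F by simp
  then obtain C where C: "C \<subseteq> \<A>" "countable C" "F = fst ` C"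
    unfolding countable_subset_image by blast
  have U: "(\<Union>c\<in>C. fst c) = UNIV" using F(3) C(3) manifold by (simp add: smooth_manifold_def)
  then have "C \<noteq> {}" by auto
  define c where "c = from_nat_into C"
  have rc: "range c = C" unfolding c_def by (rule range_from_nat_into[OF \<open>C \<noteq> {}\<close> C(2)])
  let ?A = "disjointed (\<lambda>i. fst (c i))"
  show ?thesis
  proof (rule that[of c ?A])
    show "c i \<in> \<A>" for i using rc C(1) by auto
    then show "?A i \<in> sets borel" for i
      using chart(1) by (auto simp: disjointed_def)
    show "?A i \<subseteq> fst (c i)" for i by (rule disjointed_subset)
    show "disjoint_family ?A" by (rule disjoint_family_disjointed)
    show "(\<Union>i. ?A i) = UNIV" unfolding UN_disjointed_eq using U rc by auto
  qed
qed

text \<open>Gives meaning to the description in the definition of the volume measure. Along a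
  countable partition subordinate to charts the measure is forced to be the sum of the chart
  measures of the pieces; compatibility on overlaps shows that this sum has the prescribed
  values.\<close>

lemma volume_measure_unique:
  "\<exists>!\<mu>. sets \<mu> = sets borel \<and>
     (\<forall>c\<in>\<A>. \<forall>B\<in>sets borel. B \<subseteq> fst c \<longrightarrow>
        emeasure \<mu> B = (\<integral>\<^sup>+x\<in>snd c ` B. ennreal (sqrt \<bar>det (g c x)\<bar>) \<partial>lborel))"
proof -
  obtain c :: "nat \<Rightarrow> ('m, 'd) chart" and A :: "nat \<Rightarrow> 'm set" where c: "\<And>i. c i \<in> \<A>" and A: "\<And>i. A i \<subseteq> fst (c i)"
    "\<And>i. A i \<in> sets borel" "disjoint_family A" "(\<Union>i. A i) = UNIV"
    by (rule countable_chart_partition) blast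
  have eq: "(\<integral>\<^sup>+x\<in>snd c ` B. ennreal (sqrt \<bar>det (g c x)\<bar>) \<partial>lborel) = emeasure (chart_measure c) B"
    if "c \<in> \<A>" "B \<in> sets borel" "B \<subseteq> fst c" for c B
    using emeasure_chart_measure[OF that(1,2)] that(3) by (simp add: Int_absorb2 volume_density_def)
  have dj: "disjoint_family (\<lambda>i. B \<inter> A i)" for B
    using A(3) unfolding disjoint_family_on_def by blast
  define f where "f B = (\<Sum>i. emeasure (chart_measure (c i)) (B \<inter> A i))" for B
  define \<mu> where "\<mu> = measure_of UNIV (sets borel) f"
  have sets\<mu>: "sets \<mu> = sets borel"
    using sets.sigma_sets_eq[of borel] by (simp add: \<mu>_def sets_measure_of)
  have "countably_additive (sets borel) f"
  proof (rule countably_additiveI)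
    fix F :: "nat \<Rightarrow> 'm set"
    assume F: "range F \<subseteq> sets borel" "disjoint_family F"
    \<comment> \<open>The inner series is read as an integral over counting measure, so that the two
      summations can be exchanged.\<close>
    have "(\<Sum>n. f (F n)) = (\<Sum>n. \<integral>\<^sup>+i. emeasure (chart_measure (c i)) (F n \<inter> A i) \<partial>count_space UNIV)"
      by (simp add: f_def nn_integral_count_space_nat)
    also have "\<dots> = (\<integral>\<^sup>+i. (\<Sum>n. emeasure (chart_measure (c i)) (F n \<inter> A i)) \<partial>count_space UNIV)"
      by (rule nn_integral_suminf[symmetric]) simp
    also have "\<dots> = (\<integral>\<^sup>+i. emeasure (chart_measure (c i)) ((\<Union>n. F n) \<inter> A i) \<partial>count_space UNIV)"
    proof (rule nn_integral_cong)
      fix i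
      have "(\<Sum>n. emeasure (chart_measure (c i)) (F n \<inter> A i)) = emeasure (chart_measure (c i)) (\<Union>n. F n \<inter> A i)"
        using F A(2)[of i] by (intro suminf_emeasure) (auto simp: disjoint_family_on_def)
      then show "(\<Sum>n. emeasure (chart_measure (c i)) (F n \<inter> A i)) = emeasure (chart_measure (c i)) ((\<Union>n. F n) \<inter> A i)"
        by (simp add: Int_UN_distrib2)
    qed
    also have "\<dots> = f (\<Union>n. F n)" by (simp add: f_def nn_integral_count_space_nat)
    finally show "(\<Sum>n. f (F n)) = f (\<Union>n. F n)" .
  qed
  moreover have "positive (sets borel) f" by (simp add: positive_def f_def)
  ultimately have e\<mu>: "emeasure \<mu> B = f B" if "B \<in> sets borel" for B
    using emeasure_measure_of[OF \<mu>_def, of B] that sets\<mu> by auto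
  have val: "f B = emeasure (chart_measure c0) B" if c0: "c0 \<in> \<A>" and B: "B \<in> sets borel" "B \<subseteq> fst c0" for c0 B
  proof -
    have "f B = (\<Sum>i. emeasure (chart_measure c0) (B \<inter> A i))"
      unfolding f_def
    proof (rule suminf_cong)
      fix i
      have "B \<inter> A i \<in> sets borel" "B \<inter> A i \<subseteq> fst (c i)" "B \<inter> A i \<subseteq> fst c0" using A(1)[of i] A(2)[of i] B by auto
      then show "emeasure (chart_measure (c i)) (B \<inter> A i) = emeasure (chart_measure c0) (B \<inter> A i)"
        by (rule chart_measure_compat[OF c c0])
    qed
    also have "\<dots> = emeasure (chart_measure c0) (\<Union>i. B \<inter> A i)"
      using B A(2) by (intro suminf_emeasure dj) auto
    also have "(\<Union>i. B \<inter> A i) = B" using A(4) by auto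
    finally show ?thesis .
  qed
  show ?thesis
  proof (rule ex1I[of _ \<mu>])
    show "sets \<mu> = sets borel \<and> (\<forall>c\<in>\<A>. \<forall>B\<in>sets borel. B \<subseteq> fst c \<longrightarrow>
        emeasure \<mu> B = (\<integral>\<^sup>+x\<in>snd c ` B. ennreal (sqrt \<bar>det (g c x)\<bar>) \<partial>lborel))"
      using sets\<mu> e\<mu> val eq by simp
  next
    fix \<nu> assume \<nu>: "sets \<nu> = sets borel \<and> (\<forall>c\<in>\<A>. \<forall>B\<in>sets borel. B \<subseteq> fst c \<longrightarrow>
        emeasure \<nu> B = (\<integral>\<^sup>+x\<in>snd c ` B. ennreal (sqrt \<bar>det (g c x)\<bar>) \<partial>lborel))"
    show "\<nu> = \<mu>"
    proof (rule measure_eqI)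
      show "sets \<nu> = sets \<mu>" using \<nu> sets\<mu> by simp
      fix B assume "B \<in> sets \<nu>"
      then have B: "B \<in> sets borel" using \<nu> by simp
      have "emeasure \<nu> B = emeasure \<nu> (\<Union>i. B \<inter> A i)" using A(4) by (simp add: Int_UN_distrib[symmetric])
      also have "\<dots> = (\<Sum>i. emeasure \<nu> (B \<inter> A i))"
        using B A(2) \<nu> by (intro suminf_emeasure[symmetric] dj) auto
      also have "\<dots> = f B"
        unfolding f_def
      proof (rule suminf_cong)
        fix i
        have s: "B \<inter> A i \<in> sets borel" "B \<inter> A i \<subseteq> fst (c i)" using A B by auto
        show "emeasure \<nu> (B \<inter> A i) = emeasure (chart_measure (c i)) (B \<inter> A i)"
          using \<nu> c[of i] s eq[OF c s] by simp
      qed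
      finally show "emeasure \<nu> B = emeasure \<mu> B" by (simp add: e\<mu>[OF B])
    qed
  qed
qed

abbreviation "vol \<equiv> volume_measure \<A> g"

lemma sets_vol [simp, measurable_cong]: "sets vol = sets borel"
  and emeasure_vol: "c \<in> \<A> \<Longrightarrow> B \<in> sets borel \<Longrightarrow> B \<subseteq> fst c \<Longrightarrow> emeasure vol B = emeasure (chart_measure c) B"
proof -
  note * = theI'[OF volume_measure_unique, folded volume_measure_def]
  show "sets vol = sets borel" using * by simp
  show "c \<in> \<A> \<Longrightarrow> B \<in> sets borel \<Longrightarrow> B \<subseteq> fst c \<Longrightarrow> emeasure vol B = emeasure (chart_measure c) B"
    using * emeasure_chart_measure by (simp add: Int_absorb2 volume_density_def)
qed

lemma space_vol [simp]: "space vol = UNIV"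
  using sets_eq_imp_space_eq[OF sets_vol] by simp

text \<open>\<open>vol\<close> is known through its values on sets inside chart domains; this
  equality transfers to it the integration formulas of the explicit measure.\<close>

lemma density_vol:
  assumes c: "c \<in> \<A>" shows "density vol (\<lambda>p. ennreal (indicator (fst c) p)) = chart_measure c"
proof (rule measure_eqI)
  fix B assume "B \<in> sets (density vol (\<lambda>p. ennreal (indicator (fst c) p)))"
  then have B: "B \<in> sets borel" by simp
  have f: "fst c \<in> sets borel" using chart(1)[OF c] by simp
  have "emeasure (density vol (\<lambda>p. ennreal (indicator (fst c) p))) B = (\<integral>\<^sup>+p. ennreal (indicator (fst c) p) * indicator B p \<partial>vol)"
    using B f by (intro emeasure_density) auto
  also have "\<dots> = (\<integral>\<^sup>+p. indicator (B \<inter> fst c) p \<partial>vol)"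
    by (rule nn_integral_cong) (auto simp: indicator_def)
  also have "\<dots> = emeasure vol (B \<inter> fst c)"
    using B f by (intro nn_integral_indicator) auto
  also have "\<dots> = emeasure (chart_measure c) (B \<inter> fst c)"
    using B f by (intro emeasure_vol[OF c]) auto
  also have "\<dots> = emeasure (chart_measure c) B"
    using B f by (simp add: emeasure_chart_measure[OF c] Int_assoc)
  finally show "emeasure (density vol (\<lambda>p. ennreal (indicator (fst c) p))) B = emeasure (chart_measure c) B" .
qed simp

lemma integral_vol_chart:
  fixes f :: "'m \<Rightarrow> real"
  assumes c: "c \<in> \<A>" and f: "f \<in> borel_measurable borel" "\<And>p. p \<notin> fst c \<Longrightarrow> f p = 0"
  shows "integral\<^sup>L vol f = (\<integral>x. weight c x * f (param c x) \<partial>lborel)"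
    and "integrable vol f \<longleftrightarrow> integrable lborel (\<lambda>x. weight c x * f (param c x))"
proof -
  have i: "(\<lambda>p. indicator (fst c) p :: real) \<in> borel_measurable borel" using chart(1)[OF c] by simp
  have e: "(\<lambda>p. indicator (fst c) p *\<^sub>R f p) = f" using f(2) by (intro ext) (auto simp: indicator_def)
  note fc = measurable_compose[OF param_measurable[OF c] f(1)]
  have "integral\<^sup>L (chart_measure c) f = integral\<^sup>L vol f"
    unfolding density_vol[OF c, symmetric] using integral_density[of f vol "\<lambda>p. indicator (fst c) p"] i f(1) e by simp
  moreover have "integral\<^sup>L (chart_measure c) f = integral\<^sup>L (density lborel (\<lambda>x. ennreal (weight c x))) (\<lambda>x. f (param c x))"
    unfolding chart_measure_def using param_measurable[OF c] f(1) by (intro integral_distr) auto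
  moreover have "\<dots> = (\<integral>x. weight c x *\<^sub>R f (param c x) \<partial>lborel)"
    using weight_measurable[OF c] fc weight_nonneg by (intro integral_density) auto
  ultimately show "integral\<^sup>L vol f = (\<integral>x. weight c x * f (param c x) \<partial>lborel)" by simp
  have "integrable (chart_measure c) f \<longleftrightarrow> integrable vol f"
    unfolding density_vol[OF c, symmetric] using integrable_density[of f vol "\<lambda>p. indicator (fst c) p"] i f(1) e by simp
  moreover have "integrable (chart_measure c) f \<longleftrightarrow> integrable (density lborel (\<lambda>x. ennreal (weight c x))) (\<lambda>x. f (param c x))"
    unfolding chart_measure_def using param_measurable[OF c] f(1) by (intro integrable_distr_eq) auto
  moreover have "\<dots> \<longleftrightarrow> integrable lborel (\<lambda>x. weight c x *\<^sub>R f (param c x))"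
    using weight_measurable[OF c] fc weight_nonneg by (intro integrable_density) auto
  ultimately show "integrable vol f \<longleftrightarrow> integrable lborel (\<lambda>x. weight c x * f (param c x))" by simp
qed

lemma coordinate_ball:
  assumes c: "c \<in> \<A>" and p: "p \<in> fst c" and N: "open N" "p \<in> N"
  obtains r where "0 < r" "cball (snd c p) r \<subseteq> chart_image c" "chart_inv c ` cball (snd c p) r \<subseteq> N"
proof -
  have "open (snd c ` (N \<inter> fst c))" using N chart(1)[OF c] by (intro open_chart_image[OF c]) auto
  then obtain r where r: "0 < r" "cball (snd c p) r \<subseteq> snd c ` (N \<inter> fst c)"
    using p N(2) open_contains_cball by (metis IntI imageI)
  show ?thesis
    by (rule that[OF r(1)]) (use r(2) mem_chart_image_iff[OF c, of "N \<inter> fst c"] in auto)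
qed

text \<open>On a closed coordinate ball the density is bounded, so every point has a neighbourhood
  of finite volume, and finitely many of these cover K.\<close>

lemma finite_vol_compact:
  assumes K: "compact K" shows "emeasure vol K < \<infinity>"
proof -
  have "\<exists>N. open N \<and> p \<in> N \<and> emeasure vol N < \<infinity>" for p
  proof -
    obtain c where c: "c \<in> \<A>" "p \<in> fst c" by (rule chart_cover)
    obtain r where r: "0 < r" "cball (snd c p) r \<subseteq> chart_image c" "chart_inv c ` cball (snd c p) r \<subseteq> UNIV"
      by (rule coordinate_ball[OF c open_UNIV]) auto
    have bs: "ball (snd c p) r \<subseteq> chart_image c" using r(2) ball_subset_cball by blast
    define N where "N = chart_inv c ` ball (snd c p) r"
    have N: "open N" "p \<in> N" "N \<subseteq> fst c"
      using open_chart_inv_image[OF c(1) open_ball bs] chart_apply[OF c(1)] c(2) r(1) bs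
      by (auto simp: N_def image_iff intro!: bexI[of _ "snd c p"])
    have "snd c ` N = (\<lambda>x. x) ` ball (snd c p) r"
      unfolding N_def image_image by (rule image_cong) (use bs chart_apply(3)[OF c(1)] in blast)+
    then have sN: "snd c ` N = ball (snd c p) r" by simp
    have "compact (volume_density (g c) ` cball (snd c p) r)"
      by (rule compact_continuous_image[OF continuous_on_subset[OF continuous_volume_density[OF c(1)] r(2)] compact_cball])
    then obtain M where *: "\<forall>y\<in>volume_density (g c) ` cball (snd c p) r. norm y \<le> M"
      using compact_imp_bounded bounded_iff by blast
    have M: "volume_density (g c) x \<le> M" if "x \<in> cball (snd c p) r" for x
      using bspec[OF * imageI[OF that]] by simp
    have "emeasure vol N = (\<integral>\<^sup>+x\<in>ball (snd c p) r. ennreal (volume_density (g c) x) \<partial>lborel)"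
      using emeasure_vol[OF c(1) _ N(3)] emeasure_chart_measure[OF c(1), of N] N by (simp add: Int_absorb2 sN)
    also have "\<dots> \<le> (\<integral>\<^sup>+x. ennreal M * indicator (ball (snd c p) r) x \<partial>lborel)"
      using M by (intro nn_integral_mono) (auto simp: indicator_def ennreal_leI)
    also have "\<dots> = ennreal M * emeasure lborel (ball (snd c p) r)"
      by (rule nn_integral_cmult_indicator) simp
    also have "\<dots> < \<infinity>"
      using emeasure_bounded_finite[OF bounded_ball, of "snd c p" r] by (simp add: ennreal_mult_less_top)
    finally show ?thesis using N by blast
  qed
  then obtain N where N: "\<And>p. open (N p)" "\<And>p. p \<in> N p" "\<And>p. emeasure vol (N p) < \<infinity>" by metis
  obtain P where P: "P \<subseteq> K" "finite P" "K \<subseteq> (\<Union>p\<in>P. N p)"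
    using compactE_image[OF K, of K N] N by (metis UN_I subsetI)
  have "emeasure vol K \<le> emeasure vol (\<Union>p\<in>P. N p)"
    using P N by (intro emeasure_mono) (auto intro!: borel_open)
  also have "\<dots> \<le> (\<Sum>p\<in>P. emeasure vol (N p))"
    using P N by (intro emeasure_subadditive_finite) auto
  also have "\<dots> < \<infinity>"
    using P(2) by (induction P rule: finite_induct) (use N(3) in \<open>simp_all add: ennreal_add_less_top\<close>)
  finally show ?thesis .
qed

end

section \<open>Integration by parts and time-dependent fields\<close>

text \<open>The profile exp (-1/x) of a bump function is the case k = 0. The powers of 1/x are
  included because the family is then closed under differentiation up to linear
  combinations.\<close>

definition flat :: "nat \<Rightarrow> real \<Rightarrow> real" where
  "flat k x = (if 0 < x then exp (- inverse x) * inverse x ^ k else 0)"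

lemma flat_nonneg: "0 \<le> flat k x"
  by (simp add: flat_def)

lemma flat_pos: "0 < x \<Longrightarrow> 0 < flat k x"
  by (simp add: flat_def)

lemma power_le_fact_exp:
  fixes z :: real assumes "0 \<le> z" shows "z ^ n \<le> fact n * exp z"
proof -
  have "(\<Sum>k\<in>{n}. z ^ k /\<^sub>R fact k) \<le> exp z"
    unfolding exp_def by (rule sum_le_suminf[OF summable_exp_generic]) (use assms in auto)
  then show ?thesis by (simp add: field_simps)
qed

text \<open>Obtained from one term of the exponential series at 1/x. The quadratic bound makes the
  difference quotient at the origin of order h, so the derivative there is zero.\<close>

lemma flat_le_square: "flat k x \<le> fact (k + 2) * x\<^sup>2"
proof (cases "0 < x")
  case True
  let ?z = "inverse x"
  have "flat k x = exp (- ?z) * ?z ^ (k + 2) * x\<^sup>2"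
  proof -
    have "?z ^ (k + 2) * x\<^sup>2 = ?z ^ k" using True by (simp add: power_add power2_eq_square field_simps)
    then show ?thesis using True by (simp add: flat_def mult.assoc)
  qed
  also have "\<dots> \<le> exp (- ?z) * (fact (k + 2) * exp ?z) * x\<^sup>2"
    using True by (intro mult_right_mono mult_left_mono power_le_fact_exp) auto
  also have "\<dots> = fact (k + 2) * x\<^sup>2" by (simp add: exp_minus)
  finally show ?thesis .
qed (simp add: flat_def)

lemma flat_derivative: "(flat k has_real_derivative flat (k + 2) x - real k * flat (k + 1) x) (at x)"
proof (rule linorder_cases[of x 0])
  assume x: "x < 0"
  have "((\<lambda>_. 0) has_real_derivative 0) (at x)" by simp
  then have "(flat k has_real_derivative 0) (at x)"
    by (rule has_field_derivative_transform_within_open[of _ _ _ "{..<0}"]) (use x in \<open>auto simp: flat_def\<close>)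
  then show ?thesis using x by (simp add: flat_def)
next
  assume x: "0 < x"
  have "((\<lambda>x. exp (- inverse x) * inverse x ^ k) has_real_derivative flat (k + 2) x - real k * flat (k + 1) x) (at x)"
  proof (cases k)
    case 0
    then show ?thesis using x
      by (auto intro!: derivative_eq_intros simp: flat_def power2_eq_square)
  next
    case (Suc m)
    then show ?thesis using x
      by (auto intro!: derivative_eq_intros simp: flat_def power2_eq_square algebra_simps)
        (metis One_nat_def gr0I mult.commute power_minus_mult)
  qed
  then show ?thesis
    by (rule has_field_derivative_transform_within_open[of _ _ _ "{0<..}"]) (use x in \<open>auto simp: flat_def\<close>)
next
  assume x: "x = 0"
  have "((\<lambda>h. (flat k (0 + h) - flat k 0) / h) \<longlongrightarrow> 0) (at 0)"
  proof (rule Lim_null_comparison)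
    show "\<forall>\<^sub>F h in at 0. norm ((flat k (0 + h) - flat k 0) / h) \<le> fact (k + 2) * \<bar>h\<bar>"
    proof (rule eventually_at_filter[THEN iffD2], rule always_eventually, intro allI impI)
      fix h :: real assume h: "h \<noteq> 0"
      have "\<bar>flat k h\<bar> \<le> fact (k + 2) * \<bar>h\<bar> * \<bar>h\<bar>"
        using flat_le_square[of k h] flat_nonneg[of k h] by (simp add: power2_eq_square mult.assoc)
      then show "norm ((flat k (0 + h) - flat k 0) / h) \<le> fact (k + 2) * \<bar>h\<bar>"
        using h by (simp add: flat_def[of k 0] abs_divide divide_le_eq)
    qed
    show "((\<lambda>h. fact (k + 2) * \<bar>h\<bar>) \<longlongrightarrow> (0::real)) (at 0)"
      by (auto intro!: tendsto_eq_intros)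
  qed
  then show ?thesis using x by (simp add: DERIV_def flat_def)
qed

lemma smooth_flat: "smooth_on UNIV (flat k)"
proof -
  have D: "(flat k has_derivative (\<lambda>v. (flat (k + 2) x - real k * flat (k + 1) x) * v)) (at x)" for k x
    using flat_derivative by (simp add: has_field_derivative_def)
  have "Ck_on n (flat k) UNIV" for n
  proof (induction n arbitrary: k)
    case 0
    then show ?case using has_derivative_continuous[OF D] by (simp add: continuous_at_imp_continuous_on)
  next
    case (Suc n)
    have "Ck_on n (\<lambda>x. (flat (k + 2) x + (- real k) * flat (k + 1) x) * v) UNIV" for v
      by (intro Ck_on_bilinear[OF open_UNIV bounded_bilinear_mult] Ck_on_add Ck_on_const Suc.IH open_UNIV)
    then show ?case
      using D by (auto simp: has_derivative_imp_frechet[OF D] intro: differentiableI)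
  qed
  then show ?thesis by (simp add: smooth_on_def)
qed

section \<open>Integrals of derivatives of compactly supported functions\<close>

lemma integral_translation_lborel:
  fixes F :: "'a::euclidean_space \<Rightarrow> real"
  assumes F: "integrable lborel F"
  shows "integrable lborel (\<lambda>x. F (a + x))" "(\<integral>x. F (a + x) \<partial>lborel) = (\<integral>x. F x \<partial>lborel)"
proof -
  have F': "F \<in> borel_measurable lborel" using F by auto
  have "integrable (distr lborel borel ((+) a)) F" using F by (simp add: lborel_distr_plus)
  then show "integrable lborel (\<lambda>x. F (a + x))"
    using F' by (subst (asm) integrable_distr_eq) auto
  have "(\<integral>x. F x \<partial>distr lborel borel ((+) a)) = (\<integral>x. F (a + x) \<partial>lborel)"
    using F' by (intro integral_distr) auto
  then show "(\<integral>x. F (a + x) \<partial>lborel) = (\<integral>x. F x \<partial>lborel)" by (simp add: lborel_distr_plus)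
qed

text \<open>Translation invariance of the Lebesgue measure makes every difference quotient integrate to
  zero.\<close>

lemma integral_derivative_compact_support:
  fixes F :: "'a::euclidean_space \<Rightarrow> real"
  assumes diff: "\<And>x. F differentiable (at x)"
    and cont: "continuous_on UNIV (\<lambda>x. \<D> F x u)"
    and supp: "\<And>x. R < norm x \<Longrightarrow> F x = 0"
  shows "integrable lborel (\<lambda>x. \<D> F x u)"
    and "(\<integral>x. \<D> F x u \<partial>lborel) = 0"
proof -
  let ?D = "\<lambda>x. \<D> F x u"
  have D0: "?D x = 0" if "R < norm x" for x
  proof -
    have "open {x::'a. R < norm x}" by (intro open_Collect_less continuous_intros)
    then have "?D x = \<D> (\<lambda>_. 0::real) x u"
      using that supp by (intro fun_cong[OF frechet_derivative_cong_open]) auto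
    then show ?thesis by simp
  qed
  have "bounded (?D ` cball 0 R)"
    by (rule compact_imp_bounded[OF compact_continuous_image[OF continuous_on_subset[OF cont] compact_cball]]) simp
  then obtain M0 where M0: "\<forall>y\<in>?D ` cball 0 R. norm y \<le> M0" unfolding bounded_iff by blast
  define M where "M = max M0 0"
  have M: "\<bar>?D x\<bar> \<le> M" for x
  proof (cases "R < norm x")
    case False
    then show ?thesis using bspec[OF M0 imageI[of x]] by (simp add: M_def)
  qed (simp add: D0 M_def)
  have Fcont: "continuous_on UNIV F"
    using diff by (intro continuous_at_imp_continuous_on ballI differentiable_imp_continuous_within)
  have "integrable lborel (\<lambda>x. indicator (cball 0 R) x *\<^sub>R F x)"
    by (rule borel_integrable_compact[OF compact_cball continuous_on_subset[OF Fcont]]) simp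
  moreover have "(\<lambda>x. indicator (cball 0 R) x *\<^sub>R F x) = F"
    using supp by (auto simp: fun_eq_iff indicator_def dist_norm)
  ultimately have Fint: "integrable lborel F" by simp
  define h where "h n = inverse (real (Suc n))" for n
  have h: "0 < h n" "h n \<le> 1" for n by (auto simp: h_def inverse_le_1_iff)
  define q where "q n x = (F (h n *\<^sub>R u + x) - F x) / h n" for n x
  have qint: "integrable lborel (q n)" "(\<integral>x. q n x \<partial>lborel) = 0" for n
  proof -
    have qd: "q n = (\<lambda>x. (F (h n *\<^sub>R u + x) - F x) / h n)" by (simp add: q_def fun_eq_iff)
    show "integrable lborel (q n)" "(\<integral>x. q n x \<partial>lborel) = 0"
      unfolding qd using integral_translation_lborel[OF Fint, of "h n *\<^sub>R u"] Fint by simp_all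
  qed
  \<comment> \<open>A common integrable majorant of all difference quotients: since h n is at most
    1, the shift moves the support by at most the length of u, hence the enlarged ball.\<close>
  let ?w = "\<lambda>x::'a. M * indicator (cball 0 (R + norm u)) x"
  have wint: "integrable lborel ?w"
    using emeasure_bounded_finite[OF bounded_cball] by (intro integrable_mult_right integrable_real_indicator) auto
  have lim: "(\<lambda>n. q n x) \<longlonglongrightarrow> ?D x" for x
  proof -
    have "((\<lambda>s. F (x + s *\<^sub>R u)) has_real_derivative ?D x) (at 0)"
      using directional_derivative[of F x 0 u] diff by simp
    then have "((\<lambda>s. (F (x + s *\<^sub>R u) - F x) / s) \<longlongrightarrow> ?D x) (at 0)"
      by (simp add: DERIV_def)
    moreover have "filterlim h (at 0) sequentially"
    proof -
      have "h n \<noteq> 0" for n using h(1)[of n] by simp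
      moreover have "h \<longlonglongrightarrow> 0" unfolding h_def by (rule LIMSEQ_inverse_real_of_nat)
      ultimately show ?thesis by (simp add: filterlim_at)
    qed
    ultimately have "(\<lambda>n. (F (x + h n *\<^sub>R u) - F x) / h n) \<longlonglongrightarrow> ?D x"
      by (rule filterlim_compose)
    then show ?thesis by (simp add: q_def add.commute)
  qed
  have bound: "norm (q n x) \<le> ?w x" for n x
  proof (cases "norm x \<le> R + norm u")
    case True
    have "\<exists>z>0. z < h n \<and> F (x + h n *\<^sub>R u) - F (x + 0 *\<^sub>R u) = (h n - 0) * ?D (x + z *\<^sub>R u)"
      by (rule MVT2[OF h(1)]) (rule directional_derivative[OF diff])
    then obtain z where "F (x + h n *\<^sub>R u) - F x = h n * ?D (x + z *\<^sub>R u)" by auto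
    then have "q n x = ?D (x + z *\<^sub>R u)" using h(1)[of n] by (simp add: q_def add.commute)
    then show ?thesis using M True by (simp add: dist_norm)
  next
    case False
    have "norm (h n *\<^sub>R u) \<le> norm u" using h[of n] by (simp add: mult_left_le_one_le)
    then have "R < norm (h n *\<^sub>R u + x)"
      using False norm_diff_ineq[of x "h n *\<^sub>R u"] by (simp add: add.commute)
    moreover have "R < norm x" using False norm_ge_zero[of u] by linarith
    ultimately show ?thesis using supp False by (simp add: q_def dist_norm)
  qed
  have Dm: "?D \<in> borel_measurable lborel"
    using borel_measurable_continuous_onI[OF cont] by simp
  have qm: "q n \<in> borel_measurable lborel" for n using qint(1)[of n] by auto
  show "integrable lborel ?D"
    using integrable_dominated_convergence[where s = q, OF Dm qm wint] lim bound by auto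
  have "(\<lambda>n. \<integral>x. q n x \<partial>lborel) \<longlonglongrightarrow> (\<integral>x. ?D x \<partial>lborel)"
    using integral_dominated_convergence[where s = q, OF Dm qm wint] lim bound by auto
  then show "(\<integral>x. ?D x \<partial>lborel) = 0"
    using qint(2) by (simp add: LIMSEQ_const_iff)
qed

text \<open>The components of f, extended by zero, are continuously differentiable everywhere: the
  open sets I and the complement of C cover the space, and the extension vanishes on the latter. The
  trace of the derivative is then a sum of partial derivatives.\<close>

lemma integral_ltrace_derivative:
  fixes f :: "real^'d::finite \<Rightarrow> real^'d"
  assumes I: "open I" and C: "compact C" "C \<subseteq> I"
    and diff: "\<And>x. x \<in> I \<Longrightarrow> f differentiable (at x)"
    and cont: "\<And>u. continuous_on I (\<lambda>x. \<D> f x u)"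
    and supp: "\<And>x. x \<in> I \<Longrightarrow> x \<notin> C \<Longrightarrow> f x = 0"
  shows "integrable lborel (\<lambda>x. indicator I x * ltrace (\<D> f x))"
    and "(\<integral>x. indicator I x * ltrace (\<D> f x) \<partial>lborel) = 0"
proof -
  define F where "F i x = (if x \<in> I then f x $ i else 0)" for i x
  have oC: "open (- C)" using C(1) by (simp add: compact_imp_closed open_Compl)
  have in_I: "F i differentiable (at x)" "\<D> (F i) x u = \<D> f x u $ i"
    if "x \<in> I" for i x u
  proof -
    have e: "F i y = f y $ i" if "y \<in> I" for y using that by (simp add: F_def)
    show "F i differentiable (at x)"
      by (rule differentiable_cong_open[OF I \<open>x \<in> I\<close> e, THEN iffD2])
        (auto intro: differentiable_linear_compose[OF bounded_linear_vec_nth diff[OF \<open>x \<in> I\<close>]])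
    have "\<D> (F i) x u = \<D> (\<lambda>y. f y $ i) x u"
      by (rule fun_cong[OF frechet_derivative_cong_open[OF I \<open>x \<in> I\<close> e]])
    then show "\<D> (F i) x u = \<D> f x u $ i"
      by (simp add: frechet_derivative_linear_compose[OF bounded_linear_vec_nth diff[OF \<open>x \<in> I\<close>]])
  qed
  have off_C: "F i differentiable (at x)" "\<D> (F i) x u = 0" if "x \<in> - C" for i x u
  proof -
    have e: "F i y = 0" if "y \<in> - C" for y using that supp by (simp add: F_def)
    show "F i differentiable (at x)"
      by (rule differentiable_cong_open[OF oC \<open>x \<in> - C\<close> e, THEN iffD2]) auto
    have "\<D> (F i) x u = \<D> (\<lambda>_. 0::real) x u"
      by (rule fun_cong[OF frechet_derivative_cong_open[OF oC \<open>x \<in> - C\<close> e]])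
    then show "\<D> (F i) x u = 0" by simp
  qed
  have U: "I \<union> - C = UNIV" using C(2) by auto
  have d: "F i differentiable (at x)" for i x
    using in_I(1)[of x i] off_C(1)[of x i] U by blast
  have c: "continuous_on UNIV (\<lambda>x. \<D> (F i) x u)" for i u
  proof -
    have "continuous_on I (\<lambda>x. \<D> (F i) x u)"
      by (rule continuous_on_eq[OF continuous_on_component[OF cont[of u], of i]]) (simp add: in_I)
    moreover have "continuous_on (- C) (\<lambda>x. \<D> (F i) x u)"
      by (rule continuous_on_eq[OF continuous_on_const[of _ 0]]) (simp add: off_C)
    ultimately have "continuous_on (I \<union> - C) (\<lambda>x. \<D> (F i) x u)"
      by (rule continuous_on_open_Un[OF I oC])
    then show ?thesis by (simp add: U)
  qed
  obtain R where R: "\<And>x. x \<in> C \<Longrightarrow> norm x \<le> R"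
    using compact_imp_bounded[OF C(1)] unfolding bounded_iff by blast
  have s: "F i x = 0" if "R < norm x" for i x
    using R[of x] supp[of x] that by (cases "x \<in> C") (auto simp: F_def)
  have eq: "(\<lambda>x. indicator I x * ltrace (\<D> f x))
      = (\<lambda>x. \<Sum>i\<in>UNIV. \<D> (F i) x (axis i 1))"
  proof
    fix x
    show "indicator I x * ltrace (\<D> f x) = (\<Sum>i\<in>UNIV. \<D> (F i) x (axis i 1))"
      using U off_C(2)[of x] in_I(2)[of x] C(2) by (cases "x \<in> I") (auto simp: ltrace_sum)
  qed
  note int = integral_derivative_compact_support[OF d c s]
  show "integrable lborel (\<lambda>x. indicator I x * ltrace (\<D> f x))"
    unfolding eq by (intro Bochner_Integration.integrable_sum int(1))
  show "(\<integral>x. indicator I x * ltrace (\<D> f x) \<partial>lborel) = 0"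
    unfolding eq by (subst Bochner_Integration.integral_sum) (auto simp: int)
qed

section \<open>Smoothness and additivity of the pairing in a chart\<close>

context chart_metric
begin

lemma smooth_christoffel_fields:
  assumes "smooth_on S X" "smooth_on S Y"
  shows "smooth_on S (\<lambda>y. christoffel G y (X y) (Y y))"
  by (rule smooth_on_linear_in_basis[OF open_S linear_christoffel _ assms(2)],
      assumption, rule smooth_on_linear_in_basis[OF open_S linear_christoffel_left smooth_christoffel assms(1)])

lemma smooth_ricci:
  assumes v: "smooth_on S v" and w: "smooth_on S w"
  shows "smooth_on S (\<lambda>y. ricci_tensor G y (v y) (w y))"
proof -
  have c: "smooth_on S (\<lambda>y. curvature G y a b e)" for a b e
  proof -
    have "smooth_on S (\<lambda>y. d\<Gamma> y a b e - d\<Gamma> y b a e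
     + christoffel G y a (christoffel G y b e) - christoffel G y b (christoffel G y a e))"
      by (intro smooth_on_diff smooth_on_add open_S smooth_on_frechet_derivative smooth_christoffel
        smooth_christoffel_fields smooth_on_const)
    then show ?thesis by (subst smooth_on_cong[OF open_S]) (auto simp: curvature_eq)
  qed
  have r: "smooth_on S (\<lambda>y. ricci_tensor G y a b)" for a b
    unfolding ricci_ltrace ltrace_sum by (intro smooth_on_sum open_S smooth_on_vec_nth c)
  have lin: "linear (\<lambda>a. ricci_tensor G x a b)" if "x \<in> S" for x b
    using linear_ricci[OF that, of b] by (simp add: ricci_sym[OF that, of _ b])
  show ?thesis
    by (rule smooth_on_linear_in_basis[OF open_S linear_ricci _ w],
      assumption, rule smooth_on_linear_in_basis[OF open_S lin r v])
qed

lemma smooth_metric: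
  assumes "smooth_on S v" "smooth_on S w"
  shows "smooth_on S (\<lambda>y. metric_at (G y) (v y) (w y))"
  unfolding metric_at_def
  by (intro smooth_on_inner smooth_on_matrix_vector_mult open_S smooth_G assms)

lemma smooth_matrix_inv_G: "smooth_on S (\<lambda>y. matrix_inv (G y) $ i $ j)"
  by (intro smooth_on_vec_nth smooth_on_matrix_inv open_S smooth_G inv_G)

lemma smooth_cov: "smooth_on S V \<Longrightarrow> smooth_on S (\<lambda>y. cov G V y u)"
  unfolding cov_def
  by (intro smooth_on_add open_S smooth_on_frechet_derivative smooth_christoffel_fields smooth_on_const)

lemma smooth_cov_pairing: "smooth_on S V \<Longrightarrow> smooth_on S U \<Longrightarrow> smooth_on S (cov_pairing G V U)"
  unfolding cov_pairing_def
  by (intro smooth_on_sum smooth_on_mult smooth_matrix_inv_G smooth_metric smooth_cov open_S)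

lemma cov_sum:
  assumes x: "x \<in> S" and d: "\<And>k. k \<in> I \<Longrightarrow> f k differentiable (at x)"
  shows "cov G (\<lambda>y. \<Sum>k\<in>I. f k y) x u = (\<Sum>k\<in>I. cov G (f k) x u)"
proof -
  have "((\<lambda>y. \<Sum>k\<in>I. f k y) has_derivative (\<lambda>u. \<Sum>k\<in>I. \<D> (f k) x u)) (at x)"
    by (rule has_derivative_sum) (rule frechet_derivative_worksI[OF d])
  from has_derivative_imp_frechet[OF this] show ?thesis
    by (simp add: cov_def sum.distrib linear_sum[OF linear_christoffel[OF x]])
qed

lemma cov_pairing_sum:
  assumes x: "x \<in> S" and d: "\<And>k. k \<in> I \<Longrightarrow> f k differentiable (at x)"
  shows "cov_pairing G V (\<lambda>y. \<Sum>k\<in>I. f k y) x = (\<Sum>k\<in>I. cov_pairing G V (f k) x)"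
proof -
  have "metric_at (G x) a (\<Sum>k\<in>I. b k) = (\<Sum>k\<in>I. metric_at (G x) a (b k))" for a and b :: "_ \<Rightarrow> real^'d"
    using metric_at_sum[of "G x" b I a] by (simp add: metric_sym[OF x, of a])
  moreover have "cov G (\<lambda>y. \<Sum>k\<in>I. f k y) x u = (\<Sum>k\<in>I. cov G (f k) x u)" for u
    by (rule cov_sum[OF x d])
  ultimately show ?thesis
    unfolding cov_pairing_def
    by (simp add: sum_distrib_left sum.swap[of _ UNIV I])
qed

lemma cov_pairing_zero:
  assumes x: "x \<in> S" and N: "open N" "x \<in> N" "\<And>y. y \<in> N \<Longrightarrow> U y = 0"
  shows "cov_pairing G V U x = 0"
proof -
  have "\<D> U x = \<D> (\<lambda>_. 0) x"
    by (rule frechet_derivative_cong_open[OF N])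
  then show ?thesis
    by (simp add: cov_pairing_def cov_def N(3)[OF N(2)] linear_0[OF linear_christoffel[OF x]] metric_at_simps)
qed

lemma cov_pairing_commute: "x \<in> S \<Longrightarrow> cov_pairing G V U x = cov_pairing G U V x"
  unfolding cov_pairing_def
  by (subst sum.swap, rule sum.cong[OF refl], rule sum.cong[OF refl])
    (simp add: matrix_inv_sym metric_sym)

end

text \<open>Time is an additional coordinate of a map on the product, so that symmetry of second
  derivatives also exchanges time and space derivatives.\<close>

locale time_dependent_field = chart_metric S G
  for S :: "(real^'d::finite) set" and G :: "real^'d \<Rightarrow> real^'d^'d" +
  fixes I :: "real set" and F :: "real \<times> (real^'d) \<Rightarrow> real^'d"
  assumes open_I: "open I" and smooth_F: "smooth_on (I \<times> S) F"
begin

lemma open_IS: "open (I \<times> S)"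
  by (rule open_Times[OF open_I open_S])

definition dt :: "real \<times> (real^'d) \<Rightarrow> real^'d" where
  "dt p = \<D> F p (1, 0)"

lemma smooth_dt: "smooth_on (I \<times> S) dt"
  unfolding dt_def by (rule smooth_on_frechet_derivative[OF smooth_F])

lemma smooth_slice:
  assumes H: "smooth_on (I \<times> S) H" and t: "t \<in> I"
  shows "smooth_on S (\<lambda>y. H (t, y))"
proof (rule smooth_on_compose[OF H _ open_S open_IS])
  have "smooth_on S (\<lambda>y. (t, 0) + (0, y))"
  proof (intro smooth_on_add open_S smooth_on_const smooth_on_bounded_linear)
    show "bounded_linear (\<lambda>y::real^'d. (0::real, y))"
      by (intro bounded_linear_Pair bounded_linear_zero bounded_linear_ident)
  qed
  then show "smooth_on S (\<lambda>y. (t, y))" by simp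
qed (use t in auto)

lemma slice_derivative:
  assumes H: "smooth_on (I \<times> S) H" and p: "t \<in> I" "x \<in> S"
  shows "((\<lambda>s. H (s, x)) has_derivative (\<lambda>h. h *\<^sub>R \<D> H (t, x) (1, 0))) (at t)"
    and "\<D> (\<lambda>y. H (t, y)) x u = \<D> H (t, x) (0, u)"
proof -
  have D: "(H has_derivative \<D> H (t, x)) (at (t, x))"
    using smooth_on_has_derivative[OF H] p by simp
  have l: "linear (\<D> H (t, x))" by (rule has_derivative_linear[OF D])
  have "((\<lambda>s. (s, x)) has_derivative (\<lambda>h. (h, 0))) (at t)"
    by (intro has_derivative_Pair has_derivative_ident has_derivative_const)
  from has_derivative_compose[OF this D]
  have a: "((\<lambda>s. H (s, x)) has_derivative (\<lambda>h. \<D> H (t, x) (h, 0))) (at t)" .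
  have b: "\<D> H (t, x) (h, 0) = h *\<^sub>R \<D> H (t, x) (1, 0)" for h
    using linear_scale[OF l, of h "(1, 0)"] by simp
  show "((\<lambda>s. H (s, x)) has_derivative (\<lambda>h. h *\<^sub>R \<D> H (t, x) (1, 0))) (at t)"
    by (rule has_derivative_eq_rhs[OF a ext]) (rule b)
  have "((\<lambda>y. (t, y)) has_derivative (\<lambda>u. (0, u))) (at x)"
    by (intro has_derivative_Pair has_derivative_ident has_derivative_const)
  from has_derivative_imp_frechet[OF has_derivative_compose[OF this D]]
  show "\<D> (\<lambda>y. H (t, y)) x u = \<D> H (t, x) (0, u)" by simp
qed

lemma cov_slice:
  assumes H: "smooth_on (I \<times> S) H" and p: "t \<in> I" "x \<in> S"
  shows "cov G (\<lambda>y. H (t, y)) x u = \<D> H (t, x) (0, u) + christoffel G x u (H (t, x))"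
  by (simp add: cov_def slice_derivative(2)[OF H p])

lemma smooth_cov_slice:
  assumes H: "smooth_on (I \<times> S) H"
  shows "smooth_on (I \<times> S) (\<lambda>p. cov G (\<lambda>y. H (fst p, y)) (snd p) u)"
proof -
  have sn: "smooth_on (I \<times> S) (snd :: real \<times> (real^'d) \<Rightarrow> _)"
    by (rule smooth_on_bounded_linear[OF bounded_linear_snd])
  have "smooth_on (I \<times> S) (\<lambda>p. \<D> H p (0, u) + christoffel G (snd p) u (H p))"
  proof (intro smooth_on_add open_IS smooth_on_frechet_derivative H)
    show "smooth_on (I \<times> S) (\<lambda>p. christoffel G (snd p) u (H p))"
    proof (rule smooth_on_linear_in_basis[OF open_IS _ _ H])
      show "linear (christoffel G (snd p) u)" if "p \<in> I \<times> S" for p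
        using that by (intro linear_christoffel) auto
      show "smooth_on (I \<times> S) (\<lambda>p. christoffel G (snd p) u b)" for b
        by (rule smooth_on_compose[OF smooth_christoffel sn open_IS open_S]) auto
    qed
  qed
  then show ?thesis
    by (subst smooth_on_cong[OF open_IS]) (auto simp: cov_slice[OF H])
qed

lemma smooth_cov_pairing_slice:
  assumes H: "smooth_on (I \<times> S) H" and K: "smooth_on (I \<times> S) K"
  shows "smooth_on (I \<times> S) (\<lambda>p. cov_pairing G (\<lambda>y. H (fst p, y)) (\<lambda>y. K (fst p, y)) (snd p))"
proof -
  have sn: "smooth_on (I \<times> S) (snd :: real \<times> (real^'d) \<Rightarrow> _)"
    by (rule smooth_on_bounded_linear[OF bounded_linear_snd])
  have G: "smooth_on (I \<times> S) (\<lambda>p. G (snd p))"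
    by (rule smooth_on_compose[OF smooth_G sn open_IS open_S]) auto
  show ?thesis unfolding cov_pairing_def metric_at_def
    by (intro smooth_on_sum smooth_on_mult smooth_on_vec_nth smooth_on_matrix_inv smooth_on_inner
      smooth_on_matrix_vector_mult smooth_cov_slice G open_IS H K) (auto intro: inv_G)
qed

text \<open>The metric does not depend on time, so the Christoffel term differentiates linearly, and
  mixed derivatives commute: the rate of change of \<nabla>F is \<nabla> of the velocity.\<close>

lemma cov_slice_derivative:
  assumes p: "t \<in> I" "x \<in> S"
  shows "((\<lambda>s. cov G (\<lambda>y. F (s, y)) x u) has_derivative (\<lambda>h. h *\<^sub>R cov G (\<lambda>y. dt (t, y)) x u)) (at t)"
proof -
  let ?d = "\<lambda>p. \<D> F p (0, u)"
  have s: "\<D> ?d (t, x) (1, 0) = \<D> dt (t, x) (0, u)"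
    unfolding dt_def by (rule symmetric_second_derivative[OF open_IS smooth_F]) (use p in auto)
  have 1: "((\<lambda>s. ?d (s, x)) has_derivative (\<lambda>h. h *\<^sub>R \<D> dt (t, x) (0, u))) (at t)"
    using slice_derivative(1)[OF smooth_on_frechet_derivative[OF smooth_F] p, of "(0, u)"] by (simp add: s)
  have 2: "((\<lambda>s. christoffel G x u (F (s, x))) has_derivative (\<lambda>h. christoffel G x u (h *\<^sub>R dt (t, x)))) (at t)"
    using bounded_linear.has_derivative[OF linear_conv_bounded_linear[THEN iffD1, OF linear_christoffel[OF p(2)]]
      slice_derivative(1)[OF smooth_F p]] by (simp add: dt_def)
  have "((\<lambda>s. ?d (s, x) + christoffel G x u (F (s, x))) has_derivative (\<lambda>h. h *\<^sub>R cov G (\<lambda>y. dt (t, y)) x u)) (at t)"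
    using has_derivative_add[OF 1 2]
    by (simp add: cov_slice[OF smooth_dt p] christoffel_scale[OF p(2)] scaleR_add_right)
  then show ?thesis
    by (rule has_derivative_transform_within_open[OF _ open_I p(1)]) (simp add: cov_slice[OF smooth_F _ p(2)])
qed

lemma cov_pairing_slice_derivative:
  assumes p: "t \<in> I" "x \<in> S"
  shows "((\<lambda>s. cov_pairing G (\<lambda>y. F (s, y)) (\<lambda>y. F (s, y)) x) has_real_derivative
     2 * cov_pairing G (\<lambda>y. F (t, y)) (\<lambda>y. dt (t, y)) x) (at t)"
proof -
  let ?A = "\<lambda>s u. cov G (\<lambda>y. F (s, y)) x u" and ?B = "\<lambda>u. cov G (\<lambda>y. dt (t, y)) x u"
  have m: "((\<lambda>s. metric_at (G x) (?A s u) (?A s v)) has_derivative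
     (\<lambda>h. h * (metric_at (G x) (?A t u) (?B v) + metric_at (G x) (?B u) (?A t v)))) (at t)" for u v
  proof -
    have "((\<lambda>s. G x *v ?A s v) has_derivative (\<lambda>h. G x *v (h *\<^sub>R ?B v))) (at t)"
      by (rule bounded_linear.has_derivative[OF matrix_vector_mul_bounded_linear cov_slice_derivative[OF p]])
    from has_derivative_inner[OF cov_slice_derivative[OF p] this]
    show ?thesis by (simp add: metric_at_def matrix_vector_mult_scaleR distrib_left)
  qed
  have "((\<lambda>s. cov_pairing G (\<lambda>y. F (s, y)) (\<lambda>y. F (s, y)) x) has_derivative
     (\<lambda>h. \<Sum>i\<in>UNIV. \<Sum>j\<in>UNIV. matrix_inv (G x) $ i $ j *
       (h * (metric_at (G x) (?A t (axis i 1)) (?B (axis j 1)) + metric_at (G x) (?B (axis i 1)) (?A t (axis j 1)))))) (at t)"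
    unfolding cov_pairing_def by (intro has_derivative_sum has_derivative_mult_right m)
  moreover have "(\<Sum>i\<in>UNIV. \<Sum>j\<in>UNIV. matrix_inv (G x) $ i $ j *
       (h * (metric_at (G x) (?A t (axis i 1)) (?B (axis j 1)) + metric_at (G x) (?B (axis i 1)) (?A t (axis j 1)))))
     = (2 * cov_pairing G (\<lambda>y. F (t, y)) (\<lambda>y. dt (t, y)) x) * h" for h
  proof -
    have "(\<Sum>i\<in>UNIV. \<Sum>j\<in>UNIV. matrix_inv (G x) $ i $ j *
       (h * (metric_at (G x) (?A t (axis i 1)) (?B (axis j 1)) + metric_at (G x) (?B (axis i 1)) (?A t (axis j 1)))))
      = h * (cov_pairing G (\<lambda>y. F (t, y)) (\<lambda>y. dt (t, y)) x + cov_pairing G (\<lambda>y. dt (t, y)) (\<lambda>y. F (t, y)) x)"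
      unfolding cov_pairing_def by (simp add: sum_distrib_left sum.distrib[symmetric] algebra_simps)
    then show ?thesis using cov_pairing_commute[OF p(2), of "\<lambda>y. dt (t, y)"] by simp
  qed
  ultimately show ?thesis by (simp add: has_field_derivative_def)
qed

end

section \<open>Fields on the manifold\<close>

lemma compact_local_bound:
  fixes f :: "'t \<Rightarrow> 'm::topological_space \<Rightarrow> real"
  assumes K: "compact K" and loc: "\<And>p. p \<in> K \<Longrightarrow> \<exists>N B. open N \<and> p \<in> N \<and> (\<forall>q\<in>N. \<forall>t\<in>T. \<bar>f t q\<bar> \<le> B)"
  obtains B where "0 \<le> B" "\<And>q t. q \<in> K \<Longrightarrow> t \<in> T \<Longrightarrow> \<bar>f t q\<bar> \<le> B"
proof -
  obtain N B where N: "\<And>p. p \<in> K \<Longrightarrow> open (N p)" "\<And>p. p \<in> K \<Longrightarrow> p \<in> N p"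
    and B: "\<And>p q t. p \<in> K \<Longrightarrow> q \<in> N p \<Longrightarrow> t \<in> T \<Longrightarrow> \<bar>f t q\<bar> \<le> B p"
    using loc by metis
  have "K \<subseteq> (\<Union>p\<in>K. N p)" using N(2) by blast
  from compactE_image[OF K N(1) this]
  obtain P where P: "P \<subseteq> K" "finite P" "K \<subseteq> (\<Union>p\<in>P. N p)" by blast
  show ?thesis
  proof (rule that[of "\<Sum>p\<in>P. \<bar>B p\<bar>"])
    show "0 \<le> (\<Sum>p\<in>P. \<bar>B p\<bar>)" by (simp add: sum_nonneg)
    fix q t assume "q \<in> K" "t \<in> T"
    then obtain p where p: "p \<in> P" "q \<in> N p" using P(3) by blast
    then have "\<bar>f t q\<bar> \<le> B p" using B P(1) \<open>t \<in> T\<close> by blast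
    also have "\<dots> \<le> \<bar>B p\<bar>" by simp
    also have "\<dots> \<le> (\<Sum>p\<in>P. \<bar>B p\<bar>)" using p(1) P(2) by (intro member_le_sum) auto
    finally show "\<bar>f t q\<bar> \<le> (\<Sum>p\<in>P. \<bar>B p\<bar>)" .
  qed
qed

lemma cov_pairing_cong_open:
  assumes "open N" "x \<in> N" "\<And>y. y \<in> N \<Longrightarrow> U y = U' y"
  shows "cov_pairing G V U x = cov_pairing G V U' x"
  using frechet_derivative_cong_open[OF assms] assms(3)[OF assms(2)]
  by (simp add: cov_pairing_def cov_def)

section \<open>Scalar fields, bump functions and cut-off vector fields\<close>

context smooth_manifold_locale
begin

lemma open_chart_preimage: "c \<in> \<A> \<Longrightarrow> open N \<Longrightarrow> open (chart_image c \<inter> chart_inv c -` N)"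
  by (rule continuous_open_preimage[OF continuous_chart_inv chart(2)])

lemma continuous_chartwise:
  fixes f :: "'m \<Rightarrow> real"
  assumes "\<And>c. c \<in> \<A> \<Longrightarrow> continuous_on (chart_image c) (\<lambda>x. f (chart_inv c x))"
  shows "continuous_on UNIV f"
proof (rule continuous_at_imp_continuous_on, rule ballI)
  fix p
  obtain c where c: "c \<in> \<A>" "p \<in> fst c" by (rule chart_cover)
  have "continuous_on (fst c) (\<lambda>q. f (chart_inv c (snd c q)))"
    using continuous_on_compose2[OF assms[OF c(1)] continuous_chart[OF c(1)]] chart_apply(2)[OF c(1)] by blast
  then have "continuous_on (fst c) f"
    by (rule continuous_on_eq) (simp add: chart_apply(1)[OF c(1)])
  then show "isCont f p" using continuous_on_eq_continuous_at[OF chart(1)[OF c(1)]] c(2) by blast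
qed

definition scalar_field :: "('m \<Rightarrow> real) \<Rightarrow> bool" where
  "scalar_field f \<longleftrightarrow> (\<forall>c\<in>\<A>. smooth_on (chart_image c) (\<lambda>x. f (chart_inv c x)))"

lemma scalar_field_continuous: "scalar_field f \<Longrightarrow> continuous_on UNIV f"
  by (rule continuous_chartwise) (auto simp: scalar_field_def intro: smooth_on_continuous_on)

lemma scalar_field_sum: "(\<And>i. i \<in> I \<Longrightarrow> scalar_field (f i)) \<Longrightarrow> scalar_field (\<lambda>p. \<Sum>i\<in>I. f i p)"
  unfolding scalar_field_def by (intro ballI smooth_on_sum chart(2)) auto

definition supported :: "'m set \<Rightarrow> ('m, 'd, (real, 'd) vec) field \<Rightarrow> bool" where
  "supported K U \<longleftrightarrow> (\<forall>c\<in>\<A>. \<forall>x\<in>chart_image c. chart_inv c x \<notin> K \<longrightarrow> U c x = 0)"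

text \<open>A compact set in a Hausdorff space is closed, so the open domain of c and the complement
  of K cover the manifold; f is smooth over the first and zero over the second.\<close>

lemma smooth_extension_by_zero:
  fixes f :: "(real, 'd) vec \<Rightarrow> 'b::real_normed_vector"
  assumes c: "c' \<in> \<A>" "c \<in> \<A>" and K: "compact K" "K \<subseteq> fst c" and f: "smooth_on (overlap c' c) f"
    and f0: "\<And>x. x \<in> chart_image c' \<Longrightarrow> chart_inv c' x \<notin> K \<Longrightarrow> f x = 0"
  shows "smooth_on (chart_image c') f"
proof (rule smooth_on_local)
  fix x assume x: "x \<in> chart_image c'"
  show "\<exists>T. open T \<and> x \<in> T \<and> smooth_on T f"
  proof (cases "chart_inv c' x \<in> fst c")
    case True
    then show ?thesis using open_overlap[OF c] f x mem_overlap_iff[OF c(1), of x c] by blast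
  next
    case False
    let ?T = "chart_image c' \<inter> chart_inv c' -` (- K)"
    have T: "open ?T" using compact_imp_closed[OF K(1)] by (intro open_chart_preimage[OF c(1)]) (simp add: open_Compl)
    have "smooth_on ?T f"
      by (subst smooth_on_cong[OF T, of f "\<lambda>_. 0"]) (auto simp: f0 smooth_on_const)
    then show ?thesis using T x False K(2) by blast
  qed
qed

definition bump :: "('m, 'd) chart \<Rightarrow> (real, 'd) vec \<Rightarrow> real \<Rightarrow> 'm \<Rightarrow> real" where
  "bump c a r p = (if p \<in> fst c then flat 0 (r\<^sup>2 - (snd c p - a) \<bullet> (snd c p - a)) else 0)"

lemma bump_nonneg: "0 \<le> bump c a r p"
  by (simp add: bump_def flat_nonneg)

context
  fixes c :: "('m, 'd) chart" and a :: "(real, 'd) vec" and r :: real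
  assumes c: "c \<in> \<A>" and r: "0 < r" "cball a r \<subseteq> chart_image c"
begin

lemma compact_coordinate_ball:
  shows "compact (chart_inv c ` cball a r)" "chart_inv c ` cball a r \<subseteq> fst c"
    "open (chart_inv c ` ball a r)" "chart_inv c ` ball a r \<subseteq> chart_inv c ` cball a r"
proof -
  show "compact (chart_inv c ` cball a r)"
    by (rule compact_continuous_image[OF continuous_on_subset[OF continuous_chart_inv[OF c] r(2)] compact_cball])
  show "chart_inv c ` cball a r \<subseteq> fst c" using chart_apply(4)[OF c] r(2) by blast
  show "open (chart_inv c ` ball a r)"
    using r(2) ball_subset_cball[of a r] by (intro open_chart_inv_image[OF c]) auto
  show "chart_inv c ` ball a r \<subseteq> chart_inv c ` cball a r" by (intro image_mono ball_subset_cball)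
qed

lemma bump_outside: "p \<notin> chart_inv c ` cball a r \<Longrightarrow> bump c a r p = 0"
proof (cases "p \<in> fst c")
  case True
  assume "p \<notin> chart_inv c ` cball a r"
  then have "snd c p \<notin> cball a r" using chart_apply(1)[OF c True] by force
  then have "r < norm (snd c p - a)" by (simp add: dist_norm norm_minus_commute)
  then have "r\<^sup>2 < (snd c p - a) \<bullet> (snd c p - a)"
    using r(1) by (simp add: power2_norm_eq_inner[symmetric] power_strict_mono)
  then show ?thesis by (simp add: bump_def flat_def)
qed (simp add: bump_def)

lemma bump_inside: "p \<in> chart_inv c ` ball a r \<Longrightarrow> 0 < bump c a r p"
proof -
  assume "p \<in> chart_inv c ` ball a r"
  then obtain x where x: "x \<in> ball a r" "p = chart_inv c x" by blast
  have xi: "x \<in> chart_image c" using x(1) r(2) ball_subset_cball by blast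
  have "norm (x - a) < r" using x(1) by (simp add: dist_norm norm_minus_commute)
  then have "(x - a) \<bullet> (x - a) < r\<^sup>2"
    using r(1) by (simp add: power2_norm_eq_inner[symmetric] power_strict_mono)
  then show ?thesis using chart_apply(3,4)[OF c xi] by (simp add: bump_def x(2) flat_pos)
qed

lemma scalar_field_bump: "scalar_field (bump c a r)"
  unfolding scalar_field_def
proof
  fix c' assume c': "c' \<in> \<A>"
  show "smooth_on (chart_image c') (\<lambda>x. bump c a r (chart_inv c' x))"
  proof (rule smooth_extension_by_zero[OF c' c compact_coordinate_ball(1,2)])
    have o: "open (overlap c' c)" by (rule open_overlap[OF c' c])
    have "smooth_on (overlap c' c) (\<lambda>x. r\<^sup>2 - (transition c' c x - a) \<bullet> (transition c' c x - a))"
      by (intro smooth_on_diff smooth_on_inner smooth_on_const o smooth_transition c c')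
    from smooth_on_compose[OF smooth_flat this o open_UNIV, of 0]
    have "smooth_on (overlap c' c) (\<lambda>x. flat 0 (r\<^sup>2 - (transition c' c x - a) \<bullet> (transition c' c x - a)))" by simp
    then show "smooth_on (overlap c' c) (\<lambda>x. bump c a r (chart_inv c' x))"
      by (subst smooth_on_cong[OF o]) (auto simp: bump_def transition_eq mem_overlap_iff[OF c'])
    show "bump c a r (chart_inv c' x) = 0" if "chart_inv c' x \<notin> chart_inv c ` cball a r" for x
      by (rule bump_outside[OF that])
  qed
qed

end

lemma linear_transition:
  assumes "c \<in> \<A>" "c' \<in> \<A>" "x \<in> overlap c c'"
  shows "linear (\<D> (transition c c') x)"
  by (rule linear_frechet_derivative[OF smooth_on_differentiable[OF smooth_transition[OF assms(1,2)] assms(3)]])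

lemma vector_field_scale:
  assumes f: "scalar_field f" and V: "vector_field \<A> V"
  shows "vector_field \<A> (\<lambda>c x. f (chart_inv c x) *\<^sub>R V c x)"
proof (rule vector_fieldI)
  fix c assume c: "c \<in> \<A>"
  show "smooth_on (chart_image c) (\<lambda>x. f (chart_inv c x) *\<^sub>R V c x)"
    using f c by (intro smooth_on_scaleR chart(2) vector_field_smooth[OF V]) (auto simp: scalar_field_def)
next
  fix c c' x assume c: "c \<in> \<A>" "c' \<in> \<A>" and x: "x \<in> overlap c c'"
  show "f (chart_inv c' (transition c c' x)) *\<^sub>R V c' (transition c c' x) = \<D> (transition c c') x (f (chart_inv c x) *\<^sub>R V c x)"
    by (simp add: chart_inv_transition[OF c x] vector_field_transform[OF V c x] linear_scale[OF linear_transition[OF c x]])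
qed

lemma transition_cocycle:
  assumes c: "c0 \<in> \<A>" "c \<in> \<A>" "c' \<in> \<A>" and x: "x \<in> overlap c0 c" "x \<in> overlap c0 c'"
  shows "\<D> (transition c0 c') x z
    = \<D> (transition c c') (transition c0 c x) (\<D> (transition c0 c) x z)"
proof -
  have y: "transition c0 c x \<in> overlap c c'"
    using x mem_overlap_iff[OF c(1)] chart_inv_transition[OF c(1,2) x(1)] transition_mem[OF c(1,2) x(1)]
      mem_overlap_iff[OF c(2)] by simp
  have o: "open (overlap c0 c \<inter> overlap c0 c')" by (intro open_Int open_overlap c)
  have "\<D> (transition c0 c') x = \<D> (\<lambda>y. transition c c' (transition c0 c y)) x"
  proof (rule frechet_derivative_cong_open[OF o])
    show "x \<in> overlap c0 c \<inter> overlap c0 c'" using x by simp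
    fix y assume "y \<in> overlap c0 c \<inter> overlap c0 c'"
    then show "transition c0 c' y = transition c c' (transition c0 c y)"
      using chart_inv_transition[OF c(1,2), of y] by (simp add: transition_eq[of c c'] transition_eq[of c0 c'])
  qed
  then show ?thesis
    using frechet_derivative_compose_at[OF smooth_on_differentiable[OF smooth_transition[OF c(2,3)] y]
        smooth_on_differentiable[OF smooth_transition[OF c(1,2)] x(1)]] by simp
qed

text \<open>The field with constant components \<open>z\<close> in the chart \<open>c\<close>, cut off by a scalar field supported
  in its domain.\<close>

definition cut_off_field :: "('m, 'd) chart \<Rightarrow> ('m \<Rightarrow> real) \<Rightarrow> (real, 'd) vec \<Rightarrow> ('m, 'd, (real, 'd) vec) field" where
  "cut_off_field c f z c' y = (if chart_inv c' y \<in> fst c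
     then f (chart_inv c' y) *\<^sub>R \<D> (transition c c') (transition c' c y) z else 0)"

text \<open>Carrying z from c to the second chart directly or by way of the first gives the same
  components, by the cocycle rule; off the domain of c both sides vanish. Smoothness is that of an
  extension by zero.\<close>

lemma vector_field_cut_off:
  assumes c: "c \<in> \<A>" and f: "scalar_field f" and K: "compact K" "K \<subseteq> fst c" "\<And>p. p \<notin> K \<Longrightarrow> f p = 0"
  shows "vector_field \<A> (cut_off_field c f z)"
proof (rule vector_fieldI)
  fix c' assume c': "c' \<in> \<A>"
  show "smooth_on (chart_image c') (cut_off_field c f z c')"
  proof (rule smooth_extension_by_zero[OF c' c K(1,2)])
    have o: "open (overlap c' c)" by (rule open_overlap[OF c' c])
    have "smooth_on (overlap c' c) (\<lambda>y. f (chart_inv c' y) *\<^sub>R \<D> (transition c c') (transition c' c y) z)"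
    proof (rule smooth_on_scaleR[OF o])
      show "smooth_on (overlap c' c) (\<lambda>y. f (chart_inv c' y))"
        using f c' overlap_subset[OF c'] unfolding scalar_field_def by (blast intro: smooth_on_subset)
      show "smooth_on (overlap c' c) (\<lambda>y. \<D> (transition c c') (transition c' c y) z)"
        by (rule smooth_on_compose[OF smooth_on_frechet_derivative[OF smooth_transition[OF c c']] smooth_transition[OF c' c]
            o open_overlap[OF c c']]) (rule transition_mem[OF c' c])
    qed
    then show "smooth_on (overlap c' c) (cut_off_field c f z c')"
      by (subst smooth_on_cong[OF o]) (auto simp: cut_off_field_def mem_overlap_iff[OF c'])
    show "cut_off_field c f z c' x = 0" if "chart_inv c' x \<notin> K" for x
      using K(3)[OF that] by (simp add: cut_off_field_def)
  qed
next
  fix c1 c2 x assume c12: "c1 \<in> \<A>" "c2 \<in> \<A>" and x: "x \<in> overlap c1 c2"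
  note inv = chart_inv_transition[OF c12 x]
  show "cut_off_field c f z c2 (transition c1 c2 x) = \<D> (transition c1 c2) x (cut_off_field c f z c1 x)"
  proof (cases "chart_inv c1 x \<in> fst c")
    case False
    then show ?thesis using linear_0[OF linear_transition[OF c12 x]] by (simp add: cut_off_field_def inv)
  next
    case True
    have x1: "x \<in> overlap c1 c" using True x mem_overlap_iff[OF c12(1)] by simp
    define y where "y = transition c1 c x"
    have y: "transition c2 c (transition c1 c2 x) = y" by (simp add: y_def transition_eq[of c2 c] inv transition_eq[of c1 c])
    have y1: "y \<in> overlap c c1" unfolding y_def by (rule transition_mem[OF c12(1) c x1])
    have iy: "chart_inv c y = chart_inv c1 x" unfolding y_def by (rule chart_inv_transition[OF c12(1) c x1])
    have y2: "y \<in> overlap c c2" using y1 x mem_overlap_iff[OF c] mem_overlap_iff[OF c12(1)] iy by simp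
    have ty: "transition c c1 y = x" unfolding y_def by (rule transition_inverse[OF c12(1) c x1])
    show ?thesis
      using True transition_cocycle[OF c c12 y1 y2, of z]
      by (simp add: cut_off_field_def inv y y_def[symmetric] ty linear_scale[OF linear_transition[OF c12 x]])
  qed
qed

lemma cut_off_field_chart:
  assumes c: "c \<in> \<A>" and x: "x \<in> chart_image c"
  shows "cut_off_field c f z c x = f (chart_inv c x) *\<^sub>R z"
proof -
  have t: "transition c c y = y" if "y \<in> chart_image c" for y
    using that by (simp add: transition_eq chart_apply(3)[OF c])
  have "\<D> (transition c c) x = \<D> (\<lambda>y. y) x"
    by (rule frechet_derivative_cong_open[OF chart(2)[OF c] x t])
  then show ?thesis using x by (simp add: cut_off_field_def t chart_apply(4)[OF c])
qed

end

section \<open>The pairing as a function on the manifold\<close>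

context metric_manifold
begin

definition pairing :: "('m, 'd, (real, 'd) vec) field \<Rightarrow> ('m, 'd, (real, 'd) vec) field \<Rightarrow> 'm \<Rightarrow> real" where
  "pairing V U p = (let c = (SOME c. c \<in> \<A> \<and> p \<in> fst c) in cov_pairing (g c) (V c) (U c) (snd c p))"

lemma pairing_chart:
  assumes "vector_field \<A> V" "vector_field \<A> U" "c \<in> \<A>" "p \<in> fst c"
  shows "pairing V U p = cov_pairing (g c) (V c) (U c) (snd c p)"
proof -
  define c' where "c' = (SOME c. c \<in> \<A> \<and> p \<in> fst c)"
  have c': "c' \<in> \<A>" "p \<in> fst c'"
    using someI[of "\<lambda>c. c \<in> \<A> \<and> p \<in> fst c" c] assms by (auto simp: c'_def)
  show ?thesis
    using cov_pairing_chart[OF assms(1,2) assms(3) c'(1) assms(4) c'(2)] by (simp add: pairing_def c'_def[symmetric])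
qed

lemma pairing_chart_inv:
  assumes "vector_field \<A> V" "vector_field \<A> U" "c \<in> \<A>" "x \<in> chart_image c"
  shows "pairing V U (chart_inv c x) = cov_pairing (g c) (V c) (U c) x"
  using pairing_chart[OF assms(1-3)] chart_apply(3,4)[OF assms(3,4)] by simp

lemma continuous_pairing:
  assumes V: "vector_field \<A> V" and U: "vector_field \<A> U"
  shows "continuous_on UNIV (pairing V U)"
proof (rule continuous_chartwise)
  fix c assume c: "c \<in> \<A>"
  interpret chart_metric "chart_image c" "g c" by (rule chart_metric[OF c])
  have "continuous_on (chart_image c) (cov_pairing (g c) (V c) (U c))"
    by (intro smooth_on_continuous_on smooth_cov_pairing vector_field_smooth V U c)
  then show "continuous_on (chart_image c) (\<lambda>x. pairing V U (chart_inv c x))"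
    by (rule continuous_on_eq) (simp add: pairing_chart_inv[OF V U c])
qed

lemma pairing_measurable: "vector_field \<A> V \<Longrightarrow> vector_field \<A> U \<Longrightarrow> pairing V U \<in> borel_measurable borel"
  by (rule borel_measurable_continuous_onI[OF continuous_pairing])

text \<open>The compact set K is closed, so U vanishes on a whole neighbourhood of p and its first
  derivative vanishes at p as well.\<close>

lemma pairing_zero:
  assumes V: "vector_field \<A> V" and U: "vector_field \<A> U" and K: "compact K" "supported K U" and p: "p \<notin> K"
  shows "pairing V U p = 0"
proof -
  obtain c where c: "c \<in> \<A>" "p \<in> fst c" by (rule chart_cover)
  interpret chart_metric "chart_image c" "g c" by (rule chart_metric[OF c(1)])
  have "cov_pairing (g c) (V c) (U c) (snd c p) = 0"
  proof (rule cov_pairing_zero)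
    show "snd c p \<in> chart_image c" by (rule chart_apply(2)[OF c])
    show "open (chart_image c \<inter> chart_inv c -` (- K))"
      using compact_imp_closed[OF K(1)] by (intro open_chart_preimage[OF c(1)]) (simp add: open_Compl)
    show "snd c p \<in> chart_image c \<inter> chart_inv c -` (- K)"
      using p chart_apply(1,2)[OF c] by simp
    show "U c y = 0" if "y \<in> chart_image c \<inter> chart_inv c -` (- K)" for y
      using that K(2) c(1) by (auto simp: supported_def)
  qed
  then show ?thesis by (simp add: pairing_chart[OF V U c])
qed

lemma pairing_sum:
  assumes V: "vector_field \<A> V" and U: "vector_field \<A> U" and f: "\<And>k. k \<in> I \<Longrightarrow> vector_field \<A> (f k)"
    and eq: "\<And>c x. c \<in> \<A> \<Longrightarrow> x \<in> chart_image c \<Longrightarrow> U c x = (\<Sum>k\<in>I. f k c x)"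
  shows "pairing V U p = (\<Sum>k\<in>I. pairing V (f k) p)"
proof -
  obtain c where c: "c \<in> \<A>" "p \<in> fst c" by (rule chart_cover)
  interpret chart_metric "chart_image c" "g c" by (rule chart_metric[OF c(1)])
  have x: "snd c p \<in> chart_image c" by (rule chart_apply(2)[OF c])
  have "pairing V U p = cov_pairing (g c) (V c) (\<lambda>y. \<Sum>k\<in>I. f k c y) (snd c p)"
    unfolding pairing_chart[OF V U c] by (rule cov_pairing_cong_open[OF open_S x eq[OF c(1)]])
  also have "\<dots> = (\<Sum>k\<in>I. cov_pairing (g c) (V c) (f k c) (snd c p))"
    by (rule cov_pairing_sum[OF x]) (rule smooth_on_differentiable[OF vector_field_smooth[OF f c(1)] x])
  also have "\<dots> = (\<Sum>k\<in>I. pairing V (f k) p)"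
    by (intro sum.cong refl) (simp add: pairing_chart[OF V f c])
  finally show ?thesis .
qed

end

section \<open>Divergence theorem for the pairing with \<xi>\<close>

locale paracontact_manifold = metric_manifold \<A> g
  for \<A> :: "('m::{t2_space, second_countable_topology}, 'd::{finite,wellorder}) chart set"
    and g :: "('m, 'd, ((real, 'd) vec, 'd) vec) field" +
  fixes \<phi> :: "('m, 'd, ((real, 'd) vec, 'd) vec) field" and \<xi> \<eta> :: "('m, 'd, (real, 'd) vec) field" and n :: nat
  assumes paracontact: "paracontact_metric_manifold n \<A> \<phi> \<xi> \<eta> g"
begin

lemma paracontact_chart: "c \<in> \<A> \<Longrightarrow> paracontact_chart (chart_image c) (g c) (\<phi> c) (\<xi> c) (\<eta> c)"
  using chart_metric[of c] paracontact
  by (intro paracontact_chart.intro paracontact_chart_axioms.intro)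
    (auto simp: paracontact_metric_manifold_def contact_form_def one_form_def reeb_field_def vector_field_def
      endomorphism_field_def smooth_field_def)

lemma vector_field_\<xi>: "vector_field \<A> \<xi>"
  using paracontact by (auto simp: paracontact_metric_manifold_def reeb_field_def)

definition horizontal :: "('m, 'd, (real, 'd) vec) field \<Rightarrow> bool" where
  "horizontal U \<longleftrightarrow> (\<forall>c\<in>\<A>. \<forall>x\<in>chart_image c. \<eta> c x \<bullet> U c x = 0)"

text \<open>Integration by parts inside one chart: the divergence term of the pointwise identity
  integrates to zero and the Ricci term remains.\<close>

lemma integral_pairing_chart:
  assumes c: "c \<in> \<A>" and U: "vector_field \<A> U" and h: "horizontal U"
    and K: "compact K" "K \<subseteq> fst c" "supported K U"
  shows "integrable vol (pairing \<xi> U)"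
    and "integrable lborel (\<lambda>x. weight c x * ricci_tensor (g c) x (U c x) (\<xi> c x))"
    and "integral\<^sup>L vol (pairing \<xi> U) = - (\<integral>x. weight c x * ricci_tensor (g c) x (U c x) (\<xi> c x) \<partial>lborel)"
proof -
  interpret paracontact_chart "chart_image c" "g c" "\<phi> c" "\<xi> c" "\<eta> c" by (rule paracontact_chart[OF c])
  let ?I = "chart_image c" and ?C = "snd c ` K" and ?\<rho> = "volume_density (g c)"
  \<comment> \<open>The field whose divergence occurs in \<open>cov_pairing_eq\<close>. It depends
    linearly on the value of U at each point and so inherits the support of U.\<close>
  define X where "X y = cov (g c) (\<xi> c) y (U c y) + 2 *\<^sub>R (\<phi> c y *v U c y)" for y
  have sU: "smooth_on ?I (U c)" by (rule vector_field_smooth[OF U c])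
  have dU: "U c differentiable (at x)" if "x \<in> ?I" for x by (rule smooth_on_differentiable[OF sU that])
  have C: "compact ?C" "?C \<subseteq> ?I"
    using compact_continuous_image[OF continuous_on_subset[OF continuous_chart[OF c] K(2)] K(1)]
      K(2) chart_apply(2)[OF c] by auto
  have U0: "U c x = 0" if "x \<in> ?I" "x \<notin> ?C" for x
  proof -
    have "chart_inv c x \<notin> K" using that mem_chart_image_iff[OF c K(2)] by blast
    then show ?thesis using K(3) c that(1) by (auto simp: supported_def)
  qed
  have sX: "smooth_on ?I X"
  proof -
    have "smooth_on ?I (\<lambda>y. \<D> (\<xi> c) y (U c y))"
      by (rule smooth_on_linear_in_basis[OF open_S linear_frechet_derivative[OF diff_\<xi>] smooth_on_frechet_derivative[OF smooth_\<xi>] sU])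
    then show ?thesis unfolding X_def cov_def
      by (intro smooth_on_add smooth_on_scaleR smooth_on_const smooth_on_matrix_vector_mult open_S smooth_\<phi> sU
        smooth_christoffel_fields smooth_\<xi>)
  qed
  have dX: "X differentiable (at x)" if "x \<in> ?I" for x by (rule smooth_on_differentiable[OF sX that])
  have D\<rho>X: "((\<lambda>y. ?\<rho> y *\<^sub>R X y) has_derivative
     (\<lambda>u. ?\<rho> x *\<^sub>R \<D> X x u + (?\<rho> x * ltrace (christoffel (g c) x u)) *\<^sub>R X x)) (at x)" if "x \<in> ?I" for x
    by (rule has_derivative_scaleR[OF volume_density_derivative[OF that] frechet_derivative_worksI[OF dX[OF that]]])
  have int0: "integrable lborel (\<lambda>x. indicator ?I x * ltrace (\<D> (\<lambda>y. ?\<rho> y *\<^sub>R X y) x))"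
    "(\<integral>x. indicator ?I x * ltrace (\<D> (\<lambda>y. ?\<rho> y *\<^sub>R X y) x) \<partial>lborel) = 0"
  proof -
    have d: "(\<lambda>y. ?\<rho> y *\<^sub>R X y) differentiable (at x)" if "x \<in> ?I" for x
      by (rule differentiableI[OF D\<rho>X[OF that]])
    have cont: "continuous_on ?I (\<lambda>x. \<D> (\<lambda>y. ?\<rho> y *\<^sub>R X y) x u)" for u
    proof -
      have "continuous_on ?I (\<lambda>x. ltrace (christoffel (g c) x u))"
        unfolding ltrace_sum by (intro smooth_on_continuous_on smooth_on_sum smooth_on_vec_nth open_S smooth_christoffel)
      then have "continuous_on ?I (\<lambda>x. ?\<rho> x *\<^sub>R \<D> X x u + (?\<rho> x * ltrace (christoffel (g c) x u)) *\<^sub>R X x)"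
        by (intro continuous_intros continuous_volume_density[OF c] smooth_on_continuous_on[OF smooth_on_frechet_derivative[OF sX]]
          smooth_on_continuous_on[OF sX])
      then show ?thesis by (rule continuous_on_eq) (simp add: has_derivative_imp_frechet[OF D\<rho>X])
    qed
    have z: "?\<rho> x *\<^sub>R X x = 0" if "x \<in> ?I" "x \<notin> ?C" for x
      using U0[OF that] linear_0[OF linear_cov[OF that(1) diff_\<xi>[OF that(1)]]] by (simp add: X_def)
    show "integrable lborel (\<lambda>x. indicator ?I x * ltrace (\<D> (\<lambda>y. ?\<rho> y *\<^sub>R X y) x))"
      "(\<integral>x. indicator ?I x * ltrace (\<D> (\<lambda>y. ?\<rho> y *\<^sub>R X y) x) \<partial>lborel) = 0"
      using integral_ltrace_derivative[OF open_S C d cont z] by simp_all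
  qed
  have Ric0: "ricci_tensor (g c) x 0 w = 0" if "x \<in> ?I" for x w
    using ricci_sym[OF that, of 0 w] linear_0[OF linear_ricci[OF that]] by simp
  have sR: "smooth_on ?I (\<lambda>x. ricci_tensor (g c) x (U c x) (\<xi> c x))"
    by (rule smooth_ricci[OF sU smooth_\<xi>])
  have "integrable lborel (\<lambda>x. indicator ?C x *\<^sub>R (?\<rho> x * ricci_tensor (g c) x (U c x) (\<xi> c x)))"
    by (rule borel_integrable_compact[OF C(1)], intro continuous_intros)
      (use C(2) in \<open>auto intro: continuous_on_subset[OF continuous_volume_density[OF c]] continuous_on_subset[OF smooth_on_continuous_on[OF sR]]\<close>)
  moreover have "indicator ?C x *\<^sub>R (?\<rho> x * ricci_tensor (g c) x (U c x) (\<xi> c x)) = weight c x * ricci_tensor (g c) x (U c x) (\<xi> c x)" for x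
    using C(2) U0[of x] Ric0[of x] by (auto simp: weight_def indicator_def)
  ultimately show int1: "integrable lborel (\<lambda>x. weight c x * ricci_tensor (g c) x (U c x) (\<xi> c x))" by (simp only:)
  \<comment> \<open>Multiplied by the density, the divergence of X becomes the trace of an ordinary
    derivative.\<close>
  have eq: "(\<lambda>x. weight c x * pairing \<xi> U (param c x))
     = (\<lambda>x. indicator ?I x * ltrace (\<D> (\<lambda>y. ?\<rho> y *\<^sub>R X y) x) - weight c x * ricci_tensor (g c) x (U c x) (\<xi> c x))"
  proof
    fix x
    show "weight c x * pairing \<xi> U (param c x)
     = indicator ?I x * ltrace (\<D> (\<lambda>y. ?\<rho> y *\<^sub>R X y) x) - weight c x * ricci_tensor (g c) x (U c x) (\<xi> c x)"
    proof (cases "x \<in> ?I")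
      case True
      have "\<eta> c x \<bullet> U c x = 0" using h c True by (auto simp: horizontal_def)
      from cov_pairing_eq(1)[OF True dU[OF True] this]
      have "pairing \<xi> U (param c x) = divergence (g c) X x - ricci_tensor (g c) x (U c x) (\<xi> c x)"
        using True by (simp add: param_def pairing_chart_inv[OF vector_field_\<xi> U c] X_def[abs_def])
      then show ?thesis
        using True by (simp add: weight_def ltrace_weighted_derivative[OF True dX[OF True]] right_diff_distrib)
    qed (simp add: weight_def)
  qed
  have z: "pairing \<xi> U p = 0" if "p \<notin> fst c" for p
    using that K(2) by (intro pairing_zero[OF vector_field_\<xi> U K(1,3)]) auto
  note chart_int = integral_vol_chart[OF c pairing_measurable[OF vector_field_\<xi> U] z, unfolded eq]
  show "integrable vol (pairing \<xi> U)"
    using chart_int(2) int0(1) int1 by simp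
  show "integral\<^sup>L vol (pairing \<xi> U) = - (\<integral>x. weight c x * ricci_tensor (g c) x (U c x) (\<xi> c x) \<partial>lborel)"
    using chart_int(1) int0 int1 by simp
qed

text \<open>U is cut into finitely many fields supported in coordinate balls. Each piece is a
  function times U and therefore still horizontal and annihilated by Ric(\<xi>, .), so the statement
  for one chart makes each integral zero.\<close>

lemma integral_pairing_zero:
  assumes U: "vector_field \<A> U" and h: "horizontal U" and K: "compact K" "supported K U"
    and ric: "\<And>c x. c \<in> \<A> \<Longrightarrow> x \<in> chart_image c \<Longrightarrow> ricci_tensor (g c) x (U c x) (\<xi> c x) = 0"
  shows "integral\<^sup>L vol (pairing \<xi> U) = 0"
proof -
  have "\<exists>c r. c \<in> \<A> \<and> p \<in> fst c \<and> 0 < r \<and> cball (snd c p) r \<subseteq> chart_image c" for p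
  proof -
    obtain c where c: "c \<in> \<A>" "p \<in> fst c" by (rule chart_cover)
    then show ?thesis using coordinate_ball[OF c open_UNIV] by (metis UNIV_I)
  qed
  then obtain C R where C: "\<And>p. C p \<in> \<A>" "\<And>p. p \<in> fst (C p)" and R: "\<And>p. 0 < R p"
    "\<And>p. cball (snd (C p) p) (R p) \<subseteq> chart_image (C p)" by metis
  let ?N = "\<lambda>p. chart_inv (C p) ` ball (snd (C p) p) (R p)"
  let ?K = "\<lambda>p. chart_inv (C p) ` cball (snd (C p) p) (R p)"
  let ?b = "\<lambda>p. bump (C p) (snd (C p) p) (R p)"
  note ball = compact_coordinate_ball[OF C(1) R]
  note b = bump_outside[OF C(1) R] bump_inside[OF C(1) R] scalar_field_bump[OF C(1) R]
  have mem: "p \<in> ?N p" for p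
    using chart_apply(1)[OF C] R(1)[of p] by (intro image_eqI[of _ _ "snd (C p) p"]) auto
  have "K \<subseteq> (\<Union>p\<in>K. ?N p)" using mem by blast
  from compactE_image[OF K(1) ball(3) this]
  obtain P where P: "P \<subseteq> K" "finite P" "K \<subseteq> (\<Union>p\<in>P. ?N p)" by blast
  define \<beta> where "\<beta> q = (\<Sum>p\<in>P. ?b p q)" for q
  have sf\<beta>: "scalar_field \<beta>" unfolding \<beta>_def by (rule scalar_field_sum) (rule b(3))
  have \<beta>_pos: "0 < \<beta> q" if "q \<in> K" for q
  proof -
    have "q \<in> (\<Union>p\<in>P. ?N p)" using P(3) that by (rule subsetD)
    then obtain p where "p \<in> P" "q \<in> ?N p" by (rule UN_E)
    then show ?thesis unfolding \<beta>_def
      using P(2) b(2) by (intro sum_pos2[of P p]) (auto intro: bump_nonneg)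
  qed
  have open_pos: "open {q. 0 < \<beta> q}"
    by (rule open_Collect_less[OF continuous_on_const scalar_field_continuous[OF sf\<beta>]])
  \<comment> \<open>Dividing by \<beta> normalises the bump functions to sum 1 on K. The quotient is
    smooth where \<beta> is positive, which includes K, and it is zero on the open complement of K,
    whatever \<beta> is there.\<close>
  define V where "V c x = inverse (\<beta> (chart_inv c x)) *\<^sub>R U c x" for c x
  have V: "vector_field \<A> V"
  proof (rule vector_fieldI)
    fix c assume c: "c \<in> \<A>"
    show "smooth_on (chart_image c) (V c)"
    proof (rule smooth_on_local)
      fix x assume x: "x \<in> chart_image c"
      show "\<exists>T. open T \<and> x \<in> T \<and> smooth_on T (V c)"
      proof (cases "0 < \<beta> (chart_inv c x)")
        case True
        let ?T = "chart_image c \<inter> chart_inv c -` {q. 0 < \<beta> q}"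
        have T: "open ?T" by (rule open_chart_preimage[OF c open_pos])
        have "smooth_on ?T (V c)" unfolding V_def
          using sf\<beta> c vector_field_smooth[OF U c]
          by (intro smooth_on_scaleR smooth_on_inverse T) (auto simp: scalar_field_def intro: smooth_on_subset)
        then show ?thesis using T x True by blast
      next
        case False
        let ?T = "chart_image c \<inter> chart_inv c -` (- K)"
        have T: "open ?T" using compact_imp_closed[OF K(1)] by (intro open_chart_preimage[OF c]) (simp add: open_Compl)
        have "smooth_on ?T (V c)"
          by (subst smooth_on_cong[OF T, of _ "\<lambda>_. 0"]) (use K(2) c in \<open>auto simp: V_def supported_def smooth_on_const\<close>)
        then show ?thesis using T x False \<beta>_pos by blast
      qed
    qed
  next
    fix c c' x assume c: "c \<in> \<A>" "c' \<in> \<A>" and x: "x \<in> overlap c c'"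
    show "V c' (transition c c' x) = \<D> (transition c c') x (V c x)"
      by (simp add: V_def chart_inv_transition[OF c x] vector_field_transform[OF U c x] linear_scale[OF linear_transition[OF c x]])
  qed
  define W where "W p c x = ?b p (chart_inv c x) *\<^sub>R V c x" for p c x
  have W: "vector_field \<A> (W p)" for p
    using vector_field_scale[OF b(3)[of p] V] by (simp add: W_def[abs_def])
  have hW: "horizontal (W p)" for p using h by (simp add: horizontal_def W_def V_def)
  have suppW: "supported (?K p) (W p)" for p
    using b(1)[of _ p] by (auto simp: supported_def W_def)
  have ricW: "ricci_tensor (g c) x (W p c x) (\<xi> c x) = 0" if "c \<in> \<A>" "x \<in> chart_image c" for p c x
  proof -
    interpret paracontact_chart "chart_image c" "g c" "\<phi> c" "\<xi> c" "\<eta> c" by (rule paracontact_chart[OF that(1)])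
    show ?thesis
      using ric[OF that] linear_ricci[OF that(2), of "\<xi> c x"]
      by (simp add: W_def V_def ricci_sym[OF that(2), of _ "\<xi> c x"] linear_scale)
  qed
  have w0: "weight (C p) x * ricci_tensor (g (C p)) x (W p (C p) x) (\<xi> (C p) x) = 0" for p x
    using ricW[OF C(1)] by (cases "x \<in> chart_image (C p)") (auto simp: weight_def)
  have intW: "integrable vol (pairing \<xi> (W p))" "integral\<^sup>L vol (pairing \<xi> (W p)) = 0" for p
    using integral_pairing_chart[OF C(1) W hW ball(1,2) suppW, of p] by (simp_all add: w0)
  have sumW: "U c x = (\<Sum>p\<in>P. W p c x)" if "c \<in> \<A>" "x \<in> chart_image c" for c x
  proof -
    have "(\<Sum>p\<in>P. W p c x) = (\<beta> (chart_inv c x) * inverse (\<beta> (chart_inv c x))) *\<^sub>R U c x"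
      by (simp add: W_def V_def \<beta>_def scaleR_sum_left sum_distrib_right)
    also have "\<dots> = U c x"
      using \<beta>_pos[of "chart_inv c x"] K(2) that by (cases "chart_inv c x \<in> K") (auto simp: supported_def)
    finally show ?thesis ..
  qed
  have "integral\<^sup>L vol (pairing \<xi> U) = (\<integral>q. (\<Sum>p\<in>P. pairing \<xi> (W p) q) \<partial>vol)"
    by (rule Bochner_Integration.integral_cong[OF refl]) (rule pairing_sum[OF vector_field_\<xi> U W sumW])
  also have "\<dots> = (\<Sum>p\<in>P. integral\<^sup>L vol (pairing \<xi> (W p)))"
    by (rule Bochner_Integration.integral_sum) (rule intW(1))
  finally show ?thesis by (simp add: intW(2))
qed

end

section \<open>The first variation of the energy\<close>

context paracontact_manifold
begin

lemma \<xi>_length: "c \<in> \<A> \<Longrightarrow> x \<in> chart_image c \<Longrightarrow> metric_at (g c x) (\<xi> c x) (\<xi> c x) = 1"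
proof -
  assume c: "c \<in> \<A>" and x: "x \<in> chart_image c"
  interpret paracontact_chart "chart_image c" "g c" "\<phi> c" "\<xi> c" "\<eta> c" by (rule paracontact_chart[OF c])
  show ?thesis using eta_metric[OF x, of "\<xi> c x"] eta_xi[OF x] by simp
qed

lemma constant_length_\<xi>: "constant_length_field \<A> g 1 \<xi>"
  using vector_field_\<xi> \<xi>_length by (simp add: constant_length_field_def)

context
  fixes K :: "'m set" and \<epsilon> :: real and W :: "real \<Rightarrow> ('m, 'd, (real, 'd) vec) field"
  assumes var: "variation \<A> g 1 \<xi> K \<epsilon> W"
begin

abbreviation "I \<equiv> {-\<epsilon><..<\<epsilon>}"
abbreviation "F c \<equiv> (\<lambda>p. W (fst p) c (snd p))"

definition velocity :: "real \<Rightarrow> ('m, 'd, (real, 'd) vec) field" where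
  "velocity t c x = \<D> (F c) (t, x) (1, 0)"

lemma var_pos: "0 < \<epsilon>" and zero_mem: "0 \<in> I"
  and var_field: "t \<in> I \<Longrightarrow> vector_field \<A> (W t)"
  and var_length: "t \<in> I \<Longrightarrow> c \<in> \<A> \<Longrightarrow> x \<in> chart_image c \<Longrightarrow> metric_at (g c x) (W t c x) (W t c x) = 1"
  and var_smooth: "c \<in> \<A> \<Longrightarrow> smooth_on (I \<times> chart_image c) (F c)"
  and var_zero: "c \<in> \<A> \<Longrightarrow> x \<in> chart_image c \<Longrightarrow> W 0 c x = \<xi> c x"
  and var_outside: "t \<in> I \<Longrightarrow> c \<in> \<A> \<Longrightarrow> x \<in> chart_image c \<Longrightarrow> chart_inv c x \<notin> K \<Longrightarrow> W t c x = \<xi> c x"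
  using var by (simp_all add: variation_def constant_length_field_def)

lemma time_dependent: "c \<in> \<A> \<Longrightarrow> time_dependent_field (chart_image c) (g c) I (F c)"
  by (intro time_dependent_field.intro time_dependent_field_axioms.intro chart_metric var_smooth) auto

lemma velocity_derivative:
  assumes t: "t \<in> I" and c: "c \<in> \<A>" and x: "x \<in> chart_image c"
  shows "((\<lambda>s. W s c x) has_derivative (\<lambda>h. h *\<^sub>R velocity t c x)) (at t)"
proof -
  interpret time_dependent_field "chart_image c" "g c" I "F c" by (rule time_dependent[OF c])
  show ?thesis using slice_derivative(1)[OF smooth_F t x] by (simp add: velocity_def)
qed

text \<open>Each W s obeys the transformation law with the same linear map, the derivative of the
  transition, so the law can be differentiated in s.\<close>

lemma velocity_field:
  assumes t: "t \<in> I"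
  shows "vector_field \<A> (velocity t)"
proof (rule vector_fieldI)
  fix c assume c: "c \<in> \<A>"
  interpret time_dependent_field "chart_image c" "g c" I "F c" by (rule time_dependent[OF c])
  show "smooth_on (chart_image c) (velocity t c)"
    using smooth_slice[OF smooth_dt t] by (simp add: velocity_def[abs_def] dt_def)
next
  fix c c' x assume c: "c \<in> \<A>" "c' \<in> \<A>" and x: "x \<in> overlap c c'"
  let ?J = "\<D> (transition c c') x"
  have m: "x \<in> chart_image c" "transition c c' x \<in> chart_image c'"
    using x overlap_subset[OF c(1)] transition_mem[OF c x] overlap_subset[OF c(2)] by blast+
  have "bounded_linear ?J" by (rule linear_conv_bounded_linear[THEN iffD1, OF linear_transition[OF c x]])
  from bounded_linear.has_derivative[OF this velocity_derivative[OF t c(1) m(1)]]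
  have "((\<lambda>s. W s c' (transition c c' x)) has_derivative (\<lambda>h. ?J (h *\<^sub>R velocity t c x))) (at t)"
  proof (rule has_derivative_transform_within_open[where s = I])
    show "?J (W s c x) = W s c' (transition c c' x)" if "s \<in> I" for s
      using vector_field_transform[OF var_field[OF that] c x] by simp
  qed (use t in auto)
  from fun_cong[OF has_derivative_unique[OF velocity_derivative[OF t c(2) m(2)] this], of 1]
  show "velocity t c' (transition c c' x) = ?J (velocity t c x)"
    by simp
qed

lemma velocity_supported:
  assumes t: "t \<in> I"
  shows "supported K (velocity t)"
  unfolding supported_def
proof (intro ballI impI)
  fix c x assume c: "c \<in> \<A>" and x: "x \<in> chart_image c" "chart_inv c x \<notin> K"
  have "((\<lambda>s. W s c x) has_derivative (\<lambda>h. 0)) (at t)"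
    by (rule has_derivative_transform_within_open[OF has_derivative_const[of "\<xi> c x"], where s = I])
      (use t var_outside[OF _ c x] in auto)
  from fun_cong[OF has_derivative_unique[OF velocity_derivative[OF t c x(1)] this], of 1]
  show "velocity t c x = 0" by simp
qed

text \<open>Differentiating the constant squared length at time 0 gives 2 g(\<xi>, velocity) = 0,
  and g(\<xi>, .) is \<eta>.\<close>

lemma velocity_horizontal: "horizontal (velocity 0)"
  unfolding horizontal_def
proof (intro ballI)
  fix c x assume c: "c \<in> \<A>" and x: "x \<in> chart_image c"
  interpret paracontact_chart "chart_image c" "g c" "\<phi> c" "\<xi> c" "\<eta> c" by (rule paracontact_chart[OF c])
  note vd = velocity_derivative[OF zero_mem c x]
  have "((\<lambda>s. g c x *v W s c x) has_derivative (\<lambda>h. g c x *v (h *\<^sub>R velocity 0 c x))) (at 0)"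
    by (rule bounded_linear.has_derivative[OF matrix_vector_mul_bounded_linear vd])
  from has_derivative_inner[OF vd this]
  have "((\<lambda>s. metric_at (g c x) (W s c x) (W s c x)) has_derivative
     (\<lambda>h. metric_at (g c x) (W 0 c x) (h *\<^sub>R velocity 0 c x) + metric_at (g c x) (h *\<^sub>R velocity 0 c x) (W 0 c x))) (at 0)"
    by (simp add: metric_at_def)
  moreover have "((\<lambda>s. metric_at (g c x) (W s c x) (W s c x)) has_derivative (\<lambda>h. 0)) (at 0)"
    by (rule has_derivative_transform_within_open[OF has_derivative_const[of 1], where s = I])
      (use zero_mem var_length[OF _ c x] in auto)
  ultimately have "(\<lambda>h::real. metric_at (g c x) (W 0 c x) (h *\<^sub>R velocity 0 c x) + metric_at (g c x) (h *\<^sub>R velocity 0 c x) (W 0 c x)) = (\<lambda>h. 0)"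
    by (rule has_derivative_unique)
  from fun_cong[OF this, of 1]
  have "metric_at (g c x) (\<xi> c x) (velocity 0 c x) + metric_at (g c x) (velocity 0 c x) (\<xi> c x) = 0"
    by (simp add: var_zero[OF c x])
  then show "\<eta> c x \<bullet> velocity 0 c x = 0"
    using metric_sym[OF x, of "velocity 0 c x"] by (simp add: eta_metric[OF x])
qed

lemma density_derivative:
  assumes t: "t \<in> I"
  shows "((\<lambda>s. energy_density \<A> g (W s) p) has_real_derivative pairing (W t) (velocity t) p) (at t)"
proof -
  obtain c where c: "c \<in> \<A>" "p \<in> fst c" by (rule chart_cover)
  interpret time_dependent_field "chart_image c" "g c" I "F c" by (rule time_dependent[OF c(1)])
  have x: "snd c p \<in> chart_image c" by (rule chart_apply(2)[OF c])
  have v: "(\<lambda>y. dt (t, y)) = velocity t c" by (simp add: fun_eq_iff velocity_def dt_def)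
  have "((\<lambda>s. cov_pairing (g c) (W s c) (W s c) (snd c p)) has_real_derivative 2 * pairing (W t) (velocity t) p) (at t)"
    using cov_pairing_slice_derivative[OF t x] by (simp add: v pairing_chart[OF var_field[OF t] velocity_field[OF t] c])
  from DERIV_cmult[OF DERIV_add[OF DERIV_const this], of "1/2" "real CARD('d)"]
  have "((\<lambda>s. (1/2) * (real CARD('d) + cov_pairing (g c) (W s c) (W s c) (snd c p))) has_real_derivative pairing (W t) (velocity t) p) (at t)"
    by simp
  then show ?thesis
    by (rule has_field_derivative_transform_within_open[where S = I])
      (use t in \<open>auto simp: energy_density_chart[OF var_field c]\<close>)
qed

lemma velocity_pairing_outside: "compact K \<Longrightarrow> t \<in> I \<Longrightarrow> p \<notin> K \<Longrightarrow> pairing (W t) (velocity t) p = 0"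
  using pairing_zero[OF var_field velocity_field _ velocity_supported] by blast

text \<open>A bound uniform in time and position for dominated convergence. It is found locally by
  continuity on a compact interval times a closed coordinate ball, and globally from the compactness
  of K; outside K the pairing is zero.\<close>

lemma velocity_pairing_bound:
  assumes K: "compact K"
  obtains B where "0 \<le> B" "\<And>t p. t \<in> {- \<epsilon> / 2..\<epsilon> / 2} \<Longrightarrow> \<bar>pairing (W t) (velocity t) p\<bar> \<le> B"
proof -
  let ?T = "{- \<epsilon> / 2..\<epsilon> / 2}"
  have TI: "?T \<subseteq> I" using var_pos by auto
  have "\<exists>N B. open N \<and> p \<in> N \<and> (\<forall>q\<in>N. \<forall>t\<in>?T. \<bar>pairing (W t) (velocity t) q\<bar> \<le> B)" for p
  proof -
    obtain c where c: "c \<in> \<A>" "p \<in> fst c" by (rule chart_cover)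
    obtain r where r: "0 < r" "cball (snd c p) r \<subseteq> chart_image c"
      using coordinate_ball[OF c open_UNIV] by (metis UNIV_I)
    interpret time_dependent_field "chart_image c" "g c" I "F c" by (rule time_dependent[OF c(1)])
    let ?q = "\<lambda>p. cov_pairing (g c) (\<lambda>y. F c (fst p, y)) (\<lambda>y. dt (fst p, y)) (snd p)"
    have "continuous_on (?T \<times> cball (snd c p) r) ?q"
      by (rule continuous_on_subset[OF smooth_on_continuous_on[OF smooth_cov_pairing_slice[OF smooth_F smooth_dt]]])
        (use TI r(2) in auto)
    then have "bounded (?q ` (?T \<times> cball (snd c p) r))"
      by (intro compact_imp_bounded compact_continuous_image compact_Times compact_cball compact_Icc)
    then obtain B where B: "\<forall>y\<in>?q ` (?T \<times> cball (snd c p) r). norm y \<le> B" unfolding bounded_iff by blast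
    let ?N = "chart_inv c ` ball (snd c p) r"
    have "\<bar>pairing (W t) (velocity t) q\<bar> \<le> B" if q: "q \<in> ?N" and t: "t \<in> ?T" for q t
    proof -
      obtain y where y: "y \<in> ball (snd c p) r" "q = chart_inv c y" using q by blast
      have yc: "y \<in> cball (snd c p) r" using y(1) ball_subset_cball by blast
      have tI: "t \<in> I" using t TI by blast
      have v: "(\<lambda>y. dt (t, y)) = velocity t c" by (simp add: fun_eq_iff velocity_def dt_def)
      have "pairing (W t) (velocity t) q = ?q (t, y)"
        using pairing_chart_inv[OF var_field[OF tI] velocity_field[OF tI] c(1)] yc r(2) by (auto simp: y(2) v)
      moreover have "norm (?q (t, y)) \<le> B" by (rule bspec[OF B imageI]) (use t yc in auto)
      ultimately show ?thesis by simp
    qed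
    moreover have "open ?N" using compact_coordinate_ball(3)[OF c(1) r] .
    moreover have "p \<in> ?N"
      using chart_apply(1)[OF c] r(1) by (intro image_eqI[of _ _ "snd c p"]) auto
    ultimately show ?thesis by blast
  qed
  then obtain B where B: "0 \<le> B" "\<And>q t. q \<in> K \<Longrightarrow> t \<in> ?T \<Longrightarrow> \<bar>pairing (W t) (velocity t) q\<bar> \<le> B"
    using compact_local_bound[OF K, of ?T "\<lambda>t. pairing (W t) (velocity t)"] by blast
  show ?thesis
  proof (rule that[OF B(1)])
    fix t p assume "t \<in> ?T"
    then show "\<bar>pairing (W t) (velocity t) p\<bar> \<le> B"
      using B velocity_pairing_outside[OF K, of t p] TI by (cases "p \<in> K") auto
  qed
qed

lemma energy_density_continuous: "t \<in> I \<Longrightarrow> continuous_on UNIV (energy_density \<A> g (W t))"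
proof -
  assume t: "t \<in> I"
  have "energy_density \<A> g (W t) = (\<lambda>p. (1/2) * (real CARD('d) + pairing (W t) (W t) p))"
  proof
    fix p
    obtain c where c: "c \<in> \<A>" "p \<in> fst c" by (rule chart_cover)
    show "energy_density \<A> g (W t) p = (1/2) * (real CARD('d) + pairing (W t) (W t) p)"
      by (simp add: energy_density_chart[OF var_field[OF t] c] pairing_chart[OF var_field[OF t] var_field[OF t] c])
  qed
  then show ?thesis
    by (auto intro!: continuous_intros continuous_pairing var_field t)
qed

lemma energy_density_integrable:
  assumes t: "t \<in> I" and D: "open D" "compact (closure D)"
  shows "integrable vol (\<lambda>p. indicator D p * energy_density \<A> g (W t) p)"
proof -
  let ?e = "energy_density \<A> g (W t)"
  have "bounded (?e ` closure D)"
    by (rule compact_imp_bounded[OF compact_continuous_image[OF continuous_on_subset[OF energy_density_continuous[OF t]] D(2)]]) simp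
  then obtain B where B: "\<forall>y\<in>?e ` closure D. norm y \<le> B" unfolding bounded_iff by blast
  have f: "emeasure vol (closure D) < \<infinity>" by (rule finite_vol_compact[OF D(2)])
  have D\<mu>: "D \<in> sets vol" using D(1) by simp
  have "emeasure vol D \<le> emeasure vol (closure D)" by (rule emeasure_mono[OF closure_subset]) simp
  then have fD: "emeasure vol D < \<infinity>" using f by (rule le_less_trans)
  have "integrable vol (\<lambda>p. B * indicator D p)"
    using D\<mu> fD by (intro integrable_mult_right integrable_real_indicator) auto
  then show ?thesis
  proof (rule Bochner_Integration.integrable_bound)
    show "(\<lambda>p. indicator D p * ?e p) \<in> borel_measurable vol"
      using borel_measurable_continuous_onI[OF energy_density_continuous[OF t]] D\<mu> by simp
    have "norm (indicator D p * ?e p) \<le> norm (B * indicator D p)" for p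
    proof (cases "p \<in> D")
      case True
      then have "norm (?e p) \<le> B" using bspec[OF B imageI] closure_subset by blast
      then show ?thesis using True by simp
    qed simp
    then show "AE p in vol. norm (indicator D p * ?e p) \<le> norm (B * indicator D p)" by simp
  qed
qed

text \<open>Differentiation under the integral sign. The pairing lives in K, a subset of D, so its
  integral over D is the integral over the whole manifold and the derivative no longer depends on
  D.\<close>

lemma first_variation:
  assumes D: "open D" "compact (closure D)" and K: "compact K" "K \<subseteq> D"
  shows "((\<lambda>t. energy \<A> g D (W t)) has_real_derivative integral\<^sup>L vol (pairing \<xi> (velocity 0))) (at 0)"
proof -
  let ?T = "{- \<epsilon> / 2..\<epsilon> / 2}"
  let ?e = "\<lambda>t p. energy_density \<A> g (W t) p"
  let ?E = "\<lambda>t. energy \<A> g D (W t)"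
  have TI: "?T \<subseteq> I" using var_pos by auto
  obtain B where B: "0 \<le> B" "\<And>t p. t \<in> ?T \<Longrightarrow> \<bar>pairing (W t) (velocity t) p\<bar> \<le> B"
    using velocity_pairing_bound[OF K(1)] by blast
  have E: "?E t = (\<integral>p. indicator D p * ?e t p \<partial>vol)" for t
    by (simp add: energy_def set_lebesgue_integral_def)
  \<comment> \<open>The mean value inequality in t on a convex interval. The indicator of K, a set
    of finite volume, makes the bound integrable.\<close>
  have lip: "\<bar>?e t p - ?e 0 p\<bar> \<le> B * indicator K p * \<bar>t\<bar>" if t: "t \<in> ?T" for t p
  proof -
    have "norm (?e t p - ?e 0 p) \<le> (B * indicator K p) * norm (t - 0)"
    proof (rule field_differentiable_bound[where S = ?T])
      fix s assume s: "s \<in> ?T"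
      show "((\<lambda>s. ?e s p) has_real_derivative pairing (W s) (velocity s) p) (at s within ?T)"
        by (rule has_field_derivative_at_within[OF density_derivative]) (use TI s in blast)
      show "norm (pairing (W s) (velocity s) p) \<le> B * indicator K p"
        using B(2)[OF s] velocity_pairing_outside[OF K(1), of s p] TI s by (cases "p \<in> K") auto
    qed (use t var_pos in auto)
    then show ?thesis by simp
  qed
  \<comment> \<open>W 0 and \<xi> agree on chart images only, so they cannot be rewritten as equal
    fields; the pairing sees nothing else.\<close>
  have W0: "pairing (W 0) (velocity 0) p = pairing \<xi> (velocity 0) p" for p
  proof -
    obtain c where c: "c \<in> \<A>" "p \<in> fst c" by (rule chart_cover)
    interpret chart_metric "chart_image c" "g c" by (rule chart_metric[OF c(1)])
    have x: "snd c p \<in> chart_image c" by (rule chart_apply(2)[OF c])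
    have "cov_pairing (g c) (velocity 0 c) (W 0 c) (snd c p) = cov_pairing (g c) (velocity 0 c) (\<xi> c) (snd c p)"
      by (rule cov_pairing_cong_open[OF open_S x var_zero[OF c(1)]])
    then show ?thesis
      by (simp add: pairing_chart[OF var_field[OF zero_mem] velocity_field[OF zero_mem] c]
        pairing_chart[OF vector_field_\<xi> velocity_field[OF zero_mem] c] cov_pairing_commute[OF x, of _ "velocity 0 c"])
  qed
  have d0: "indicator D p * pairing \<xi> (velocity 0) p = pairing \<xi> (velocity 0) p" for p
    using velocity_pairing_outside[OF K(1) zero_mem, of p] K(2) by (cases "p \<in> D") (auto simp: W0)
  have fK: "emeasure vol K < \<infinity>" by (rule finite_vol_compact[OF K(1)])
  have wint: "integrable vol (\<lambda>p. B * indicator K p)"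
    using fK compact_imp_closed[OF K(1)] by (intro integrable_mult_right integrable_real_indicator) auto
  have pm: "pairing \<xi> (velocity 0) \<in> borel_measurable vol"
    using pairing_measurable[OF vector_field_\<xi> velocity_field[OF zero_mem]] by simp
  \<comment> \<open>The limit is tested along sequences, as dominated convergence requires. Y drops
    the first N terms, so that all times lie in the interval of the bound.\<close>
  have "((\<lambda>h. (?E (0 + h) - ?E 0) / h) \<longlongrightarrow> integral\<^sup>L vol (pairing \<xi> (velocity 0))) (at 0)"
    unfolding tendsto_at_iff_sequentially
  proof (intro allI impI)
    fix X :: "nat \<Rightarrow> real" assume X: "\<forall>i. X i \<in> UNIV - {0}" "X \<longlonglongrightarrow> 0"
    have "\<forall>\<^sub>F i in sequentially. dist (X i) 0 < \<epsilon> / 2"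
      using X(2) var_pos by (intro tendstoD) auto
    then obtain N where N: "\<And>i. N \<le> i \<Longrightarrow> \<bar>X i\<bar> < \<epsilon> / 2" unfolding eventually_sequentially by (auto simp: dist_real_def)
    define Y where "Y i = X (i + N)" for i
    have Y: "Y i \<noteq> 0" "Y i \<in> ?T" for i using X(1) N[of "i + N"] by (auto simp: Y_def abs_less_iff)
    have Y0: "Y \<longlonglongrightarrow> 0" unfolding Y_def by (rule LIMSEQ_ignore_initial_segment[OF X(2)])
    have YI: "Y i \<in> I" for i using Y(2) TI by blast
    define q where "q i p = (indicator D p * ?e (Y i) p - indicator D p * ?e 0 p) / Y i" for i p
    have q_int: "integrable vol (q i)" "integral\<^sup>L vol (q i) = (?E (Y i) - ?E 0) / Y i" for i
    proof -
      have qd: "q i = (\<lambda>p. (indicator D p * ?e (Y i) p - indicator D p * ?e 0 p) / Y i)" by (simp add: q_def fun_eq_iff)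
      show "integrable vol (q i)" "integral\<^sup>L vol (q i) = (?E (Y i) - ?E 0) / Y i"
        unfolding qd E using energy_density_integrable[OF YI D, of i] energy_density_integrable[OF zero_mem D] by simp_all
    qed
    have lim: "(\<lambda>i. q i p) \<longlonglongrightarrow> pairing \<xi> (velocity 0) p" for p
    proof -
      have "((\<lambda>h. (?e (0 + h) p - ?e 0 p) / h) \<longlongrightarrow> pairing \<xi> (velocity 0) p) (at 0)"
        using density_derivative[OF zero_mem, of p] by (simp add: DERIV_def W0)
      moreover have "filterlim Y (at 0) sequentially" using Y0 Y(1) by (simp add: filterlim_at)
      ultimately have "(\<lambda>i. (?e (0 + Y i) p - ?e 0 p) / Y i) \<longlonglongrightarrow> pairing \<xi> (velocity 0) p"
        by (rule filterlim_compose)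
      from tendsto_mult_left[OF this, of "indicator D p"] show ?thesis
        by (simp add: d0 q_def right_diff_distrib diff_divide_distrib)
    qed
    have bound: "norm (q i p) \<le> B * indicator K p" for i p
    proof -
      have "norm (q i p) = indicator D p * \<bar>?e (Y i) p - ?e 0 p\<bar> / \<bar>Y i\<bar>"
        by (simp add: q_def right_diff_distrib[symmetric] abs_mult)
      also have "\<dots> \<le> 1 * (B * indicator K p * \<bar>Y i\<bar>) / \<bar>Y i\<bar>"
        using lip[OF Y(2)[of i], of p] by (intro divide_right_mono mult_mono) (auto simp: indicator_def)
      finally show ?thesis using Y(1)[of i] by simp
    qed
    have qm: "q i \<in> borel_measurable vol" for i using q_int(1)[of i] by (rule borel_measurable_integrable)
    have "(\<lambda>i. integral\<^sup>L vol (q i)) \<longlonglongrightarrow> integral\<^sup>L vol (pairing \<xi> (velocity 0))"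
      by (rule integral_dominated_convergence[where s = q, OF pm qm wint]) (use lim bound in auto)
    then have "(\<lambda>i. (?E (X (i + N)) - ?E 0) / X (i + N)) \<longlonglongrightarrow> integral\<^sup>L vol (pairing \<xi> (velocity 0))"
      by (simp add: q_int(2) Y_def)
    then have "(\<lambda>i. (?E (X i) - ?E 0) / X i) \<longlonglongrightarrow> integral\<^sup>L vol (pairing \<xi> (velocity 0))"
      by (rule LIMSEQ_offset)
    then show "((\<lambda>h. (?E (0 + h) - ?E 0) / h) \<circ> X) \<longlonglongrightarrow> integral\<^sup>L vol (pairing \<xi> (velocity 0))"
      by (simp add: comp_def)
  qed
  then show ?thesis by (simp add: DERIV_def)
qed

end

section \<open>The two implications between harmonicity and collinearity\<close>

lemma harmonic_if_eigenvector:
  assumes eig: "\<And>c x. c \<in> \<A> \<Longrightarrow> x \<in> chart_image c \<Longrightarrow> \<exists>k. ricci_operator (g c) x (\<xi> c x) = k *\<^sub>R \<xi> c x"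
  shows "harmonic_vector_field \<A> g \<xi>"
  unfolding harmonic_vector_field_def
proof (intro exI[of _ 1] conjI allI impI)
  fix D K \<epsilon> W
  assume H: "open D \<and> connected D \<and> compact (closure D) \<and> compact K \<and> K \<subseteq> D \<and> variation \<A> g 1 \<xi> K \<epsilon> W"
  then have v: "variation \<A> g 1 \<xi> K \<epsilon> W" by simp
  have "integral\<^sup>L vol (pairing \<xi> (velocity W 0)) = 0"
  proof (rule integral_pairing_zero[OF velocity_field[OF v zero_mem[OF v]] velocity_horizontal[OF v] _ velocity_supported[OF v zero_mem[OF v]]])
    show "compact K" using H by simp
    fix c x assume c: "c \<in> \<A>" and x: "x \<in> chart_image c"
    interpret paracontact_chart "chart_image c" "g c" "\<phi> c" "\<xi> c" "\<eta> c" by (rule paracontact_chart[OF c])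
    obtain k where k: "ricci_operator (g c) x (\<xi> c x) = k *\<^sub>R \<xi> c x" using eig[OF c x] by blast
    have "ricci_tensor (g c) x (velocity W 0 c x) (\<xi> c x) = ricci_tensor (g c) x (\<xi> c x) (velocity W 0 c x)"
      by (rule ricci_sym[OF x])
    also have "\<dots> = metric_at (g c x) (k *\<^sub>R \<xi> c x) (velocity W 0 c x)"
      by (simp add: ricci_operator[OF x, symmetric] k)
    also have "\<dots> = k * (\<eta> c x \<bullet> velocity W 0 c x)" by (simp add: metric_at_simps eta_metric[OF x])
    also have "\<dots> = 0" using velocity_horizontal[OF v] c x by (simp add: horizontal_def)
    finally show "ricci_tensor (g c) x (velocity W 0 c x) (\<xi> c x) = 0" .
  qed
  then show "((\<lambda>t. energy \<A> g D (W t)) has_real_derivative 0) (at 0)"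
    using first_variation[OF v, of D] H by simp
qed (simp_all add: constant_length_\<xi>)

text \<open>A rational parametrisation of the unit vectors near \<open>\<xi>\<close> in the direction of \<open>U\<close>: with
  \<open>s = t\<^sup>2 g(U, U) / 4\<close>, the vector \<open>((1 - s) \<xi> + t U) / (1 + s)\<close> has the length of \<open>\<xi>\<close>, because
  \<open>(1 - s)\<^sup>2 + 4 s = (1 + s)\<^sup>2\<close>.\<close>

definition rational_variation :: "('m, 'd, (real, 'd) vec) field \<Rightarrow> real \<Rightarrow> ('m, 'd, (real, 'd) vec) field" where
  "rational_variation U t c x = (let s = t\<^sup>2 * metric_at (g c x) (U c x) (U c x) / 4 in
     inverse (1 + s) *\<^sub>R ((1 - s) *\<^sub>R \<xi> c x + t *\<^sub>R U c x))"

text \<open>In an indefinite metric g(U, U) may be negative, so 1 + s could vanish for large t.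
  Compactness of the support bounds g(U, U) and yields a time interval on which 1 + s stays
  positive.\<close>

lemma rational_variation:
  assumes U: "vector_field \<A> U" and h: "horizontal U" and K: "compact K" "supported K U"
  obtains \<epsilon> where "variation \<A> g 1 \<xi> K \<epsilon> (rational_variation U)"
proof -
  let ?q = "\<lambda>c x. metric_at (g c x) (U c x) (U c x)"
  have sq: "smooth_on (chart_image c) (?q c)" if c: "c \<in> \<A>" for c
  proof -
    interpret chart_metric "chart_image c" "g c" by (rule chart_metric[OF c])
    show ?thesis by (intro smooth_metric vector_field_smooth U c)
  qed
  \<comment> \<open>The function g(U, U) on the manifold itself, where the compactness of K can be
    applied; its value does not depend on the chosen chart.\<close>
  define Q where "Q p = (let c = (SOME c. c \<in> \<A> \<and> p \<in> fst c) in ?q c (snd c p))" for p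
  have Q: "Q (chart_inv c x) = ?q c x" if c: "c \<in> \<A>" and x: "x \<in> chart_image c" for c x
  proof -
    let ?p = "chart_inv c x"
    define c' where "c' = (SOME c'. c' \<in> \<A> \<and> ?p \<in> fst c')"
    have c': "c' \<in> \<A>" "?p \<in> fst c'"
      using someI[of "\<lambda>c'. c' \<in> \<A> \<and> ?p \<in> fst c'" c] c chart_apply(4)[OF c x] by (auto simp: c'_def)
    have "x \<in> overlap c c'" using c' x mem_overlap_iff[OF c] by simp
    from metric_at_transition[OF U U c c'(1) this] show ?thesis
      by (simp add: Q_def c'_def[symmetric] transition_eq)
  qed
  have "continuous_on UNIV Q"
    by (rule continuous_chartwise, rule continuous_on_eq[OF smooth_on_continuous_on[OF sq]]) (simp_all add: Q)
  then have "bounded (Q ` K)"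
    by (intro compact_imp_bounded compact_continuous_image K(1)) (rule continuous_on_subset, auto)
  then obtain B0 where B0: "\<forall>y\<in>Q ` K. norm y \<le> B0" unfolding bounded_iff by blast
  define B where "B = max B0 0"
  have qB: "\<bar>?q c x\<bar> \<le> B" if c: "c \<in> \<A>" and x: "x \<in> chart_image c" for c x
  proof (cases "chart_inv c x \<in> K")
    case True
    then show ?thesis using bspec[OF B0 imageI[OF True]] Q[OF c x] by (simp add: B_def)
  next
    case False
    then have "U c x = 0" using K(2) c x by (simp add: supported_def)
    then show ?thesis by (simp add: metric_at_simps B_def)
  qed
  have B: "0 \<le> B" by (simp add: B_def)
  \<comment> \<open>This value satisfies both \<epsilon> \<le> 1 and \<epsilon> B \<le> 1, hence
    \<open>t\<^sup>2 \<bar>g(U, U)\<bar> \<le> 1\<close> and |s| \<le> 1/4 on the interval.\<close>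
  define \<epsilon> where "\<epsilon> = inverse (1 + B)"
  have \<epsilon>: "0 < \<epsilon>" using B by (simp add: \<epsilon>_def)
  let ?I = "{-\<epsilon><..<\<epsilon>}"
  have pos: "0 < 1 + t\<^sup>2 * ?q c x / 4" if t: "t \<in> ?I" and c: "c \<in> \<A>" and x: "x \<in> chart_image c" for t c x
  proof -
    have t1: "\<bar>t\<bar> \<le> \<epsilon>" using t by auto
    have \<epsilon>1: "\<epsilon> \<le> 1" using B by (simp add: \<epsilon>_def inverse_le_1_iff)
    have "t\<^sup>2 \<le> \<epsilon> * 1" using t1 \<epsilon>1 unfolding power2_eq_square abs_mult_self_eq[of t, symmetric]
      by (intro mult_mono) auto
    then have "t\<^sup>2 * \<bar>?q c x\<bar> \<le> \<epsilon> * B" using qB[OF c x] \<epsilon> by (intro mult_mono) auto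
    also have "\<epsilon> * B \<le> 1" using B by (simp add: \<epsilon>_def field_simps)
    finally have "\<bar>t\<^sup>2 * ?q c x\<bar> \<le> 1" by (simp add: abs_mult)
    then show ?thesis by linarith
  qed
  let ?W = "rational_variation U"
  have W_field: "vector_field \<A> (?W t)" if t: "t \<in> ?I" for t
  proof (rule vector_fieldI)
    fix c assume c: "c \<in> \<A>"
    note o = chart(2)[OF c]
    have "smooth_on (chart_image c) (\<lambda>x. inverse (1 + t\<^sup>2 * ?q c x * (1/4)) *\<^sub>R ((1 - t\<^sup>2 * ?q c x * (1/4)) *\<^sub>R \<xi> c x + t *\<^sub>R U c x))"
      using pos[OF t c] by (intro smooth_on_scaleR smooth_on_inverse smooth_on_add smooth_on_diff smooth_on_mult
         smooth_on_const sq c o vector_field_smooth U vector_field_\<xi>) fastforce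
    then show "smooth_on (chart_image c) (?W t c)" by (simp add: rational_variation_def[abs_def] Let_def)
  next
    fix c c' x assume c: "c \<in> \<A>" "c' \<in> \<A>" and x: "x \<in> overlap c c'"
    note l = linear_transition[OF c x]
    show "?W t c' (transition c c' x) = \<D> (transition c c') x (?W t c x)"
      unfolding rational_variation_def Let_def metric_at_transition[OF U U c x]
      by (simp add: vector_field_transform[OF U c x] vector_field_transform[OF vector_field_\<xi> c x]
        linear_add[OF l] linear_scale[OF l])
  qed
  have W_length: "metric_at (g c x) (?W t c x) (?W t c x) = 1" if t: "t \<in> ?I" and c: "c \<in> \<A>" and x: "x \<in> chart_image c" for t c x
  proof -
    interpret paracontact_chart "chart_image c" "g c" "\<phi> c" "\<xi> c" "\<eta> c" by (rule paracontact_chart[OF c])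
    define s where "s = t\<^sup>2 * ?q c x / 4"
    have "metric_at (g c x) (\<xi> c x) (U c x) = 0"
      using h c x by (simp add: eta_metric[OF x, symmetric] horizontal_def)
    then have z: "metric_at (g c x) (\<xi> c x) (U c x) = 0" "metric_at (g c x) (U c x) (\<xi> c x) = 0"
      using metric_sym[OF x] by simp_all
    have "metric_at (g c x) (?W t c x) (?W t c x) = (inverse (1 + s))\<^sup>2 * ((1 - s)\<^sup>2 + t\<^sup>2 * ?q c x)"
    proof -
      have W: "?W t c x = inverse (1 + s) *\<^sub>R ((1 - s) *\<^sub>R \<xi> c x + t *\<^sub>R U c x)"
        by (simp only: rational_variation_def Let_def s_def)
      show ?thesis unfolding W
        by (simp add: metric_at_simps z \<xi>_length[OF c x] power2_eq_square algebra_simps)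
    qed
    also have "t\<^sup>2 * ?q c x = 4 * s" by (simp add: s_def)
    also have "(1 - s)\<^sup>2 + 4 * s = (1 + s)\<^sup>2" by (simp add: power2_eq_square algebra_simps)
    finally show ?thesis using pos[OF t c x] by (simp add: s_def[symmetric] power_mult_distrib[symmetric])
  qed
  have W_smooth: "smooth_on (?I \<times> chart_image c) (\<lambda>p. ?W (fst p) c (snd p))" if c: "c \<in> \<A>" for c
  proof -
    have o: "open (?I \<times> chart_image c)" by (intro open_Times chart(2)[OF c]) simp
    have f: "smooth_on (?I \<times> chart_image c) (fst :: real \<times> (real, 'd) vec \<Rightarrow> real)"
      by (rule smooth_on_bounded_linear[OF bounded_linear_fst])
    have s: "smooth_on (?I \<times> chart_image c) (\<lambda>p. f (snd p))" if "smooth_on (chart_image c) f" for f :: "_ \<Rightarrow> 'b::real_normed_vector"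
      by (rule smooth_on_compose[OF that smooth_on_bounded_linear[OF bounded_linear_snd] o chart(2)[OF c]]) auto
    have nz: "1 + fst p * fst p * ?q c (snd p) * (1/4) \<noteq> 0" if "p \<in> ?I \<times> chart_image c" for p
      using pos[of "fst p" c "snd p"] c that by (auto simp: power2_eq_square)
    have "smooth_on (?I \<times> chart_image c) (\<lambda>p. inverse (1 + fst p * fst p * ?q c (snd p) * (1/4)) *\<^sub>R
        ((1 - fst p * fst p * ?q c (snd p) * (1/4)) *\<^sub>R \<xi> c (snd p) + fst p *\<^sub>R U c (snd p)))"
      by (intro smooth_on_scaleR smooth_on_inverse smooth_on_add smooth_on_diff smooth_on_mult smooth_on_const o f
        s[OF sq[OF c]] s[OF vector_field_smooth[OF U c]] s[OF vector_field_smooth[OF vector_field_\<xi> c]] nz)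
    then show ?thesis by (simp add: rational_variation_def Let_def power2_eq_square)
  qed
  have "variation \<A> g 1 \<xi> K \<epsilon> ?W"
    unfolding variation_def
  proof (intro conjI ballI impI)
    show "constant_length_field \<A> g 1 (?W t)" if "t \<in> ?I" for t
      using W_field[OF that] W_length[OF that] by (simp add: constant_length_field_def)
    show "?W 0 c x = \<xi> c x" for c x by (simp add: rational_variation_def)
    show "?W t c x = \<xi> c x" if "c \<in> \<A>" "x \<in> chart_image c" "chart_inv c x \<notin> K" for t c x
      using K(2) that by (simp add: rational_variation_def supported_def metric_at_simps)
  qed (rule \<epsilon> W_smooth, assumption?)+
  then show ?thesis by (rule that)
qed

text \<open>The quantity s is quadratic in t, so only the term t U contributes at first
  order.\<close>

lemma velocity_rational_variation:
  assumes v: "variation \<A> g 1 \<xi> K \<epsilon> (rational_variation U)" and c: "c \<in> \<A>" and x: "x \<in> chart_image c"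
  shows "velocity (rational_variation U) 0 c x = U c x"
proof -
  let ?q = "metric_at (g c x) (U c x) (U c x)"
  have "((\<lambda>t. rational_variation U t c x) has_derivative (\<lambda>h. h *\<^sub>R U c x)) (at 0)"
    unfolding rational_variation_def Let_def
    by (auto intro!: derivative_eq_intros simp: power2_eq_square)
  from fun_cong[OF has_derivative_unique[OF velocity_derivative[OF v zero_mem[OF v] c x] this], of 1]
  show ?thesis by simp
qed

text \<open>The fundamental lemma of the calculus of variations. If Q\<xi> were not collinear to
  \<xi> at a, a horizontal test field concentrated near a would make the first variation the
  negative of the integral of a nonnegative function that is positive on a ball.\<close>

lemma eigenvector_if_harmonic:
  assumes harm: "harmonic_vector_field \<A> g \<xi>" and c: "c \<in> \<A>" and a: "a \<in> chart_image c"
  shows "\<exists>k. ricci_operator (g c) a (\<xi> c a) = k *\<^sub>R \<xi> c a"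
proof (rule ccontr)
  interpret paracontact_chart "chart_image c" "g c" "\<phi> c" "\<xi> c" "\<eta> c" by (rule paracontact_chart[OF c])
  let ?Q = "ricci_operator (g c) a (\<xi> c a)"
  assume no: "\<nexists>k. ?Q = k *\<^sub>R \<xi> c a"
  \<comment> \<open>The component of Q\<xi> orthogonal to \<xi> at a; it is nonzero exactly when
    collinearity fails.\<close>
  define w where "w = ?Q - (\<eta> c a \<bullet> ?Q) *\<^sub>R \<xi> c a"
  have "w \<noteq> 0" using no by (auto simp: w_def)
  then have "\<exists>z. metric_at (g c a) z w \<noteq> metric_at (g c a) z 0" using metric_eqI[OF a] by blast
  then obtain z0 where z0: "metric_at (g c a) w z0 \<noteq> 0" using metric_sym[OF a] by (auto simp: metric_at_simps)
  define z where "z = (if 0 < metric_at (g c a) w z0 then z0 else - z0)"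
  have z: "0 < metric_at (g c a) w z" using z0 by (auto simp: z_def metric_at_simps)
  \<comment> \<open>The horizontal projection of the constant field z. At a its Ricci value is g(w,
    z), made positive by the choice of sign of z, and so it stays positive near a by
    continuity.\<close>
  define u where "u x = z - (\<eta> c x \<bullet> z) *\<^sub>R \<xi> c x" for x
  define R where "R x = ricci_tensor (g c) x (u x) (\<xi> c x)" for x
  have "R a = ricci_tensor (g c) a (\<xi> c a) (u a)" unfolding R_def by (rule ricci_sym[OF a])
  also have "\<dots> = metric_at (g c a) ?Q (u a)" by (rule ricci_operator[OF a, symmetric])
  also have "\<dots> = metric_at (g c a) w z"
    by (simp add: u_def w_def metric_at_simps eta_metric[OF a] metric_sym[OF a, of ?Q "\<xi> c a"])
  finally have "R a = metric_at (g c a) w z" .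
  then have Ra: "0 < R a" using z by simp
  have su: "smooth_on (chart_image c) u" unfolding u_def
    by (intro smooth_on_diff smooth_on_scaleR smooth_on_inner smooth_on_const open_S smooth_\<xi> smooth_\<eta>)
  have cR: "continuous_on (chart_image c) R" unfolding R_def
    by (rule smooth_on_continuous_on[OF smooth_ricci[OF su smooth_\<xi>]])
  have "open (chart_image c \<inter> R -` {0<..})" by (rule continuous_open_preimage[OF cR open_S]) simp
  then obtain r where r: "0 < r" "cball a r \<subseteq> chart_image c \<inter> R -` {0<..}"
    using a Ra open_contains_cball by (metis (no_types, lifting) IntI greaterThan_iff vimage_eq)
  \<comment> \<open>Two concentric balls: the closed ball of half radius carries the test field, and
    the open ball of radius r is the domain D, connected and with compact closure.\<close>
  define r' where "r' = r / 2"
  have r': "0 < r'" "cball a r' \<subseteq> chart_image c" "cball a r' \<subseteq> ball a r"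
    using r by (auto simp: r'_def)
  have rc: "cball a r \<subseteq> chart_image c" using r(2) by blast
  define K where "K = chart_inv c ` cball a r'"
  define D where "D = chart_inv c ` ball a r"
  note Kb = compact_coordinate_ball[OF c r'(1,2), folded K_def]
  note Db = compact_coordinate_ball[OF c r(1) rc, folded D_def]
  have KD: "K \<subseteq> D" unfolding K_def D_def by (rule image_mono[OF r'(3)])
  have cD: "compact (closure D)"
  proof -
    have "closure D \<subseteq> chart_inv c ` cball a r"
      by (rule closure_minimal[OF Db(4) compact_imp_closed[OF Db(1)]])
    then have "closure D = (chart_inv c ` cball a r) \<inter> closure D" by blast
    moreover have "compact ((chart_inv c ` cball a r) \<inter> closure D)" by (intro compact_Int_closed Db(1)) simp
    ultimately show ?thesis by simp
  qed
  have conD: "connected D" unfolding D_def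
    by (rule connected_continuous_image[OF continuous_on_subset[OF continuous_chart_inv[OF c]]])
      (use rc ball_subset_cball[of a r] in auto)
  let ?b = "bump c a r'"
  note b = bump_outside[OF c r'(1,2), folded K_def] bump_inside[OF c r'(1,2)] scalar_field_bump[OF c r'(1,2)]
  define Z where "Z = cut_off_field c ?b z"
  have Z: "vector_field \<A> Z" unfolding Z_def by (rule vector_field_cut_off[OF c b(3) Kb(1,2) b(1)])
  \<comment> \<open>The \<xi>-component is removed after the cut-off, globally and by metric terms,
    so that the result is visibly a vector field; in the chart c it equals the bump function times
    u.\<close>
  define U where "U c' x = Z c' x - (metric_at (g c' x) (\<xi> c' x) (Z c' x)) *\<^sub>R \<xi> c' x" for c' x
  have U: "vector_field \<A> U"
  proof (rule vector_fieldI)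
    fix c' assume c': "c' \<in> \<A>"
    interpret C': chart_metric "chart_image c'" "g c'" by (rule chart_metric[OF c'])
    show "smooth_on (chart_image c') (U c')" unfolding U_def
      by (intro smooth_on_diff smooth_on_scaleR C'.smooth_metric C'.open_S vector_field_smooth Z vector_field_\<xi> c')
  next
    fix c1 c2 x assume c12: "c1 \<in> \<A>" "c2 \<in> \<A>" and x: "x \<in> overlap c1 c2"
    note l = linear_transition[OF c12 x]
    show "U c2 (transition c1 c2 x) = \<D> (transition c1 c2) x (U c1 x)"
      unfolding U_def metric_at_transition[OF vector_field_\<xi> Z c12 x]
      by (simp add: vector_field_transform[OF Z c12 x] vector_field_transform[OF vector_field_\<xi> c12 x] linear_diff[OF l] linear_scale[OF l])
  qed
  have hU: "horizontal U"
    unfolding horizontal_def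
  proof (intro ballI)
    fix c' x assume c': "c' \<in> \<A>" and x: "x \<in> chart_image c'"
    interpret C': paracontact_chart "chart_image c'" "g c'" "\<phi> c'" "\<xi> c'" "\<eta> c'" by (rule paracontact_chart[OF c'])
    show "\<eta> c' x \<bullet> U c' x = 0"
      by (simp add: U_def C'.eta_metric[OF x] metric_at_simps \<xi>_length[OF c' x])
  qed
  have sU: "supported K U"
    using b(1) by (auto simp: supported_def U_def Z_def cut_off_field_def metric_at_simps)
  obtain \<epsilon> where v: "variation \<A> g 1 \<xi> K \<epsilon> (rational_variation U)"
    by (rule rational_variation[OF U hU Kb(1) sU])
  let ?W = "rational_variation U"
  have vel: "velocity ?W 0 c' x = U c' x" if "c' \<in> \<A>" "x \<in> chart_image c'" for c' x
    by (rule velocity_rational_variation[OF v that])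
  have "((\<lambda>t. energy \<A> g D (?W t)) has_real_derivative 0) (at 0)"
  proof -
    obtain r0 where "r0 \<noteq> 0" and len: "constant_length_field \<A> g r0 \<xi>"
      and crit: "\<And>D K \<epsilon> W. open D \<and> connected D \<and> compact (closure D) \<and> compact K \<and> K \<subseteq> D \<and>
        variation \<A> g r0 \<xi> K \<epsilon> W \<Longrightarrow> ((\<lambda>t. energy \<A> g D (W t)) has_real_derivative 0) (at 0)"
      using harm unfolding harmonic_vector_field_def by blast
    \<comment> \<open>Harmonicity provides some constant length, which the value g(\<xi>, \<xi>) = 1
      at a identifies.\<close>
    have "r0 = 1" using len \<xi>_length[OF c a] c a by (auto simp: constant_length_field_def)
    then show ?thesis using crit[of D K \<epsilon> ?W] Db(3) conD cD Kb(1) KD v by simp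
  qed
  from DERIV_unique[OF first_variation[OF v Db(3) cD Kb(1) KD] this]
  have "integral\<^sup>L vol (pairing \<xi> (velocity ?W 0)) = 0" .
  moreover note int = integral_pairing_chart[OF c velocity_field[OF v zero_mem[OF v]] velocity_horizontal[OF v]
      Kb(1,2) velocity_supported[OF v zero_mem[OF v]]]
  ultimately have i0: "(\<integral>x. weight c x * ricci_tensor (g c) x (velocity ?W 0 c x) (\<xi> c x) \<partial>lborel) = 0" by simp
  have eq: "weight c x * ricci_tensor (g c) x (velocity ?W 0 c x) (\<xi> c x) = weight c x * ?b (chart_inv c x) * R x" for x
  proof (cases "x \<in> chart_image c")
    case True
    have "U c x = ?b (chart_inv c x) *\<^sub>R u x"
      by (simp add: U_def Z_def cut_off_field_chart[OF c True] u_def eta_metric[OF True] metric_at_simps scaleR_diff_right)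
    then show ?thesis using linear_scale[OF linear_ricci[OF True]]
      by (simp add: vel[OF c True] R_def ricci_sym[OF True, of _ "\<xi> c x"])
  qed (simp add: weight_def)
  let ?f = "\<lambda>x. weight c x * ?b (chart_inv c x) * R x"
  have bz: "?b (chart_inv c x) = 0" if "x \<in> chart_image c" "x \<notin> cball a r'" for x
  proof (rule b(1), rule notI)
    assume "chart_inv c x \<in> K"
    then obtain y where y: "y \<in> cball a r'" "chart_inv c x = chart_inv c y" unfolding K_def by (rule imageE)
    have "x = snd c (chart_inv c x)" by (rule chart_apply(3)[OF c that(1), symmetric])
    also have "\<dots> = y" unfolding y(2) by (rule chart_apply(3)[OF c subsetD[OF r'(2) y(1)]])
    finally show False using y(1) that(2) by simp
  qed
  have nn: "0 \<le> ?f x" for x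
  proof (cases "x \<in> cball a r'")
    case True
    then have "x \<in> cball a r" using r'(3) ball_subset_cball by blast
    then have "0 < R x" using r(2) by auto
    then show ?thesis using weight_nonneg bump_nonneg by simp
  next
    case False
    then show ?thesis using bz[of x] by (cases "x \<in> chart_image c") (auto simp: weight_def)
  qed
  have pos: "?f x \<noteq> 0" if x: "x \<in> ball a r'" for x
  proof -
    have m: "x \<in> cball a r" "x \<in> chart_image c" using x r' rc ball_subset_cball by blast+
    have "0 < R x" using m(1) r(2) by auto
    moreover have "0 < ?b (chart_inv c x)" using x by (intro b(2)) auto
    moreover have "0 < weight c x" using m(2) volume_density_pos[OF m(2)] by (simp add: weight_def)
    ultimately show ?thesis by simp
  qed
  have fint: "integrable lborel ?f" using int(2) by (simp only: eq)
  have "(\<integral>x. ?f x \<partial>lborel) = 0" using i0 by (simp only: eq)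
  \<comment> \<open>A nonnegative function with zero integral vanishes almost everywhere, although
    this one is nonzero on a ball, which is not a null set.\<close>
  then have "AE x in lborel. ?f x = 0"
    using integral_nonneg_eq_0_iff_AE[OF fint] nn by simp
  then have "AE x in lborel. x \<notin> ball a r'" by (rule AE_mp) (use pos in auto)
  then have "emeasure lborel (ball a r') = 0" by (subst (asm) AE_iff_measurable[where N = "ball a r'"]) auto
  then have "ball a r' \<in> null_sets lborel" by (simp add: null_sets_def)
  then have "negligible (ball a r')" by (simp add: negligible_iff_null_sets null_sets_completionI)
  then show False using open_not_negligible[of "ball a r'"] r'(1) by simp
qed

end

theorem theorem3p1:
  fixes \<A> :: "('m::{t2_space, second_countable_topology}, 'd::{finite, wellorder}) chart set"
    and \<phi> g :: "('m, 'd, ((real, 'd) vec, 'd) vec) field"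
    and \<xi> \<eta> :: "('m, 'd, (real, 'd) vec) field"
    and n :: nat
  assumes "paracontact_metric_manifold n \<A> \<phi> \<xi> \<eta> g"
  shows "harmonic_vector_field \<A> g \<xi> \<longleftrightarrow>
    (\<forall>c\<in>\<A>. \<forall>x\<in>chart_image c. \<exists>k. ricci_operator (g c) x (\<xi> c x) = k *\<^sub>R \<xi> c x)"
proof -
  interpret paracontact_manifold \<A> g \<phi> \<xi> \<eta> n
    using assms by unfold_locales (auto simp: paracontact_metric_manifold_def)
  show ?thesis using harmonic_if_eigenvector eigenvector_if_harmonic by blast
qed

end
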